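(* Let $q=e^{-\omega}$ with $\omega>0$, and let $a,b,c,d,e,f,g$ be complex parameters with $\max\{|q^f|,|q^g|,|q^{c+f}|,|q^{c+g}|,|q^{d+f}|,|q^{d+g}|,|q^{c+d+f+g}|\}<1$. Then $$\frac{1}{2\pi i}\int_{-i\infty}^{i\infty}\frac{(q^{1-c+s},q^{1-d+s},q^{a+b+c+d+f+s},q^{e+g+s};q)_\infty}{(q^{a+s},q^{b+s},q^{f+s},q^{g+s};q)_\infty}\,\frac{\pi q^s}{\sin \pi(c-s)\,\sin\pi(d-s)}$$ $$\times\;{}_{3}\phi_2\left[\begin{array}{c}q^e,\ q^{a+s},\ q^{b+s}\\ q^{e+g+s},\ q^{a+b+c+d+f+s}\end{array};q,q^{c+d+f+g}\right]ds$$ $$=\frac{q^c}{\sin \pi(c-d)}\,\frac{(q,q^{1+c-d},q^{d-c},q^{a+b+c+d},q^{a+c+d+f},q^{b+c+d+f},q^{c+e+g};q)_{\infty}}{(q^{a+c},q^{a+d},q^{b+c},q^{b+d},q^{c+f},q^{c+g},q^{d+f};q)_{\infty}}\;{}_{3}\phi_2\left[\begin{array}{c}q^e,\ q^{a+c},\ q^{b+c}\\ q^{c+e+g},\ q^{a+b+c+d}\end{array};q,q^{d+g}\right],$$ where the contour of integration runs from $-i\infty$ to $i\infty$ so that the increasing sequences of poles of the integrand lie to its right and the decreasing sequences of poles lie to its left.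
   Context: The $q$-shifted factorials are $(x;q)_\infty=\prod_{k=0}^{\infty}(1-xq^k)$ and $(x;q)_n=(x;q)_\infty/(xq^n;q)_\infty$, with $(x_1,\ldots,x_m;q)_n=(x_1;q)_n\cdots(x_m;q)_n$ for $n$ an integer or $\infty$. The basic hypergeometric series ${}_3\phi_2$ is ${}_{3}\phi_2\left[\begin{array}{c}a_1,a_2,a_3\\ b_1,b_2\end{array};q,z\right]=\sum_{k=0}^\infty\frac{(a_1,a_2,a_3;q)_k}{(q,b_1,b_2;q)_k}z^k$. Here $q^x=e^{-\omega x}$, and in exponents $e$ is a parameter. As is standard for basic hypergeometric series, parameters are assumed to be such that no denominator vanishes (and that a contour separating the poles as described exists).
   Formalization: The printed right-hand side has the wrong overall sign for a contour running upward with the increasing poles on its right; the factor 1/sin π(c−d) is corrected to 1/sin π(d−c). *)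

theory Defs
  imports "HOL-Complex_Analysis.Complex_Analysis"
begin

definition qpoch_inf :: "complex \<Rightarrow> complex \<Rightarrow> complex" where
  "qpoch_inf x q = (\<Prod>k. 1 - x * q ^ k)"

(* For a natural number n the shifted factorial is the finite product.  The quotient
   (x;q)_inf / (x q^n;q)_inf has the same value whenever it makes sense (lemma below), but it
   is 0/0 when x = q^(-m) with m >= n. *)
definition qpoch :: "complex \<Rightarrow> complex \<Rightarrow> nat \<Rightarrow> complex" where
  "qpoch x q n = (\<Prod>k<n. 1 - x * q ^ k)"

lemma convergent_prod_qpoch:
  fixes x q :: complex
  assumes "norm q < 1"
  shows "convergent_prod (\<lambda>k. 1 - x * q ^ k)"
proof -
  have "summable (\<lambda>k. norm x * norm q ^ k)"
    using assms by (intro summable_mult summable_geometric) auto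
  hence "summable (\<lambda>k. norm ((1 - x * q ^ k) - 1))"
    by (simp add: norm_mult norm_power)
  thus ?thesis
    by (intro abs_convergent_prod_imp_convergent_prod summable_imp_abs_convergent_prod)
qed

lemma qpoch_eq_quotient:
  assumes "norm q < 1" "qpoch_inf (x * q ^ n) q \<noteq> 0"
  shows "qpoch x q n = qpoch_inf x q / qpoch_inf (x * q ^ n) q"
proof -
  have "qpoch_inf x q = qpoch x q n * (\<Prod>k. 1 - x * q ^ (k + n))"
    using has_prod_ignore_initial_segment'[OF convergent_prod_qpoch[OF assms(1), of x], of n]
    unfolding qpoch_inf_def qpoch_def by (simp add: has_prod_iff)
  also have "(\<Prod>k. 1 - x * q ^ (k + n)) = qpoch_inf (x * q ^ n) q"
    by (simp add: qpoch_inf_def power_add mult_ac)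
  finally show ?thesis
    using assms(2) by simp
qed

definition phi32 ::
  "complex \<Rightarrow> complex \<Rightarrow> complex \<Rightarrow> complex \<Rightarrow> complex \<Rightarrow> complex \<Rightarrow> complex \<Rightarrow> complex" where
  "phi32 a1 a2 a3 b1 b2 q z =
     (\<Sum>k. qpoch a1 q k * qpoch a2 q k * qpoch a3 q k
          / (qpoch q q k * qpoch b1 q k * qpoch b2 q k) * z ^ k)"

(* q^x for q = exp (-w): the branch is fixed by w, so the base is carried as w. *)
definition qpow :: "real \<Rightarrow> complex \<Rightarrow> complex" where
  "qpow w x = exp (- (of_real w * x))"

(* (q^(x_1), ..., q^(x_m); q)_inf, given by the list of exponents. *)
definition qfacs :: "real \<Rightarrow> complex list \<Rightarrow> complex" where
  "qfacs w xs = (\<Prod>x\<leftarrow>xs. qpoch_inf (qpow w x) (qpow w 1))"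

(* Near s = c the factor 1 / (sin (pi (c - s)) sin (pi (d - s))) behaves like
   - 1 / (pi (s - c) sin (pi (d - c))).  For an upward contour with c on its right the pole at c
   thus contributes with factor q^c / sin (pi (d - c)), which fixes the sign of the evaluation. *)
definition barnes_integrand ::
  "real \<Rightarrow> complex \<Rightarrow> complex \<Rightarrow> complex \<Rightarrow> complex \<Rightarrow> complex \<Rightarrow> complex \<Rightarrow> complex
    \<Rightarrow> complex \<Rightarrow> complex" where
  "barnes_integrand w a b c d e f g s =
     qfacs w [1 - c + s, 1 - d + s, a + b + c + d + f + s, e + g + s]
       / qfacs w [a + s, b + s, f + s, g + s]
     * (of_real pi * qpow w s / (sin (of_real pi * (c - s)) * sin (of_real pi * (d - s))))
     * phi32 (qpow w e) (qpow w (a + s)) (qpow w (b + s))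
         (qpow w (e + g + s)) (qpow w (a + b + c + d + f + s)) (qpow w 1)
         (qpow w (c + d + f + g))"

(* Candidate poles c + n of the integrand: those of 1 / sin (pi (c - s)) that are not cancelled
   by the zeros of (q^(1-c+s); q)_inf. *)
definition increasing_seq :: "complex \<Rightarrow> complex set" where
  "increasing_seq c = {c + of_nat n |n. True}"

(* The zeros of (q^(a+s); q)_inf as a function of s; it has period 2 pi i / w. *)
definition decreasing_seq :: "real \<Rightarrow> complex \<Rightarrow> complex set" where
  "decreasing_seq w a =
     {- a - of_nat n + 2 * of_real pi * \<i> * of_int m / of_real w |n m. True}"

(* Contours from -i inf to i inf.  The parameter runs over the whole real line, so no vertical
   ends are required; the contour may follow the infinite vertical families of poles, as it must
   if it has to keep them on its left.  The Lipschitz condition and the bounded distance from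
   the imaginary axis rule out contours whose length grows so fast that the integral diverges
   in spite of the exponential decay of the integrand. *)
definition imaginary_contour :: "(real \<Rightarrow> complex) \<Rightarrow> bool" where
  "imaginary_contour \<gamma> \<longleftrightarrow>
     (\<forall>T. \<gamma> piecewise_C1_differentiable_on {- T..T}) \<and>
     (\<exists>L. L-lipschitz_on UNIV \<gamma>) \<and>
     bounded (range (\<lambda>t. \<gamma> t - \<i> * of_real t))"

definition lies_left_of :: "complex \<Rightarrow> (real \<Rightarrow> complex) \<Rightarrow> bool" where
  "lies_left_of p \<gamma> \<longleftrightarrow> (\<exists>R. \<forall>z. Re z \<le> R \<longrightarrow> connected_component (- range \<gamma>) p z)"

definition lies_right_of :: "complex \<Rightarrow> (real \<Rightarrow> complex) \<Rightarrow> bool" where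
  "lies_right_of p \<gamma> \<longleftrightarrow> (\<exists>R. \<forall>z. Re z \<ge> R \<longrightarrow> connected_component (- range \<gamma>) p z)"

(* The poles of F in Inc lie to the right of the contour, those in Dec to its left.  There
   are infinitely many poles at bounded distance from the imaginary axis, so the usual
   convention for q-Barnes integrals is added that they keep a positive distance from the
   contour; otherwise the integral need not converge. *)
definition separates_poles ::
  "(real \<Rightarrow> complex) \<Rightarrow> (complex \<Rightarrow> complex) \<Rightarrow> complex set \<Rightarrow> complex set \<Rightarrow> bool" where
  "separates_poles \<gamma> F Inc Dec \<longleftrightarrow>
     (\<forall>p\<in>Inc. is_pole F p \<longrightarrow> lies_right_of p \<gamma>) \<and>
     (\<forall>p\<in>Dec. is_pole F p \<longrightarrow> lies_left_of p \<gamma>) \<and>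
     (\<exists>\<epsilon>>0. \<forall>p. is_pole F p \<longrightarrow> (\<forall>t. \<epsilon> \<le> dist p (\<gamma> t)))"

end

theory Submission
  imports Defs
begin

text \<open>The idea is to close the contour on the right and to sum the residues. Put \<open>x =
  q\<^sup>s\<close> and write \<open>A = q\<^sup>a\<close>, ..., \<open>G = q\<^sup>g\<close>,
  \<open>\<alpha> = q\<^sup>e\<close>. The integrand is \<open>P x\<close> times \<open>pi / (sin (pi *
  (c - s)) * sin (pi * (d - s)))\<close>, where \<open>P\<close> is a quotient with entire numerator and
  with denominator \<open>qinf (A * x) * qinf (B * x) * qinf (F * x) * qinf (G * x)\<close>. The zeros
  of the denominator are the decreasing sequences of poles; the zeros of the numerator cancel those
  zeros of the sines that lie to the left of \<open>c\<close> and \<open>d\<close>. What remains on the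
  right are the nodes \<open>c + n\<close> and \<open>d + n\<close>, so the integral, divided by
  \<open>2 * pi * \<i>\<close>, is \<open>((\<Sum>n. P (C * q ^ n)) - (\<Sum>n. P (D * q ^ n))) / sin
  (pi * (d - c))\<close>.

  The difference of the two series is evaluated by \<open>node_sums_evaluation\<close>. If
  \<open>\<alpha> = 1\<close>, it is the nonterminating \<open>q\<close>-Saalschuetz formula. Its two
  sides satisfy the same \<open>q\<close>-difference equation in \<open>F\<close>, by creative
  telescoping, and the constant is found at \<open>F = 1 / C\<close>, where the series collapse. For
  general \<open>\<alpha>\<close> let \<open>A\<close> vary, call it \<open>X\<close>, and put \<open>t
  = C * D * F\<close>. There are sequences of functions \<open>\<delta> k X\<close> on either side that
  start with the \<open>q\<close>-Saalschuetz terms and satisfy \<open>X * (1 - q ^ (k + 1)) * \<delta>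
  (k + 1) X = \<delta> k X - (1 - X * t) * \<delta> k (X * q)\<close>. Because both sides obey the same
  recurrence, the formula for \<open>k = 0\<close> implies the formula for every \<open>k\<close>
  (\<open>lifted_coefficient_identity\<close>). Multiplying by \<open>qfin \<alpha> k * G ^ k\<close>
  and summing over \<open>k\<close> with the \<open>q\<close>-binomial theorem produces the two
  \<open>3phi2\<close> series (\<open>lifted_saalschuetz\<close>).

  Closing the contour needs care, because \<open>P\<close> has the period \<open>2 * pi * \<i> /
  w\<close> in \<open>s\<close>: infinitely many poles accompany the curve on its left, and being on the
  left or on the right is a topological condition only. For a loop that consists of an arc of the curve
  and three sides of a box, the condition determines the winding number around every pole that is not
  near one of the two truncation heights: the loop can be enlarged until it misses a path that joins the
  pole to a point far away (\<open>winding_box_loop_left\<close>,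
  \<open>winding_box_loop_right\<close>). Near the truncation heights the winding number is merely
  bounded by length over distance, that is, by a linear function of the height. However, by periodicity
  there is a bounded number of such poles, and their residues decay exponentially, because the two sines
  in the denominator grow exponentially. So these poles do not contribute in the limit
  (\<open>contour_integral_residues\<close>).\<close>

section \<open>Infinite and finite q-shifted factorials\<close>

locale q_base =
  fixes q :: complex
  assumes norm_q: "norm q < 1" and q_nz: "q \<noteq> 0"
begin

abbreviation qinf :: "complex \<Rightarrow> complex" where "qinf x \<equiv> qpoch_inf x q"
abbreviation qfin :: "complex \<Rightarrow> nat \<Rightarrow> complex" where "qfin x n \<equiv> qpoch x q n"

lemma qfin_0 [simp]: "qfin x 0 = 1"
  by (simp add: qpoch_def)

lemma qfin_Suc: "qfin x (Suc n) = qfin x n * (1 - x * q ^ n)"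
  by (simp add: qpoch_def)

text \<open>Splitting off the first \<open>n\<close> factors is possible for every \<open>x\<close>,
  also when \<open>qinf (x * q ^ n)\<close> vanishes; the recurrences below rely on this multiplicative
  form rather than on the quotient.\<close>
lemma qinf_split: "qinf x = qfin x n * qinf (x * q ^ n)"
proof -
  have "qinf x = qfin x n * (\<Prod>k. 1 - x * q ^ (k + n))"
    using has_prod_ignore_initial_segment'[OF convergent_prod_qpoch[OF norm_q, of x], of n]
    unfolding qpoch_inf_def qpoch_def by (simp add: has_prod_iff)
  thus ?thesis
    by (simp add: qpoch_inf_def power_add mult_ac)
qed

lemma qinf_rec: "qinf x = (1 - x) * qinf (x * q)"
  using qinf_split[of x 1] by (simp add: qfin_Suc)

lemma qfin_add: "qfin x (m + n) = qfin x m * qfin (x * q ^ m) n"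
  by (induction n) (simp_all add: qfin_Suc power_add mult_ac)

lemma qfin_rec: "qfin x (Suc n) = (1 - x) * qfin (x * q) n"
  using qfin_add[of x 1 n] by (simp add: qfin_Suc)

lemma qinf_0 [simp]: "qinf 0 = 1"
  by (simp add: qpoch_inf_def)

lemma qfin_zero_arg [simp]: "qfin 0 n = 1"
  by (simp add: qpoch_def)

lemma qinf_eq_0_iff: "qinf x = 0 \<longleftrightarrow> (\<exists>k. x * q ^ k = 1)"
proof -
  have "(\<lambda>k. 1 - x * q ^ k) has_prod qinf x"
    unfolding qpoch_inf_def using convergent_prod_qpoch[OF norm_q, of x]
    by (simp add: convergent_prod_has_prod)
  hence "qinf x = 0 \<longleftrightarrow> (\<exists>k. 1 - x * q ^ k = 0)"
    by (subst has_prod_eq_0_iff) auto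
  thus ?thesis by (simp add: eq_commute[of 1])
qed

lemma qinf_1 [simp]: "qinf 1 = 0"
  by (subst qinf_eq_0_iff, rule exI[of _ 0]) simp

lemma qinf_nonzero: "norm x < 1 \<Longrightarrow> qinf x \<noteq> 0"
proof
  assume x: "norm x < 1" and "qinf x = 0"
  then obtain k where "x * q ^ k = 1" by (auto simp: qinf_eq_0_iff)
  hence "norm x * norm q ^ k = 1" by (metis norm_mult norm_power norm_one)
  moreover have "norm x * norm q ^ k \<le> norm x * 1"
    using norm_q by (intro mult_left_mono power_le_one) auto
  ultimately show False using x by simp
qed

lemma qinf_shift_nonzero: "qinf x \<noteq> 0 \<Longrightarrow> qinf (x * q ^ n) \<noteq> 0"
  using qinf_split[of x n] by auto

lemma qfin_nonzero: "qinf x \<noteq> 0 \<Longrightarrow> qfin x n \<noteq> 0"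
  using qinf_split[of x n] by auto

lemma qfin_q_nonzero [simp]: "qfin q n \<noteq> 0"
  by (intro qfin_nonzero qinf_nonzero norm_q)

lemma qfin_tendsto: "(\<lambda>n. qfin x n) \<longlonglongrightarrow> qinf x"
proof -
  have "(\<lambda>n. \<Prod>k\<le>n. 1 - x * q ^ k) \<longlonglongrightarrow> qinf x"
    unfolding qpoch_inf_def by (intro convergent_prod_LIMSEQ convergent_prod_qpoch norm_q)
  hence "(\<lambda>n. qfin x (Suc n)) \<longlonglongrightarrow> qinf x"
    by (simp add: qpoch_def lessThan_Suc_atMost)
  thus ?thesis by (rule LIMSEQ_imp_Suc)
qed

text \<open>Since \<open>1 + u \<le> exp u\<close>, the product is dominated by the exponential of a
  geometric series. The bound is uniform in \<open>n\<close>, so it passes to the infinite product and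
  makes interchanges of sums and limits routine.\<close>
lemma norm_qfin_le: "norm (qfin x n) \<le> exp (norm x / (1 - norm q))"
proof -
  have "norm (qfin x n) = (\<Prod>k<n. norm (1 - x * q ^ k))"
    by (simp add: qpoch_def prod_norm)
  also have "\<dots> \<le> (\<Prod>k<n. exp (norm x * norm q ^ k))"
  proof (intro prod_mono conjI)
    fix k
    have "norm (1 - x * q ^ k) \<le> 1 + norm x * norm q ^ k"
      using norm_triangle_ineq4[of 1 "x * q ^ k"] by (simp add: norm_mult norm_power)
    also have "\<dots> \<le> exp (norm x * norm q ^ k)" by (rule exp_ge_add_one_self)
    finally show "norm (1 - x * q ^ k) \<le> exp (norm x * norm q ^ k)" .
  qed auto
  also have "\<dots> = exp (\<Sum>k<n. norm x * norm q ^ k)" by (simp add: exp_sum)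
  also have "(\<Sum>k<n. norm x * norm q ^ k) \<le> (\<Sum>k. norm x * norm q ^ k)"
    using norm_q by (intro sum_le_suminf summable_mult summable_geometric) auto
  also have "\<dots> = norm x / (1 - norm q)"
    using norm_q by (subst suminf_mult) (auto simp: suminf_geometric summable_geometric)
  finally show ?thesis by simp
qed

lemma norm_qinf_le: "norm (qinf x) \<le> exp (norm x / (1 - norm q))"
  by (rule tendsto_upperbound[OF tendsto_norm[OF qfin_tendsto]]) (simp_all add: norm_qfin_le)

lemma norm_qfin_le':
  assumes "norm x \<le> r"
  shows "norm (qfin x n) \<le> exp (r / (1 - norm q))" "norm (qinf x) \<le> exp (r / (1 - norm q))"
proof -
  have "exp (norm x / (1 - norm q)) \<le> exp (r / (1 - norm q))"
    using assms norm_q by (simp add: divide_right_mono)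
  thus "norm (qfin x n) \<le> exp (r / (1 - norm q))" "norm (qinf x) \<le> exp (r / (1 - norm q))"
    using norm_qfin_le[of x n] norm_qinf_le[of x] by linarith+
qed

lemma norm_mult_power_le: "norm x \<le> r \<Longrightarrow> norm (x * q ^ n) \<le> r"
proof -
  assume "norm x \<le> r"
  moreover have "norm (x * q ^ n) \<le> norm x * 1"
    unfolding norm_mult norm_power using norm_q by (intro mult_left_mono power_le_one) auto
  ultimately show ?thesis by simp
qed

lemma holomorphic_qinf_UNIV: "(\<lambda>x. qinf x) holomorphic_on UNIV"
proof (rule holomorphic_uniform_sequence[where f = "\<lambda>n x. qfin x n"])
  show "(\<lambda>x. qfin x n) holomorphic_on UNIV" for n
    unfolding qpoch_def by (intro holomorphic_intros)
  fix x :: complex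
  have "uniform_limit (cball x 1) (\<lambda>n x. qfin x n) (\<lambda>x. qinf x) sequentially"
  proof -
    have "uniformly_convergent_on (cball x 1) (\<lambda>N x. \<Prod>n<N. 1 - x * q ^ n)"
    proof (rule uniformly_convergent_on_prod')
      show "uniformly_convergent_on (cball x 1) (\<lambda>N x. \<Sum>n<N. norm (1 - x * q ^ n - 1))"
      proof (rule Weierstrass_m_test')
        fix n y assume "y \<in> cball x 1"
        hence "norm y \<le> norm x + 1"
          by (metis mem_cball dist_norm norm_minus_commute add.commute diff_le_eq order_trans norm_triangle_ineq2)
        thus "norm (norm (1 - y * q ^ n - 1)) \<le> (norm x + 1) * norm q ^ n"
          by (simp add: norm_mult norm_power mult_right_mono)
      qed (use norm_q in \<open>auto intro!: summable_mult summable_geometric\<close>)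
    qed (auto intro!: continuous_intros)
    then obtain l where l: "uniform_limit (cball x 1) (\<lambda>n x. qfin x n) l sequentially"
      by (auto simp: uniformly_convergent_on_def qpoch_def)
    have "l y = qinf y" if "y \<in> cball x 1" for y
      using tendsto_uniform_limitI[OF l that] qfin_tendsto[of y] LIMSEQ_unique by blast
    thus ?thesis
      using l by (subst uniform_limit_cong'[where g = "\<lambda>n x. qfin x n" and i = l]) auto
  qed
  thus "\<exists>d>0. cball x d \<subseteq> UNIV \<and> uniform_limit (cball x d) (\<lambda>n x. qfin x n) (\<lambda>x. qinf x) sequentially"
    by (intro exI[of _ 1]) auto
qed auto

lemma holomorphic_qinf [holomorphic_intros]:
  "f holomorphic_on S \<Longrightarrow> (\<lambda>x. qinf (f x)) holomorphic_on S"
  using holomorphic_on_compose[of f S "\<lambda>x. qinf x"] holomorphic_on_subset[OF holomorphic_qinf_UNIV]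
  by (auto simp: o_def)

lemma holomorphic_qfin [holomorphic_intros]:
  "f holomorphic_on S \<Longrightarrow> (\<lambda>x. qfin (f x) n) holomorphic_on S"
  unfolding qpoch_def by (intro holomorphic_intros)

lemma tendsto_qinf [tendsto_intros]:
  assumes "(f \<longlongrightarrow> l) F"
  shows "((\<lambda>x. qinf (f x)) \<longlongrightarrow> qinf l) F"
proof (rule isCont_tendsto_compose[OF _ assms])
  show "isCont (\<lambda>x. qinf x) l"
    using holomorphic_on_imp_continuous_on[OF holomorphic_qinf_UNIV]
    by (simp add: continuous_on_eq_continuous_at)
qed

lemma tendsto_qpower: "(\<lambda>n. x * q ^ n) \<longlonglongrightarrow> 0"
  using norm_q by (intro tendsto_mult_right_zero LIMSEQ_power_zero)

lemma tendsto_qinf_power: "(\<lambda>n. qinf (x * q ^ n)) \<longlonglongrightarrow> 1"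
  using tendsto_qinf[OF tendsto_qpower[of x]] by simp

text \<open>Applied to quotients of \<open>q\<close>-products along a sequence \<open>y * q ^ n\<close>.
  Single terms may have a vanishing denominator; their value is then 0, and the limit is the
  same.\<close>
lemma bounded_ratio:
  assumes "f \<longlonglongrightarrow> l" "g \<longlonglongrightarrow> (m::complex)" "m \<noteq> 0"
  obtains K where "K > 0" "\<And>n::nat. norm (f n / g n :: complex) \<le> K"
proof -
  have "(\<lambda>n. f n / g n) \<longlonglongrightarrow> l / m" by (intro tendsto_divide assms)
  hence "Bseq (\<lambda>n. f n / g n)" by (intro convergent_imp_Bseq) (auto simp: convergent_def)
  thus ?thesis using that by (auto elim!: BseqE)
qed

lemma bounded_inv_qfin_q:
  obtains K where "K > 0" "\<And>n. norm (1 / qfin q n) \<le> K"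
  using bounded_ratio[OF tendsto_const[of 1] qfin_tendsto qinf_nonzero[OF norm_q]] by blast

lemma bounded_qbinom_coeff:
  obtains K where "K > 0" "\<And>n. norm (qfin b n / qfin q n) \<le> K"
  using bounded_ratio[OF qfin_tendsto qfin_tendsto qinf_nonzero[OF norm_q], of b] by blast

lemma summable_bounded_geometric:
  fixes f :: "nat \<Rightarrow> complex"
  assumes "\<And>n. norm (f n) \<le> K * r ^ n" "0 \<le> r" "r < 1"
  shows "summable f"
  by (rule summable_comparison_test'[where g = "\<lambda>n. K * r ^ n" and N = 0])
     (use assms in \<open>auto intro!: summable_mult summable_geometric\<close>)

text \<open>The coefficients satisfy a two-term recurrence that turns into \<open>(1 - y) * g y = (1 - b
  * y) * g (y * q)\<close> for the power series \<open>g\<close>. Iterating moves the argument to 0,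
  where \<open>g\<close> is continuous with value 1.\<close>
theorem q_binomial:
  assumes z: "norm z < 1"
  shows "(\<lambda>m. qfin b m / qfin q m * z ^ m) sums (qinf (b * z) / qinf z)"
proof -
  define c where "c = (\<lambda>m. qfin b m / qfin q m)"
  define g where "g = (\<lambda>z. \<Sum>m. c m * z ^ m)"
  obtain K where K: "K > 0" "\<And>n. norm (c n) \<le> K"
    using bounded_qbinom_coeff[of b] unfolding c_def by blast
  have sm: "summable (\<lambda>m. c m * y ^ m)" if "norm y < 1" for y
    by (rule summable_bounded_geometric[where K = K and r = "norm y"])
       (use K that in \<open>auto simp: norm_mult norm_power intro!: mult_right_mono\<close>)
  have crec: "c (Suc m) * (1 - q ^ Suc m) = c m * (1 - b * q ^ m)" for m
    using qfin_q_nonzero[of "Suc m"] unfolding c_def qfin_Suc by (simp add: field_simps)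
  have rec: "(1 - y) * g y = (1 - b * y) * g (y * q)" if y: "norm y < 1" for y
  proof -
    have yq: "norm (y * q) < 1" using norm_mult_power_le[of y "norm y" 1] y by simp
    have "g y - g (y * q) = (\<Sum>m. c m * y ^ m - c m * (y * q) ^ m)"
      unfolding g_def by (intro suminf_diff sm y yq)
    also have "\<dots> = (\<Sum>m. c (Suc m) * y ^ Suc m - c (Suc m) * (y * q) ^ Suc m)"
      by (subst suminf_split_head) (auto intro!: summable_diff sm y yq)
    also have "\<dots> = (\<Sum>m. y * (c m * y ^ m) - (b * y) * (c m * (y * q) ^ m))"
    proof (rule suminf_cong)
      fix m
      have "c (Suc m) * y ^ Suc m - c (Suc m) * (y * q) ^ Suc m
          = (c (Suc m) * (1 - q ^ Suc m)) * y ^ Suc m"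
        by (simp add: power_mult_distrib algebra_simps)
      also have "\<dots> = y * (c m * y ^ m) - (b * y) * (c m * (y * q) ^ m)"
        unfolding crec by (simp add: power_mult_distrib algebra_simps)
      finally show "c (Suc m) * y ^ Suc m - c (Suc m) * (y * q) ^ Suc m = \<dots>" .
    qed
    also have "\<dots> = y * g y - (b * y) * g (y * q)"
      unfolding g_def by (subst suminf_diff [symmetric])
        (auto intro!: summable_mult sm y yq simp: suminf_mult[OF sm[OF y]] suminf_mult[OF sm[OF yq]])
    finally show ?thesis by (simp add: algebra_simps)
  qed
  have iter: "qfin z n * g z = qfin (b * z) n * g (z * q ^ n)" for n
  proof (induction n)
    case (Suc n)
    have "norm (z * q ^ n) < 1" using norm_mult_power_le[of z "norm z" n] z by simp
    note r = rec[OF this]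
    have "qfin z (Suc n) * g z = (1 - z * q ^ n) * (qfin z n * g z)"
      by (simp add: qfin_Suc)
    also have "\<dots> = qfin (b * z) n * ((1 - z * q ^ n) * g (z * q ^ n))"
      unfolding Suc by (simp add: mult_ac)
    also have "\<dots> = qfin (b * z) (Suc n) * g (z * q ^ Suc n)"
      unfolding r by (simp add: qfin_Suc mult_ac)
    finally show ?case .
  qed simp
  have "g 0 = 1" unfolding g_def by (subst powser_zero) (simp add: c_def)
  moreover have "isCont g 0"
  proof -
    have "norm ((norm z + 1) / 2 :: real) < 1" using z by simp
    hence "norm (of_real ((norm z + 1) / 2) :: complex) < 1" by (simp only: norm_of_real real_norm_def)
    from sm[OF this] show ?thesis unfolding g_def
    proof (rule isCont_powser)
      show "norm (0 :: complex) < norm (of_real ((norm z + 1) / 2) :: complex)"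
        using norm_ge_zero[of z] by (simp only: norm_of_real norm_zero) (simp add: add_nonneg_pos)
    qed
  qed
  ultimately have "(\<lambda>n. g (z * q ^ n)) \<longlonglongrightarrow> 1"
    using isCont_tendsto_compose[OF _ tendsto_qpower, of g z] by simp
  hence "(\<lambda>n. qfin (b * z) n * g (z * q ^ n)) \<longlonglongrightarrow> qinf (b * z) * 1"
    by (intro tendsto_mult qfin_tendsto)
  hence "(\<lambda>n. qfin z n * g z) \<longlonglongrightarrow> qinf (b * z)" by (simp only: iter) simp
  moreover have "(\<lambda>n. qfin z n * g z) \<longlonglongrightarrow> qinf z * g z"
    by (intro tendsto_mult qfin_tendsto tendsto_const)
  ultimately have "qinf z * g z = qinf (b * z)" by (rule LIMSEQ_unique[symmetric])
  hence "g z = qinf (b * z) / qinf z" using qinf_nonzero[OF z] by (simp add: field_simps)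
  thus ?thesis using summable_sums[OF sm[OF z]] unfolding g_def c_def by simp
qed

section \<open>The nonterminating q-Saalschuetz formula\<close>

text \<open>The terms of the two series in the nonterminating \<open>q\<close>-Saalschuetz formula,
  multiplied by \<open>qinf (F * C)\<close>. This normalisation makes each term an entire function of
  \<open>F\<close>.\<close>
definition saal_term where
  "saal_term A B C D F n = C * q ^ n * qinf (q ^ Suc n) * qinf (C / D * q ^ Suc n)
     * qinf (A * B * C * D * F * C * q ^ n) / (qinf (A * C * q ^ n) * qinf (B * C * q ^ n))
     * qfin (F * C) n"

text \<open>An antidifference for the \<open>q\<close>-difference operator in \<open>F\<close> that acts
  on \<open>saal_term\<close>. The value at 0 is the value of the formula for \<open>Suc m\<close>
  continued to index 0, where the factor \<open>qinf 1\<close> vanishes.\<close>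
definition saal_cert where
  "saal_cert A B C D F n = (case n of 0 \<Rightarrow> 0 | Suc m \<Rightarrow>
     qinf (q ^ n) * qinf (C / D * q ^ n) * qinf (A * B * C * D * F * C * q ^ n)
       / (qinf (A * C * q ^ n) * qinf (B * C * q ^ n)) * qfin (F * q * C) m)"

lemma qinf_power_Suc: "qinf (y * q ^ n) = (1 - y * q ^ n) * qinf (y * q ^ Suc n)"
  using qinf_rec[of "y * q ^ n"] by (simp add: mult_ac)

text \<open>The rational core of the telescoping step: with \<open>y = q ^ n\<close>, all four
  quantities have the common factor \<open>K\<close>, and a polynomial identity remains.\<close>
lemma saal_step_algebra:
  fixes A B C D F y K :: complex
  assumes "D \<noteq> 0"
  shows "(1 - F * A * C * D) * (1 - F * B * C * D) * (C * y * (1 - F * C * y) * K)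
           - (1 - F * D) * (C * y * (1 - A * B * C * D * F * C * y) * (1 - F * C) * K)
         = F * C * D * ((1 - A * C * y) * (1 - B * C * y) * (1 - F * C * y) * K
             - (1 - y) * (1 - C / D * y) * (1 - A * B * C * D * F * C * y) * K)"
proof -
  define E where "E = C / D"
  have C: "C = E * D" using assms by (simp add: E_def)
  show ?thesis unfolding E_def[symmetric] unfolding C by (simp add: algebra_simps)
qed

text \<open>Creative telescoping in \<open>F\<close>: the combination of the series at \<open>F *
  q\<close> and at \<open>F\<close> is a difference in \<open>n\<close>, so its sum collapses to a
  boundary term.\<close>
lemma saal_step:
  assumes "C \<noteq> 0" "D \<noteq> 0" "qinf (A * C) \<noteq> 0" "qinf (B * C) \<noteq> 0"
  shows "(1 - F * A * C * D) * (1 - F * B * C * D) * saal_term A B C D (F * q) n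
           - (1 - F * D) * saal_term A B C D F n
         = F * C * D * (saal_cert A B C D F (Suc n) - saal_cert A B C D F n)"
proof -
  have nz: "qinf (A * C * q ^ n) \<noteq> 0" "qinf (B * C * q ^ n) \<noteq> 0" for n
    using qinf_shift_nonzero assms by blast+
  define y where "y = q ^ n"
  define a b c d e where
    "a = qinf (q ^ Suc n)" and "b = qinf (C / D * q ^ Suc n)"
    and "c = qinf (A * B * C * D * F * C * q ^ Suc n)"
    and "d = qinf (A * C * q ^ Suc n)" and "e = qinf (B * C * q ^ Suc n)"
  note abc = a_def b_def c_def d_def e_def
  have de: "d \<noteq> 0" "e \<noteq> 0" unfolding abc using nz by blast+
  have r: "qinf (q ^ n) = (1 - y) * a" "qinf (C / D * q ^ n) = (1 - C / D * y) * b"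
    "qinf (A * B * C * D * F * C * q ^ n) = (1 - A * B * C * D * F * C * y) * c"
    "qinf (A * C * q ^ n) = (1 - A * C * y) * d" "qinf (B * C * q ^ n) = (1 - B * C * y) * e"
    unfolding abc y_def using qinf_power_Suc[of 1 n]
    by (simp_all only: mult_1) (rule qinf_power_Suc)+
  have l: "1 - A * C * y \<noteq> 0" "1 - B * C * y \<noteq> 0"
    using nz[of n] r by auto
  have c': "qinf (A * B * C * D * (F * q) * C * q ^ n) = c"
    unfolding c_def by (rule arg_cong[of _ _ qinf]) (simp add: mult_ac)
  show ?thesis
  proof (cases n)
    case 0
    have y: "y = 1" using 0 by (simp add: y_def)
    have t1: "saal_term A B C D (F * q) n = C * (a * b * c / ((1 - A * C) * d * ((1 - B * C) * e)))"
      unfolding saal_term_def abc[symmetric] r c' using 0 y by simp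
    have t2: "saal_term A B C D F n = C * (1 - A * B * C * D * F * C) * (a * b * c / ((1 - A * C) * d * ((1 - B * C) * e)))"
      unfolding saal_term_def abc[symmetric] r using 0 y by simp
    have t3: "saal_cert A B C D F (Suc n) = (1 - A * C) * (1 - B * C) * (a * b * c / ((1 - A * C) * d * ((1 - B * C) * e)))"
      unfolding saal_cert_def abc[symmetric] using 0 l y de by simp
    have t4: "saal_cert A B C D F n = 0" using 0 by (simp add: saal_cert_def)
    show ?thesis unfolding t1 t2 t3 t4 by (simp only: algebra_simps) simp
  next
    case (Suc m)
    define f where "f = qfin (F * q * C) m"
    have f: "qfin (F * q * C) n = f * (1 - F * C * y)" "qfin (F * C) n = (1 - F * C) * f"
      unfolding f_def Suc y_def using qfin_rec[of "F * C" m] by (simp_all add: qfin_Suc mult_ac)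
    define K where "K = a * b * c * f / ((1 - A * C * y) * d * ((1 - B * C * y) * e))"
    have t1: "saal_term A B C D (F * q) n = C * y * (1 - F * C * y) * K"
      unfolding saal_term_def abc[symmetric] r c' f K_def by (simp add: y_def[symmetric])
    have t2: "saal_term A B C D F n = C * y * (1 - A * B * C * D * F * C * y) * (1 - F * C) * K"
      unfolding saal_term_def abc[symmetric] r f K_def by (simp add: y_def[symmetric])
    have t3: "saal_cert A B C D F (Suc n) = (1 - A * C * y) * (1 - B * C * y) * (1 - F * C * y) * K"
      unfolding saal_cert_def abc[symmetric] K_def using l de by (simp add: f)
    have t4: "saal_cert A B C D F n = (1 - y) * (1 - C / D * y) * (1 - A * B * C * D * F * C * y) * K"
    proof -
      have "saal_cert A B C D F n = qinf (q ^ n) * qinf (C / D * q ^ n) * qinf (A * B * C * D * F * C * q ^ n)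
       / (qinf (A * C * q ^ n) * qinf (B * C * q ^ n)) * f"
        unfolding saal_cert_def f_def by (simp add: Suc)
      thus ?thesis unfolding r K_def by simp
    qed
    show ?thesis unfolding t1 t2 t3 t4 by (rule saal_step_algebra) fact
  qed
qed

lemma saal_cert_tendsto:
  "saal_cert A B C D F \<longlonglongrightarrow> qinf (F * q * C)"
proof -
  have "(\<lambda>m. qinf (1 * q ^ Suc m) * qinf (C / D * q ^ Suc m) * qinf (A * B * C * D * F * C * q ^ Suc m)
       / (qinf (A * C * q ^ Suc m) * qinf (B * C * q ^ Suc m)) * qfin (F * q * C) m)
       \<longlonglongrightarrow> 1 * 1 * 1 / (1 * 1) * qinf (F * q * C)"
    by (intro tendsto_mult tendsto_divide LIMSEQ_Suc[OF tendsto_qinf_power] qfin_tendsto) auto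
  hence "(\<lambda>m. saal_cert A B C D F (Suc m)) \<longlonglongrightarrow> qinf (F * q * C)"
    by (simp add: saal_cert_def)
  thus ?thesis by (rule LIMSEQ_imp_Suc)
qed

lemma saal_term_bound:
  obtains K where "\<And>(F :: complex) n. norm F \<le> r \<Longrightarrow> norm (saal_term A B C D F n) \<le> K * norm q ^ n"
proof -
  have "(\<lambda>n. qinf (1 * q ^ Suc n) * qinf (C / D * q ^ Suc n)) \<longlonglongrightarrow> 1 * 1"
    by (intro tendsto_mult LIMSEQ_Suc[OF tendsto_qinf_power])
  moreover have "(\<lambda>n. qinf (A * C * q ^ n) * qinf (B * C * q ^ n)) \<longlonglongrightarrow> 1 * 1"
    by (intro tendsto_mult tendsto_qinf_power)
  ultimately obtain K where K: "K > 0"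
    "\<And>n. norm (qinf (1 * q ^ Suc n) * qinf (C / D * q ^ Suc n)
            / (qinf (A * C * q ^ n) * qinf (B * C * q ^ n))) \<le> K"
    by (rule bounded_ratio) auto
  define E1 where "E1 = exp (norm (A * B * C * D) * r * norm C / (1 - norm q))"
  define E2 where "E2 = exp (r * norm C / (1 - norm q))"
  show ?thesis
  proof (rule that[of "norm C * K * E1 * E2"])
    fix F :: complex and n assume F: "norm F \<le> r"
    have r: "0 \<le> r" using F norm_ge_zero order_trans by blast
    have 1: "norm (qinf (A * B * C * D * F * C * q ^ n)) \<le> E1"
      unfolding E1_def by (intro norm_qfin_le' norm_mult_power_le)
        (use F r in \<open>auto simp: norm_mult intro!: mult_mono\<close>)
    have 2: "norm (qfin (F * C) n) \<le> E2"
      unfolding E2_def by (intro norm_qfin_le') (use F r in \<open>auto simp: norm_mult intro!: mult_mono\<close>)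
    have "norm (saal_term A B C D F n) = norm C * norm q ^ n
        * norm (qinf (1 * q ^ Suc n) * qinf (C / D * q ^ Suc n)
            / (qinf (A * C * q ^ n) * qinf (B * C * q ^ n)))
        * norm (qinf (A * B * C * D * F * C * q ^ n)) * norm (qfin (F * C) n)"
      unfolding saal_term_def by (simp add: norm_mult norm_divide norm_power)
    also have "\<dots> \<le> norm C * norm q ^ n * K * E1 * E2"
      by (intro mult_mono mult_nonneg_nonneg K 1 2) (use K in \<open>auto simp: E1_def E2_def\<close>)
    finally show "norm (saal_term A B C D F n) \<le> norm C * K * E1 * E2 * norm q ^ n"
      by (simp add: mult_ac)
  qed
qed

lemma summable_saal_term: "summable (saal_term A B C D F)"
proof -
  obtain K where "\<And>F' n. norm F' \<le> norm F \<Longrightarrow> norm (saal_term A B C D F' n) \<le> K * norm q ^ n"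
    using saal_term_bound by blast
  thus ?thesis using norm_q by (intro summable_bounded_geometric[of _ K "norm q"]) auto
qed

lemma saal_rec:
  assumes "C \<noteq> 0" "D \<noteq> 0" "qinf (A * C) \<noteq> 0" "qinf (B * C) \<noteq> 0"
  shows "(1 - F * A * C * D) * (1 - F * B * C * D) * suminf (saal_term A B C D (F * q))
           - (1 - F * D) * suminf (saal_term A B C D F)
         = F * C * D * qinf (F * q * C)"
proof -
  have "(\<lambda>n. F * C * D * (saal_cert A B C D F (Suc n) - saal_cert A B C D F n)) sums
      (F * C * D * (qinf (F * q * C) - saal_cert A B C D F 0))"
    by (intro sums_mult telescope_sums saal_cert_tendsto)
  moreover have "(\<lambda>n. (1 - F * A * C * D) * (1 - F * B * C * D) * saal_term A B C D (F * q) n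
           - (1 - F * D) * saal_term A B C D F n) sums
      ((1 - F * A * C * D) * (1 - F * B * C * D) * suminf (saal_term A B C D (F * q))
           - (1 - F * D) * suminf (saal_term A B C D F))"
    by (intro sums_diff sums_mult summable_sums summable_saal_term)
  ultimately show ?thesis
    unfolding saal_step[OF assms] by (simp add: sums_iff saal_cert_def)
qed

text \<open>Dominated convergence (Tannery) as \<open>F * q ^ i\<close> tends to 0; the geometric
  majorant is uniform on bounded sets of \<open>F\<close>.\<close>
lemma saal_suminf_tendsto:
  "(\<lambda>i. suminf (saal_term A B C D (F * q ^ i))) \<longlonglongrightarrow> suminf (saal_term A B C D 0)"
proof -
  obtain K where K: "\<And>F' n. norm F' \<le> norm F \<Longrightarrow> norm (saal_term A B C D F' n) \<le> K * norm q ^ n"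
    using saal_term_bound by blast
  have "(\<lambda>i. saal_term A B C D (F * q ^ i) k) \<longlonglongrightarrow> saal_term A B C D 0 k" for k
  proof -
    have "isCont (\<lambda>F. saal_term A B C D F k) 0"
    proof -
      define K0 where "K0 = C * q ^ k * qinf (q ^ Suc k) * qinf (C / D * q ^ Suc k)
        / (qinf (A * C * q ^ k) * qinf (B * C * q ^ k))"
      have "saal_term A B C D F k = K0 * qinf (F * (A * B * C * D * C * q ^ k)) * qfin (F * C) k" for F
        unfolding saal_term_def K0_def by (simp add: mult_ac)
      hence "(\<lambda>F. saal_term A B C D F k) holomorphic_on UNIV"
        by (simp only:) (intro holomorphic_intros)
      hence "continuous_on UNIV (\<lambda>F. saal_term A B C D F k)" by (rule holomorphic_on_imp_continuous_on)
      thus ?thesis by (simp add: continuous_on_eq_continuous_at)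
    qed
    from isCont_tendsto_compose[OF this tendsto_qpower[of F]] show ?thesis .
  qed
  moreover have "eventually (\<lambda>(k, i). norm (saal_term A B C D (F * q ^ i) k) \<le> K * norm q ^ k)
      (at_top \<times>\<^sub>F sequentially)"
    by (intro always_eventually allI) (auto intro!: K norm_mult_power_le)
  moreover have "summable (\<lambda>k. K * norm q ^ k)"
    using norm_q by (intro summable_mult summable_geometric) auto
  ultimately show ?thesis
    using tannerys_theorem[of "\<lambda>k i. saal_term A B C D (F * q ^ i) k" "saal_term A B C D 0" sequentially
      "\<lambda>k. K * norm q ^ k"] by simp
qed

text \<open>The antisymmetric combination of the series over \<open>C\<close> and over \<open>D\<close>.
  With these weights the inhomogeneous terms of \<open>saal_rec\<close> for the two series
  cancel.\<close>
definition saal_sum where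
  "saal_sum A B C D F = qinf (F * D) * suminf (saal_term A B C D F)
     - qinf (F * C) * suminf (saal_term A B D C F)"

context
  fixes A B C D :: complex
  assumes CD: "C \<noteq> 0" "D \<noteq> 0"
    and nz: "qinf (A * C) \<noteq> 0" "qinf (B * C) \<noteq> 0" "qinf (A * D) \<noteq> 0" "qinf (B * D) \<noteq> 0"
begin

lemma saal_sum_rec:
  "saal_sum A B C D F = (1 - F * A * C * D) * (1 - F * B * C * D) * saal_sum A B C D (F * q)"
proof -
  define N where "N = (1 - F * A * C * D) * (1 - F * B * C * D)"
  have 1: "N * suminf (saal_term A B C D (F * q))
           - (1 - F * D) * suminf (saal_term A B C D F) = F * C * D * qinf (F * C * q)"
    unfolding N_def using saal_rec[OF CD nz(1,2), of F] by (simp add: mult_ac)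
  have 2: "N * suminf (saal_term A B D C (F * q))
           - (1 - F * C) * suminf (saal_term A B D C F) = F * C * D * qinf (F * D * q)"
    unfolding N_def using saal_rec[OF CD(2,1) nz(3,4), of F] by (simp add: mult_ac)
  have Fq: "F * q * C = F * C * q" "F * q * D = F * D * q" by simp_all
  show ?thesis
    unfolding saal_sum_def qinf_rec[of "F * D"] qinf_rec[of "F * C"] N_def[symmetric] Fq
    using arg_cong[OF 1, of "\<lambda>z. z * qinf (F * D * q)"] arg_cong[OF 2, of "\<lambda>z. z * qinf (F * C * q)"]
    by (simp add: algebra_simps)
qed

lemma saal_sum_eq:
  "saal_sum A B C D F = qinf (F * A * C * D) * qinf (F * B * C * D) * saal_sum A B C D 0"
proof -
  have iter: "saal_sum A B C D F = qfin (F * A * C * D) n * qfin (F * B * C * D) n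
      * saal_sum A B C D (F * q ^ n)" for n
  proof (induction n)
    case (Suc n)
    show ?case unfolding Suc saal_sum_rec[of "F * q ^ n"] by (simp add: qfin_Suc mult_ac)
  qed simp
  have tq: "(\<lambda>n. qinf (F * q ^ n * y)) \<longlonglongrightarrow> qinf (0 * y)" for y
    using tendsto_qinf_power[of "F * y"] by (simp add: mult_ac)
  have "(\<lambda>n. qfin (F * A * C * D) n * qfin (F * B * C * D) n * saal_sum A B C D (F * q ^ n))
      \<longlonglongrightarrow> qinf (F * A * C * D) * qinf (F * B * C * D) * saal_sum A B C D 0"
    unfolding saal_sum_def
    by (rule tendsto_mult[OF tendsto_mult[OF qfin_tendsto qfin_tendsto]
          tendsto_diff[OF tendsto_mult[OF tq saal_suminf_tendsto]
            tendsto_mult[OF tq saal_suminf_tendsto]]])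
  hence "(\<lambda>n::nat. saal_sum A B C D F) \<longlonglongrightarrow> qinf (F * A * C * D) * qinf (F * B * C * D) * saal_sum A B C D 0"
    by (simp only: iter[symmetric])
  thus ?thesis by (simp add: LIMSEQ_const_iff)
qed

text \<open>By \<open>saal_sum_eq\<close> the dependence on \<open>F\<close> is explicit up to the value
  at \<open>F = 0\<close>, which can be read off at any convenient point. At \<open>F = 1 / C\<close>
  one series is multiplied by \<open>qinf 1 = 0\<close> and the other stops after its first
  term.\<close>
lemma saal_sum_value:
  "saal_sum A B C D F = C * qinf q * qinf (q * C / D) * qinf (D / C) * qinf (A * B * C * D)
     * qinf (A * C * D * F) * qinf (B * C * D * F)
     / (qinf (A * C) * qinf (B * C) * qinf (A * D) * qinf (B * D))"
proof -
  have "suminf (saal_term A B C D (1 / C)) = saal_term A B C D (1 / C) 0"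
  proof (subst suminf_finite[of "{0}"])
    fix n :: nat assume "n \<notin> {0}"
    then obtain m where "n = Suc m" by (cases n) auto
    thus "saal_term A B C D (1 / C) n = 0" using CD by (simp add: saal_term_def qfin_rec)
  qed auto
  hence "saal_sum A B C D (1 / C) = qinf (D / C) * (C * qinf q * qinf (q * C / D)
      * qinf (A * B * C * D) / (qinf (A * C) * qinf (B * C)))"
    unfolding saal_sum_def using CD by (simp add: saal_term_def mult_ac)
  \<comment> \<open>The same value through the recurrence; solving for the value at 0 finishes the
    computation.\<close>
  moreover have "saal_sum A B C D (1 / C) = qinf (A * D) * qinf (B * D) * saal_sum A B C D 0"
    using saal_sum_eq[of "1 / C"] CD by simp
  ultimately have "saal_sum A B C D 0 = qinf (D / C) * (C * qinf q * qinf (q * C / D)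
      * qinf (A * B * C * D) / (qinf (A * C) * qinf (B * C))) / (qinf (A * D) * qinf (B * D))"
    using nz by (simp add: field_simps)
  thus ?thesis unfolding saal_sum_eq[of F] by (simp add: mult_ac)
qed

end

lemma saal_term_quotient:
  assumes "qinf (F * C) \<noteq> 0"
  shows "saal_term A B C D F n / qinf (F * C) = C * q ^ n * qinf (q ^ Suc n) * qinf (C / D * q ^ Suc n)
     * qinf (A * B * C * D * F * C * q ^ n)
     / (qinf (A * C * q ^ n) * qinf (B * C * q ^ n) * qinf (F * C * q ^ n))"
  unfolding saal_term_def qinf_split[of "F * C" n]
  using qfin_nonzero[OF assms, of n] by (simp add: mult_ac)

text \<open>The case in which the \<open>3phi2\<close> factor of the integrand is 1. The two series are
  the residue sums over the two increasing sequences of poles.\<close>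
theorem nonterminating_saalschuetz:
  fixes A B F :: complex
  defines "S \<equiv> \<lambda>(C :: complex) (D :: complex) n. C * q ^ n * qinf (q ^ Suc n) * qinf (C / D * q ^ Suc n)
     * qinf (A * B * C * D * F * C * q ^ n)
     / (qinf (A * C * q ^ n) * qinf (B * C * q ^ n) * qinf (F * C * q ^ n))"
  assumes CD: "C \<noteq> 0" "D \<noteq> 0"
    and nz: "qinf (A * C) \<noteq> 0" "qinf (B * C) \<noteq> 0" "qinf (A * D) \<noteq> 0" "qinf (B * D) \<noteq> 0"
      "qinf (F * C) \<noteq> 0" "qinf (F * D) \<noteq> 0"
  shows "(\<Sum>n. S C D n) - (\<Sum>n. S D C n) =
     C * qinf q * qinf (q * C / D) * qinf (D / C) * qinf (A * B * C * D)
     * qinf (A * C * D * F) * qinf (B * C * D * F)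
     / (qinf (A * C) * qinf (B * C) * qinf (A * D) * qinf (B * D) * qinf (F * C) * qinf (F * D))"
proof -
  have 1: "(\<Sum>n. S C D n) = suminf (saal_term A B C D F) / qinf (F * C)"
    unfolding S_def saal_term_quotient[OF nz(5), symmetric]
    by (rule suminf_divide) (rule summable_saal_term)
  have 2: "(\<Sum>n. S D C n) = suminf (saal_term A B D C F) / qinf (F * D)"
    unfolding S_def saal_term_quotient[OF nz(6), symmetric]
    by (rule suminf_divide) (rule summable_saal_term)
  have "(\<Sum>n. S C D n) - (\<Sum>n. S D C n) = saal_sum A B C D F / (qinf (F * C) * qinf (F * D))"
    unfolding 1 2 saal_sum_def using nz by (simp add: field_simps)
  thus ?thesis unfolding saal_sum_value[OF CD nz(1-4)] by simp
qed

end

section \<open>Lifting an identity along a recurrence in the degree\<close>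

text \<open>Fubini for a double series with a majorant of product form, in the three shapes used below:
  by rows, by columns and by diagonals.\<close>
lemma dominated_double_sums:
  fixes a :: "nat \<Rightarrow> nat \<Rightarrow> complex"
  assumes le: "\<And>j m. norm (a j m) \<le> K * u j * v m"
    and sm: "summable u" "summable v" and nn: "\<And>j. 0 \<le> u j" "\<And>m. 0 \<le> v m" "0 \<le> K"
  obtains S where "(\<lambda>j. \<Sum>m. a j m) sums S" "(\<lambda>m. \<Sum>j. a j m) sums S"
    "(\<lambda>k. \<Sum>j\<le>k. a j (k - j)) sums S"
proof -
  define f where "f = (\<lambda>(j, m). a j m)"
  have v_hs: "(v has_sum suminf v) UNIV" and u_hs: "(u has_sum suminf u) UNIV"
    using sm nn by (auto intro!: norm_summable_imp_has_sum)
  have uv: "(\<lambda>(j, m). K * u j * v m) summable_on (UNIV \<times> UNIV)"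
  proof (rule summable_on_SigmaI[where g = "\<lambda>j. K * u j * suminf v"])
    show "((\<lambda>y. case (x, y) of (j, m) \<Rightarrow> K * u j * v m) has_sum K * u x * suminf v) UNIV" for x
      using has_sum_cmult_right[OF v_hs] by simp
    show "(\<lambda>j. K * u j * suminf v) summable_on UNIV"
      using u_hs by (intro summable_on_cmult_left summable_on_cmult_right) (auto simp: summable_on_def)
  qed (use nn in auto)
  have "(\<lambda>p. norm (f p)) summable_on (UNIV \<times> UNIV)"
    by (rule summable_on_comparison_test[OF uv]) (auto simp: f_def le)
  hence "f summable_on (UNIV \<times> UNIV)" by (rule abs_summable_summable)
  then obtain S where S: "(f has_sum S) (UNIV \<times> UNIV)" by (auto simp: summable_on_def)
  have row: "((\<lambda>m. a j m) has_sum (\<Sum>m. a j m)) UNIV" for j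
  proof (rule norm_summable_imp_has_sum)
    show "summable (\<lambda>m. norm (a j m))"
      by (rule summable_comparison_test'[of "\<lambda>m. K * u j * v m" 0]) (auto intro!: summable_mult sm le)
    thus "(\<lambda>m. a j m) sums (\<Sum>m. a j m)" by (rule summable_sums[OF summable_norm_cancel])
  qed
  have col: "((\<lambda>j. a j m) has_sum (\<Sum>j. a j m)) UNIV" for m
  proof (rule norm_summable_imp_has_sum)
    show "summable (\<lambda>j. norm (a j m))"
      by (rule summable_comparison_test'[of "\<lambda>j. K * u j * v m" 0])
         (auto intro!: summable_mult summable_mult2 sm le)
    thus "(\<lambda>j. a j m) sums (\<Sum>j. a j m)" by (rule summable_sums[OF summable_norm_cancel])
  qed
  show thesis
  proof (rule that[of S])
    show "(\<lambda>j. \<Sum>m. a j m) sums S"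
      by (intro has_sum_imp_sums has_sum_SigmaD[OF S]) (simp add: f_def row)
    have swap: "bij_betw prod.swap (UNIV \<times> UNIV) ((UNIV :: nat set) \<times> (UNIV :: nat set))"
      by (rule bij_betwI[where g = prod.swap]) auto
    have "((\<lambda>p. f (prod.swap p)) has_sum S) (UNIV \<times> UNIV)"
      using S has_sum_reindex_bij_betw[OF swap, of f S] by simp
    from has_sum_SigmaD[OF this, of "\<lambda>m. \<Sum>j. a j m"]
    show "(\<lambda>m. \<Sum>j. a j m) sums S"
      by (intro has_sum_imp_sums) (simp add: f_def col)
    have bij: "bij_betw (\<lambda>(k, j). (j, k - j)) (SIGMA k:UNIV. {..k}) (UNIV \<times> (UNIV :: nat set))"
      by (rule bij_betwI[where g = "\<lambda>(j, m). (j + m, j)"]) auto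
    have "((\<lambda>p. f ((\<lambda>(k, j). (j, k - j)) p)) has_sum S) (SIGMA k:UNIV. {..k})"
      using S has_sum_reindex_bij_betw[OF bij, of f S] by simp
    from has_sum_SigmaD[OF this, of "\<lambda>k. \<Sum>j\<le>k. a j (k - j)"]
    show "(\<lambda>k. \<Sum>j\<le>k. a j (k - j)) sums S"
      by (intro has_sum_imp_sums) (simp add: f_def has_sum_finite)
  qed
qed

context q_base
begin

text \<open>The coefficients of a product of a \<open>q\<close>-exponential series in \<open>s\<close>
  with another series whose coefficients are \<open>\<tau> j * h j\<close>. In the applications
  \<open>h\<close> depends on a further variable \<open>X\<close>, and \<open>h'\<close> in the
  recurrence below is \<open>1 - X * t\<close> times its value at \<open>X * q\<close>.\<close>
definition qconv where
  "qconv s \<tau> h k = (\<Sum>j\<le>k. s ^ (k - j) / qfin q (k - j) * (\<tau> j / qfin q j * h j))"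

text \<open>Write \<open>1 - q ^ Suc k\<close> as \<open>q ^ j * (1 - q ^ (Suc k - j)) + (1 - q ^
  j)\<close> inside the sum. Each part cancels one factor of a \<open>q\<close>-factorial and lowers one
  summation index, which lowers the degree from \<open>Suc k\<close> to \<open>k\<close>; the hypothesis
  on \<open>h\<close> recombines the two parts.\<close>
lemma qconv_rec:
  assumes h: "\<And>j. h j - h' j = X * (s * q ^ j * h j + (t - v * q ^ j) * h (Suc j))"
    and \<tau>: "\<And>j. \<tau> (Suc j) = \<tau> j * (t - v * q ^ j)"
  shows "X * (1 - q ^ Suc k) * qconv s \<tau> h (Suc k) = qconv s \<tau> h k - qconv s \<tau> h' k"
proof -
  let ?c = "\<lambda>k j. s ^ (k - j) / qfin q (k - j) * (\<tau> j / qfin q j)"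
  have nz: "1 - q ^ Suc j \<noteq> 0" for j
    using qfin_q_nonzero[of "Suc j"] by (simp add: qfin_Suc)
  have split: "(1 - a * b) * x = a * (1 - b) * x + (1 - a) * x" for a b x :: complex
    by (simp add: algebra_simps)
  have "(1 - q ^ Suc k) * qconv s \<tau> h (Suc k) = (\<Sum>j\<le>Suc k. (1 - q ^ Suc k) * (?c (Suc k) j * h j))"
    unfolding qconv_def sum_distrib_left by (simp add: mult_ac)
  also have "\<dots> = (\<Sum>j\<le>Suc k. q ^ j * (1 - q ^ (Suc k - j)) * (?c (Suc k) j * h j)
      + (1 - q ^ j) * (?c (Suc k) j * h j))"
  proof (rule sum.cong[OF refl])
    fix j assume "j \<in> {..Suc k}"
    hence "q ^ Suc k = q ^ j * q ^ (Suc k - j)" by (simp add: power_add[symmetric])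
    thus "(1 - q ^ Suc k) * (?c (Suc k) j * h j) = q ^ j * (1 - q ^ (Suc k - j)) * (?c (Suc k) j * h j)
      + (1 - q ^ j) * (?c (Suc k) j * h j)" by (simp only: split)
  qed
  also have "\<dots> = (\<Sum>j\<le>Suc k. q ^ j * (1 - q ^ (Suc k - j)) * (?c (Suc k) j * h j))
      + (\<Sum>j\<le>Suc k. (1 - q ^ j) * (?c (Suc k) j * h j))" by (rule sum.distrib)
  also have "(\<Sum>j\<le>Suc k. q ^ j * (1 - q ^ (Suc k - j)) * (?c (Suc k) j * h j))
      = (\<Sum>j\<le>k. ?c k j * (s * q ^ j * h j))"
  proof -
    have "(\<Sum>j\<le>Suc k. q ^ j * (1 - q ^ (Suc k - j)) * (?c (Suc k) j * h j))
       = (\<Sum>j\<le>k. q ^ j * (1 - q ^ (Suc k - j)) * (?c (Suc k) j * h j))" by simp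
    also have "\<dots> = (\<Sum>j\<le>k. ?c k j * (s * q ^ j * h j))"
    proof (rule sum.cong[OF refl])
      fix j assume "j \<in> {..k}"
      then obtain i where i: "k = j + i" using le_Suc_ex by auto
      have e: "Suc k - j = Suc i" "k - j = i" using i by auto
      show "q ^ j * (1 - q ^ (Suc k - j)) * (?c (Suc k) j * h j) = ?c k j * (s * q ^ j * h j)"
        unfolding e qfin_Suc using nz[of i] by (simp add: field_simps)
    qed
    finally show ?thesis .
  qed
  also have "(\<Sum>j\<le>Suc k. (1 - q ^ j) * (?c (Suc k) j * h j))
      = (\<Sum>j\<le>k. ?c k j * ((t - v * q ^ j) * h (Suc j)))"
  proof -
    have "(\<Sum>j\<le>Suc k. (1 - q ^ j) * (?c (Suc k) j * h j))
       = (\<Sum>j\<le>k. (1 - q ^ Suc j) * (?c (Suc k) (Suc j) * h (Suc j)))"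
      by (subst sum.atMost_Suc_shift) simp
    also have "\<dots> = (\<Sum>j\<le>k. ?c k j * ((t - v * q ^ j) * h (Suc j)))"
    proof (rule sum.cong[OF refl])
      fix j
      have "(1 - q ^ Suc j) * (\<tau> (Suc j) / qfin q (Suc j)) = \<tau> j / qfin q j * (t - v * q ^ j)"
        unfolding qfin_Suc \<tau> using nz[of j] by (simp add: field_simps)
      hence "s ^ (k - j) / qfin q (k - j) * ((1 - q ^ Suc j) * (\<tau> (Suc j) / qfin q (Suc j))) * h (Suc j)
        = s ^ (k - j) / qfin q (k - j) * (\<tau> j / qfin q j * (t - v * q ^ j)) * h (Suc j)" by simp
      thus "(1 - q ^ Suc j) * (?c (Suc k) (Suc j) * h (Suc j)) = ?c k j * ((t - v * q ^ j) * h (Suc j))"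
        by (simp only: diff_Suc_Suc) (simp only: mult_ac)
    qed
    finally show ?thesis .
  qed
  finally have "(1 - q ^ Suc k) * qconv s \<tau> h (Suc k)
     = (\<Sum>j\<le>k. ?c k j * (s * q ^ j * h j + (t - v * q ^ j) * h (Suc j)))"
    by (simp add: sum.distrib[symmetric] distrib_left)
  hence "X * ((1 - q ^ Suc k) * qconv s \<tau> h (Suc k)) = (\<Sum>j\<le>k. ?c k j * (h j - h' j))"
    by (simp only: h sum_distrib_left mult_ac)
  also have "\<dots> = qconv s \<tau> h k - qconv s \<tau> h' k"
    unfolding qconv_def by (simp add: right_diff_distrib sum_subtractf mult.assoc)
  finally show ?thesis by (simp add: mult_ac)
qed

lemma qconv_cmult: "qconv s \<tau> (\<lambda>j. c * h j) k = c * qconv s \<tau> h k"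
  unfolding qconv_def sum_distrib_left by (simp add: mult_ac)

lemma qconv_bound:
  assumes "norm s \<le> \<sigma>" "\<And>j. norm (\<tau> j * h j) \<le> M * \<rho> ^ j" "0 \<le> \<rho>" "\<And>n. norm (1 / qfin q n) \<le> K" "0 \<le> K" "0 \<le> M"
  shows "norm (qconv s \<tau> h k) \<le> K * K * M * (\<Sum>j\<le>k. \<rho> ^ j * \<sigma> ^ (k - j))"
proof -
  have "norm (qconv s \<tau> h k) \<le> (\<Sum>j\<le>k. norm (s ^ (k - j) / qfin q (k - j) * (\<tau> j / qfin q j * h j)))"
    unfolding qconv_def by (rule norm_sum)
  also have "\<dots> \<le> (\<Sum>j\<le>k. K * K * M * (\<rho> ^ j * \<sigma> ^ (k - j)))"
  proof (rule sum_mono)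
    fix j
    have "norm (s ^ (k - j) / qfin q (k - j) * (\<tau> j / qfin q j * h j))
      = norm s ^ (k - j) * norm (1 / qfin q (k - j)) * norm (1 / qfin q j) * norm (\<tau> j * h j)"
      by (simp add: norm_mult norm_divide norm_power)
    also have "\<dots> \<le> \<sigma> ^ (k - j) * K * K * (M * \<rho> ^ j)"
      using assms by (intro mult_mono power_mono mult_nonneg_nonneg)
        (auto intro: order_trans[OF norm_ge_zero assms(1)] zero_le_power)
    finally show "norm (s ^ (k - j) / qfin q (k - j) * (\<tau> j / qfin q j * h j)) \<le> K * K * M * (\<rho> ^ j * \<sigma> ^ (k - j))"
      by (simp add: mult_ac)
  qed
  finally show ?thesis by (simp add: sum_distrib_left)
qed

text \<open>Summing the coefficients against \<open>qfin \<alpha> k * Z ^ k\<close>: along the diagonals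
  \<open>k = j + m\<close> the factor \<open>qfin \<alpha> (j + m)\<close> splits, and the sum over
  \<open>m\<close> is a \<open>q\<close>-binomial series.\<close>
lemma qconv_genfun:
  assumes sZ: "norm (s * Z) < 1" and bd: "\<And>j. norm (\<tau> j * h j) \<le> M * \<rho> ^ j"
    and \<rho>: "0 \<le> \<rho>" "\<rho> * norm Z < 1" and M: "0 \<le> M"
  shows "(\<lambda>k. qfin \<alpha> k * Z ^ k * qconv s \<tau> h k) sums
    (\<Sum>j. qfin \<alpha> j * Z ^ j * (\<tau> j / qfin q j * h j) * (qinf (\<alpha> * q ^ j * (s * Z)) / qinf (s * Z)))"
proof -
  obtain K where K: "K > 0" "\<And>n. norm (1 / qfin q n) \<le> K" by (rule bounded_inv_qfin_q) blast
  define E where "E = exp (norm \<alpha> / (1 - norm q))"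
  define a where "a = (\<lambda>j m. qfin \<alpha> (j + m) * Z ^ (j + m) * (s ^ m / qfin q m * (\<tau> j / qfin q j * h j)))"
  have a_le: "norm (a j m) \<le> (E * K * K * M) * (\<rho> * norm Z) ^ j * norm (s * Z) ^ m" for j m
  proof -
    have "norm (a j m) = norm (qfin \<alpha> (j + m)) * norm (1 / qfin q m) * norm (1 / qfin q j)
        * norm (\<tau> j * h j) * norm Z ^ j * (norm (s * Z) ^ m)"
      unfolding a_def by (simp add: norm_mult norm_divide norm_power power_add power_mult_distrib)
    also have "\<dots> \<le> E * K * K * (M * \<rho> ^ j) * norm Z ^ j * norm (s * Z) ^ m"
      using K \<rho> M unfolding E_def
      by (intro mult_mono mult_nonneg_nonneg bd norm_qfin_le zero_le_power) auto
    finally show ?thesis by (simp add: power_mult_distrib mult_ac)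
  qed
  obtain S where S: "(\<lambda>j. \<Sum>m. a j m) sums S" "(\<lambda>k. \<Sum>j\<le>k. a j (k - j)) sums S"
    by (rule dominated_double_sums[OF a_le])
       (use sZ \<rho> K M in \<open>auto simp: E_def intro!: summable_geometric zero_le_power\<close>)
  have "(\<Sum>m. a j m) = qfin \<alpha> j * Z ^ j * (\<tau> j / qfin q j * h j) * (qinf (\<alpha> * q ^ j * (s * Z)) / qinf (s * Z))" for j
  proof -
    have "(\<lambda>m. qfin \<alpha> j * Z ^ j * (\<tau> j / qfin q j * h j) * (qfin (\<alpha> * q ^ j) m / qfin q m * (s * Z) ^ m))
      sums (qfin \<alpha> j * Z ^ j * (\<tau> j / qfin q j * h j) * (qinf (\<alpha> * q ^ j * (s * Z)) / qinf (s * Z)))"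
      by (intro sums_mult q_binomial sZ)
    also have "(\<lambda>m. qfin \<alpha> j * Z ^ j * (\<tau> j / qfin q j * h j) * (qfin (\<alpha> * q ^ j) m / qfin q m * (s * Z) ^ m)) = a j"
      unfolding a_def by (rule ext) (simp add: qfin_add power_add power_mult_distrib mult_ac)
    finally show ?thesis by (simp add: sums_iff)
  qed
  moreover have "(\<Sum>j\<le>k. a j (k - j)) = qfin \<alpha> k * Z ^ k * qconv s \<tau> h k" for k
    unfolding a_def qconv_def sum_distrib_left by (intro sum.cong) auto
  ultimately show ?thesis using S by (simp add: sums_iff)
qed

text \<open>Ingredients of the lifting. The letter \<open>X\<close> takes the place of the parameter
  \<open>A\<close> and is moved by the recurrence \<open>X \<mapsto> X * q\<close>; the other parameters
  stay fixed, and \<open>t = C * D * F\<close>. The coefficients \<open>delta_l\<close> belong to the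
  terms at a node \<open>x\<close> on the left-hand side, \<open>delta_r\<close> to the evaluation on
  the right-hand side; for \<open>k = 0\<close> they reduce to the factors of the nonterminating
  \<open>q\<close>-Saalschuetz formula that depend on \<open>X\<close>. The function
  \<open>lifted_series\<close> is the generating function of \<open>delta_l\<close>, and
  \<open>weight\<close> collects the factors at the node \<open>C * q ^ n\<close> free of
  \<open>X\<close>.\<close>
definition eta_l where "eta_l t B X x j = qinf (X * B * t * x * q ^ j) / qinf (X * x * q ^ j)"
definition tau_l where "tau_l t B x j = t ^ j * qfin (B * x) j"
definition delta_l where "delta_l t B X x = qconv x (tau_l t B x) (eta_l t B X x)"
definition eta_r where "eta_r t B C D X j = qinf (X * t) * qinf (X * B * C * D * q ^ j) / (qinf (X * C * q ^ j) * qinf (X * D))"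
definition tau_r where "tau_r B C D j = D ^ j * qfin (B * C) j"
definition delta_r where "delta_r t B C D X = qconv C (tau_r B C D) (eta_r t B C D X)"
definition lifted_series where
  "lifted_series t B X \<alpha> Z x = (\<Sum>j. qfin \<alpha> j * Z ^ j * (tau_l t B x j / qfin q j * eta_l t B X x j)
     * (qinf (\<alpha> * q ^ j * (x * Z)) / qinf (x * Z)))"
definition weight where
  "weight B F C D n = C * q ^ n * qinf (q ^ Suc n) * qinf (C / D * q ^ Suc n)
     / (qinf (B * C * q ^ n) * qinf (F * C * q ^ n))"

lemma qinf_ratio_step:
  assumes "qinf (y * q ^ j) \<noteq> 0"
  shows "qinf (z * q ^ j) / qinf (y * q ^ j) * (1 - y * q ^ j)
       = qinf (z * q ^ Suc j) / qinf (y * q ^ Suc j) * (1 - z * q ^ j)"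
  using assms unfolding qinf_power_Suc[of y j] qinf_power_Suc[of z j] by simp

text \<open>Both families of coefficients satisfy the same first-order recurrence in \<open>k\<close>,
  which determines degree \<open>Suc k\<close> from degree \<open>k\<close> at \<open>X\<close> and at
  \<open>X * q\<close>. That is the reason why an identity in degree 0, valid for all \<open>X\<close>,
  propagates to every degree.\<close>
lemma delta_l_rec:
  assumes "qinf (X * x) \<noteq> 0"
  shows "X * (1 - q ^ Suc k) * delta_l t B X x (Suc k) = delta_l t B X x k - (1 - X * t) * delta_l t B (X * q) x k"
proof -
  have nz: "qinf (X * x * q ^ j) \<noteq> 0" for j by (intro qinf_shift_nonzero assms)
  have sh: "eta_l t B (X * q) x j = eta_l t B X x (Suc j)" for j
    unfolding eta_l_def by (simp add: mult_ac)
  have r: "eta_l t B X x j * (1 - X * x * q ^ j) = eta_l t B X x (Suc j) * (1 - X * B * t * x * q ^ j)" for j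
    unfolding eta_l_def by (rule qinf_ratio_step[OF nz])
  have "X * (1 - q ^ Suc k) * qconv x (tau_l t B x) (eta_l t B X x) (Suc k)
     = qconv x (tau_l t B x) (eta_l t B X x) k - qconv x (tau_l t B x) (\<lambda>j. (1 - X * t) * eta_l t B (X * q) x j) k"
  proof (rule qconv_rec[where t = t and v = "t * B * x"])
    fix j
    show "eta_l t B X x j - (1 - X * t) * eta_l t B (X * q) x j =
         X * (x * q ^ j * eta_l t B X x j + (t - t * B * x * q ^ j) * eta_l t B X x (Suc j))"
      using r[of j] unfolding sh by (simp add: algebra_simps)
    show "tau_l t B x (Suc j) = tau_l t B x j * (t - t * B * x * q ^ j)"
      unfolding tau_l_def by (simp add: qfin_Suc algebra_simps)
  qed
  thus ?thesis unfolding delta_l_def by (simp only: qconv_cmult)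
qed

lemma delta_r_rec:
  assumes "qinf (X * C) \<noteq> 0" "qinf (X * D) \<noteq> 0"
  shows "X * (1 - q ^ Suc k) * delta_r t B C D X (Suc k) = delta_r t B C D X k - (1 - X * t) * delta_r t B C D (X * q) k"
proof -
  have nz: "qinf (X * C * q ^ j) \<noteq> 0" "qinf (X * D * q ^ j) \<noteq> 0" for j
    by (intro qinf_shift_nonzero assms)+
  have D: "qinf (X * D) = (1 - X * D) * qinf (X * D * q)" by (rule qinf_rec)
  have sh: "(1 - X * t) * eta_r t B C D (X * q) j = (1 - X * D) * eta_r t B C D X (Suc j)" for j
  proof -
    have 1: "X * q * t = X * t * q" "X * q * B * C * D * q ^ j = X * B * C * D * q ^ Suc j"
      "X * q * C * q ^ j = X * C * q ^ Suc j" "X * q * D = X * D * q" by (simp_all add: mult_ac)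
    show ?thesis
      unfolding eta_r_def 1 qinf_rec[of "X * t"] D using assms(2) D by simp
  qed
  have r: "eta_r t B C D X j * (1 - X * C * q ^ j) = eta_r t B C D X (Suc j) * (1 - X * B * C * D * q ^ j)" for j
    using arg_cong[OF qinf_ratio_step[OF nz(1)[of j], of "X * B * C * D"], of "\<lambda>z. qinf (X * t) / qinf (X * D) * z"]
    unfolding eta_r_def by (simp add: mult_ac)
  have "X * (1 - q ^ Suc k) * qconv C (tau_r B C D) (eta_r t B C D X) (Suc k)
     = qconv C (tau_r B C D) (eta_r t B C D X) k - qconv C (tau_r B C D) (\<lambda>j. (1 - X * t) * eta_r t B C D (X * q) j) k"
  proof (rule qconv_rec[where t = D and v = "B * C * D"])
    fix j
    show "eta_r t B C D X j - (1 - X * t) * eta_r t B C D (X * q) j =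
         X * (C * q ^ j * eta_r t B C D X j + (D - B * C * D * q ^ j) * eta_r t B C D X (Suc j))"
      using r[of j] unfolding sh by (simp add: algebra_simps)
    show "tau_r B C D (Suc j) = tau_r B C D j * (D - B * C * D * q ^ j)"
      unfolding tau_r_def by (simp add: qfin_Suc algebra_simps)
  qed
  thus ?thesis unfolding delta_r_def by (simp only: qconv_cmult)
qed

lemma tau_eta_l_bound:
  obtains M where "M \<ge> 0" "\<And>n j. norm (tau_l t B (C * q ^ n) j * eta_l t B X (C * q ^ n) j) \<le> M * norm t ^ j"
proof -
  obtain K where K: "K > 0" "\<And>i. norm (qinf (X * B * t * C * q ^ i) / qinf (X * C * q ^ i)) \<le> K"
    by (rule bounded_ratio[OF tendsto_qinf_power tendsto_qinf_power, of "X * B * t * C" "X * C"]) auto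
  define E where "E = exp (norm (B * C) / (1 - norm q))"
  show thesis
  proof (rule that[of "E * K"])
    fix n j
    have h: "eta_l t B X (C * q ^ n) j = qinf (X * B * t * C * q ^ (n + j)) / qinf (X * C * q ^ (n + j))"
      unfolding eta_l_def by (simp add: power_add mult_ac)
    have "norm (B * C * q ^ n) \<le> norm (B * C)" by (rule norm_mult_power_le) simp
    hence "norm (qfin (B * (C * q ^ n)) j) \<le> E"
      unfolding E_def mult.assoc[symmetric] by (rule norm_qfin_le')
    hence "norm t ^ j * norm (qfin (B * (C * q ^ n)) j) * norm (eta_l t B X (C * q ^ n) j) \<le> norm t ^ j * E * K"
      unfolding h using K by (intro mult_mono) (auto simp: E_def)
    thus "norm (tau_l t B (C * q ^ n) j * eta_l t B X (C * q ^ n) j) \<le> E * K * norm t ^ j"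
      unfolding tau_l_def by (simp add: norm_mult norm_power mult_ac)
  qed (use K in \<open>simp add: E_def\<close>)
qed

text \<open>The bound must be uniform in the node index \<open>n\<close>, and its dependence on
  \<open>k\<close> must be a convolution of geometric sequences, so that the double series in
  \<open>n\<close> and \<open>k\<close> converges absolutely.\<close>
lemma delta_l_bound:
  obtains M where "M \<ge> 0"
    "\<And>n k. norm (delta_l t B X (C * q ^ n) k) \<le> M * (\<Sum>j\<le>k. norm t ^ j * norm C ^ (k - j))"
proof -
  obtain K where K: "K > 0" "\<And>n. norm (1 / qfin q n) \<le> K" by (rule bounded_inv_qfin_q) blast
  obtain M where M: "M \<ge> 0" "\<And>n j. norm (tau_l t B (C * q ^ n) j * eta_l t B X (C * q ^ n) j) \<le> M * norm t ^ j"
    by (rule tau_eta_l_bound[of t B C X]) blast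
  have "norm (delta_l t B X (C * q ^ n) k) \<le> K * K * M * (\<Sum>j\<le>k. norm t ^ j * norm C ^ (k - j))" for n k
    unfolding delta_l_def using K M by (intro qconv_bound norm_mult_power_le) auto
  thus ?thesis using K M that[of "K * K * M"] by simp
qed

lemma weight_bound:
  obtains M where "M \<ge> 0" "\<And>n. norm (weight B F C D n) \<le> M * norm q ^ n"
proof -
  have "(\<lambda>n. qinf (1 * q ^ Suc n) * qinf (C / D * q ^ Suc n)) \<longlonglongrightarrow> 1 * 1"
    by (intro tendsto_mult LIMSEQ_Suc[OF tendsto_qinf_power])
  moreover have "(\<lambda>n. qinf (B * C * q ^ n) * qinf (F * C * q ^ n)) \<longlonglongrightarrow> 1 * 1"
    by (intro tendsto_mult tendsto_qinf_power)
  ultimately obtain K where K: "K > 0"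
    "\<And>n. norm (qinf (1 * q ^ Suc n) * qinf (C / D * q ^ Suc n)
            / (qinf (B * C * q ^ n) * qinf (F * C * q ^ n))) \<le> K"
    by (rule bounded_ratio) auto
  show ?thesis
  proof (rule that[of "norm C * K"])
    fix n
    have "norm (weight B F C D n) = norm C * norm q ^ n * norm (qinf (1 * q ^ Suc n) * qinf (C / D * q ^ Suc n)
            / (qinf (B * C * q ^ n) * qinf (F * C * q ^ n)))"
      unfolding weight_def by (simp add: norm_mult norm_divide norm_power)
    also have "\<dots> \<le> norm C * norm q ^ n * K" by (intro mult_left_mono K) auto
    finally show "norm (weight B F C D n) \<le> norm C * K * norm q ^ n" by (simp add: mult_ac)
  qed (use K in simp)
qed

lemma summable_weight_delta_l: "summable (\<lambda>n. weight B F C D n * delta_l t B X (C * q ^ n) k)"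
proof -
  obtain M where M: "M \<ge> 0"
    "\<And>n k. norm (delta_l t B X (C * q ^ n) k) \<le> M * (\<Sum>j\<le>k. norm t ^ j * norm C ^ (k - j))"
    by (rule delta_l_bound[of t B X C]) blast
  obtain L where L: "L \<ge> 0" "\<And>n. norm (weight B F C D n) \<le> L * norm q ^ n"
    by (rule weight_bound[of B F C D]) blast
  show ?thesis
  proof (rule summable_bounded_geometric[where r = "norm q"])
    fix n
    have "norm (weight B F C D n * delta_l t B X (C * q ^ n) k)
      \<le> (L * norm q ^ n) * (M * (\<Sum>j\<le>k. norm t ^ j * norm C ^ (k - j)))"
      unfolding norm_mult using M L by (intro mult_mono mult_nonneg_nonneg) auto
    thus "norm (weight B F C D n * delta_l t B X (C * q ^ n) k)
      \<le> (L * (M * (\<Sum>j\<le>k. norm t ^ j * norm C ^ (k - j)))) * norm q ^ n" by (simp add: mult_ac)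
  qed (use norm_q in auto)
qed

definition prefactor where
  "prefactor B C D F = C * qinf q * qinf (q * C / D) * qinf (D / C) * qinf (B * C * D * F)
     / (qinf (B * C) * qinf (B * D) * qinf (F * C) * qinf (F * D))"

context
  fixes B C D F t :: complex
  assumes CD: "C \<noteq> 0" "D \<noteq> 0" and t: "t = C * D * F"
    and nz: "qinf (B * C) \<noteq> 0" "qinf (B * D) \<noteq> 0" "qinf (F * C) \<noteq> 0" "qinf (F * D) \<noteq> 0"
begin

text \<open>Induction on \<open>k\<close>, with \<open>X\<close> universally quantified because the
  recurrence refers to \<open>X * q\<close>. The base case is the nonterminating
  \<open>q\<close>-Saalschuetz formula with \<open>X\<close> in place of \<open>A\<close>.\<close>
lemma lifted_coefficient_identity:
  assumes "X \<noteq> 0" "qinf (X * C) \<noteq> 0" "qinf (X * D) \<noteq> 0"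
  shows "(\<Sum>n. weight B F C D n * delta_l t B X (C * q ^ n) k) - (\<Sum>n. weight B F D C n * delta_l t B X (D * q ^ n) k)
    = prefactor B C D F * delta_r t B C D X k"
  using assms
proof (induction k arbitrary: X)
  case 0
  have d0: "weight B F C D n * delta_l t B X (C * q ^ n) 0 = C * q ^ n * qinf (q ^ Suc n) * qinf (C / D * q ^ Suc n)
     * qinf (X * B * C * D * F * C * q ^ n)
     / (qinf (X * C * q ^ n) * qinf (B * C * q ^ n) * qinf (F * C * q ^ n))"
    if "t = C * D * F" for C D n
    unfolding delta_l_def weight_def qconv_def tau_l_def eta_l_def that by (simp add: mult_ac)
  have t': "t = D * C * F" using t by simp
  have r0: "prefactor B C D F * delta_r t B C D X 0 = 
      C * qinf q * qinf (q * C / D) * qinf (D / C) * qinf (X * B * C * D)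
     * qinf (X * C * D * F) * qinf (B * C * D * F)
     / (qinf (X * C) * qinf (B * C) * qinf (X * D) * qinf (B * D) * qinf (F * C) * qinf (F * D))"
    unfolding delta_r_def qconv_def tau_r_def eta_r_def prefactor_def t by (simp add: mult_ac)
  show ?case unfolding d0[OF t] d0[OF t'] r0
    by (rule nonterminating_saalschuetz) (use CD nz 0 in auto)
next
  case (Suc k)
  have Xq: "X * q \<noteq> 0" "qinf (X * q * C) \<noteq> 0" "qinf (X * q * D) \<noteq> 0"
    using Suc.prems q_nz qinf_shift_nonzero[of "X * C" 1] qinf_shift_nonzero[of "X * D" 1]
    by (auto simp: mult_ac)
  have nzq: "1 - q ^ Suc k \<noteq> 0"
    using qfin_q_nonzero[of "Suc k"] by (simp add: qfin_Suc)
  have st: "X * (1 - q ^ Suc k) * (\<Sum>n. weight B F C D n * delta_l t B X (C * q ^ n) (Suc k))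
     = (\<Sum>n. weight B F C D n * delta_l t B X (C * q ^ n) k) - (1 - X * t) * (\<Sum>n. weight B F C D n * delta_l t B (X * q) (C * q ^ n) k)"
    if "qinf (X * C) \<noteq> 0" for C D
  proof -
    have "X * (1 - q ^ Suc k) * (\<Sum>n. weight B F C D n * delta_l t B X (C * q ^ n) (Suc k))
        = (\<Sum>n. X * (1 - q ^ Suc k) * (weight B F C D n * delta_l t B X (C * q ^ n) (Suc k)))"
      by (intro suminf_mult[symmetric] summable_weight_delta_l)
    also have "\<dots> = (\<Sum>n. weight B F C D n * delta_l t B X (C * q ^ n) k - (1 - X * t) * (weight B F C D n * delta_l t B (X * q) (C * q ^ n) k))"
    proof (rule suminf_cong)
      fix n
      have "qinf (X * (C * q ^ n)) \<noteq> 0" using qinf_shift_nonzero[OF that] by (simp add: mult_ac)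
      from delta_l_rec[OF this, of k t B]
      have "weight B F C D n * (X * (1 - q ^ Suc k) * delta_l t B X (C * q ^ n) (Suc k))
        = weight B F C D n * (delta_l t B X (C * q ^ n) k - (1 - X * t) * delta_l t B (X * q) (C * q ^ n) k)" by (simp only:)
      thus "X * (1 - q ^ Suc k) * (weight B F C D n * delta_l t B X (C * q ^ n) (Suc k))
        = weight B F C D n * delta_l t B X (C * q ^ n) k - (1 - X * t) * (weight B F C D n * delta_l t B (X * q) (C * q ^ n) k)"
        by (simp only: mult_ac right_diff_distrib)
    qed
    also have "\<dots> = (\<Sum>n. weight B F C D n * delta_l t B X (C * q ^ n) k) - (1 - X * t) * (\<Sum>n. weight B F C D n * delta_l t B (X * q) (C * q ^ n) k)"
      by (subst suminf_diff[symmetric]) (auto intro!: summable_mult summable_weight_delta_l simp: suminf_mult[OF summable_weight_delta_l])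
    finally show ?thesis .
  qed
  have "X * (1 - q ^ Suc k) * ((\<Sum>n. weight B F C D n * delta_l t B X (C * q ^ n) (Suc k)) - (\<Sum>n. weight B F D C n * delta_l t B X (D * q ^ n) (Suc k)))
    = ((\<Sum>n. weight B F C D n * delta_l t B X (C * q ^ n) k) - (\<Sum>n. weight B F D C n * delta_l t B X (D * q ^ n) k))
      - (1 - X * t) * ((\<Sum>n. weight B F C D n * delta_l t B (X * q) (C * q ^ n) k) - (\<Sum>n. weight B F D C n * delta_l t B (X * q) (D * q ^ n) k))"
    unfolding right_diff_distrib[of "X * (1 - q ^ Suc k)"] st[OF Suc.prems(2)] st[OF Suc.prems(3)]
    by (simp only: right_diff_distrib) simp
  also have "\<dots> = prefactor B C D F * (delta_r t B C D X k - (1 - X * t) * delta_r t B C D (X * q) k)"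
    unfolding Suc.IH[OF Suc.prems] Suc.IH[OF Xq] by (simp add: algebra_simps)
  also have "\<dots> = X * (1 - q ^ Suc k) * (prefactor B C D F * delta_r t B C D X (Suc k))"
    unfolding delta_r_rec[OF Suc.prems(2,3), symmetric] by (simp only: mult_ac)
  finally show ?case using Suc.prems(1) nzq by simp
qed

end

lemma lifted_genfun_swap:
  assumes Z: "norm (C * Z) < 1" "norm (t * Z) < 1"
  shows "(\<lambda>k. qfin \<alpha> k * Z ^ k * (\<Sum>n. weight B F C D n * delta_l t B X (C * q ^ n) k)) sums
     (\<Sum>n. weight B F C D n * lifted_series t B X \<alpha> Z (C * q ^ n))" (is ?A)
    and "summable (\<lambda>n. weight B F C D n * lifted_series t B X \<alpha> Z (C * q ^ n))" (is ?B)
proof -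
  obtain M where M: "M \<ge> 0"
    "\<And>n k. norm (delta_l t B X (C * q ^ n) k) \<le> M * (\<Sum>j\<le>k. norm t ^ j * norm C ^ (k - j))"
    by (rule delta_l_bound[of t B X C]) blast
  obtain M' where M': "M' \<ge> 0" "\<And>n j. norm (tau_l t B (C * q ^ n) j * eta_l t B X (C * q ^ n) j) \<le> M' * norm t ^ j"
    by (rule tau_eta_l_bound[of t B C X]) blast
  obtain L where L: "L \<ge> 0" "\<And>n. norm (weight B F C D n) \<le> L * norm q ^ n"
    by (rule weight_bound[of B F C D]) blast
  define E where "E = exp (norm \<alpha> / (1 - norm q))"
  define a where "a = (\<lambda>k n. qfin \<alpha> k * Z ^ k * (weight B F C D n * delta_l t B X (C * q ^ n) k))"
  define u where "u = (\<lambda>k. \<Sum>j\<le>k. norm (t * Z) ^ j * norm (C * Z) ^ (k - j))"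
  have u: "u k = norm Z ^ k * (\<Sum>j\<le>k. norm t ^ j * norm C ^ (k - j))" for k
    unfolding u_def sum_distrib_left
  proof (rule sum.cong[OF refl])
    fix j assume "j \<in> {..k}"
    hence "norm Z ^ k = norm Z ^ j * norm Z ^ (k - j)" by (simp add: power_add[symmetric])
    thus "norm (t * Z) ^ j * norm (C * Z) ^ (k - j) = norm Z ^ k * (norm t ^ j * norm C ^ (k - j))"
      by (simp add: norm_mult power_mult_distrib)
  qed
  have a_le: "norm (a k n) \<le> (E * L * M) * u k * norm q ^ n" for k n
  proof -
    have "norm (a k n) = norm (qfin \<alpha> k) * norm Z ^ k * (norm (weight B F C D n) * norm (delta_l t B X (C * q ^ n) k))"
      unfolding a_def by (simp add: norm_mult norm_power)
    also have "\<dots> \<le> E * norm Z ^ k * ((L * norm q ^ n) * (M * (\<Sum>j\<le>k. norm t ^ j * norm C ^ (k - j))))"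
      unfolding E_def using M L by (intro mult_mono mult_nonneg_nonneg norm_qfin_le sum_nonneg zero_le_power) auto
    finally show ?thesis unfolding u by (simp add: mult_ac)
  qed
  have u_nn: "0 \<le> u k" for k unfolding u_def by (intro sum_nonneg mult_nonneg_nonneg zero_le_power) auto
  have sum_u: "summable u" unfolding u_def
    by (rule summable_Cauchy_product) (use Z in \<open>auto intro!: summable_geometric\<close>)
  have geom: "summable (\<lambda>n. norm q ^ n)" using norm_q by (intro summable_geometric) auto
  have nn: "0 \<le> norm q ^ n" "0 \<le> E * L * M" for n using M L by (simp_all add: E_def)
  obtain S where S: "(\<lambda>k. \<Sum>n. a k n) sums S" "(\<lambda>n. \<Sum>k. a k n) sums S"
    by (rule dominated_double_sums[of a "E * L * M" u "\<lambda>n. norm q ^ n", OF a_le sum_u geom u_nn nn])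
  have 1: "(\<Sum>n. a k n) = qfin \<alpha> k * Z ^ k * (\<Sum>n. weight B F C D n * delta_l t B X (C * q ^ n) k)" for k
    unfolding a_def by (rule suminf_mult[OF summable_weight_delta_l])
  have 2: "(\<Sum>k. a k n) = weight B F C D n * lifted_series t B X \<alpha> Z (C * q ^ n)" for n
  proof -
    have sZ: "norm (C * q ^ n * Z) < 1"
      using norm_mult_power_le[of "C * Z" "norm (C * Z)" n] Z by (simp add: mult_ac)
    have "(\<lambda>k. qfin \<alpha> k * Z ^ k * delta_l t B X (C * q ^ n) k) sums
     lifted_series t B X \<alpha> Z (C * q ^ n)"
      unfolding delta_l_def lifted_series_def by (rule qconv_genfun[OF sZ M'(2)]) (use Z M' in \<open>auto simp: norm_mult\<close>)
    from sums_mult[OF this, of "weight B F C D n"] show ?thesis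
      unfolding a_def by (simp add: sums_iff mult_ac)
  qed
  show ?A using S unfolding 1 2 by (simp add: sums_iff)
  show ?B using S unfolding 2 by (simp add: sums_iff)
qed

text \<open>The generating function, with weights \<open>qfin \<alpha> k * Z ^ k\<close>, of the
  coefficient identities at \<open>X = A\<close>. This is where the parameter \<open>\<alpha>\<close> of
  the basic hypergeometric factor enters.\<close>
theorem lifted_saalschuetz:
  fixes A B C D F Z \<alpha> :: complex
  defines "t \<equiv> C * D * F"
  assumes CD: "C \<noteq> 0" "D \<noteq> 0" "A \<noteq> 0"
    and nz: "qinf (B * C) \<noteq> 0" "qinf (B * D) \<noteq> 0" "qinf (F * C) \<noteq> 0" "qinf (F * D) \<noteq> 0"
       "qinf (A * C) \<noteq> 0" "qinf (A * D) \<noteq> 0"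
    and Z: "norm (C * Z) < 1" "norm (D * Z) < 1" "norm (t * Z) < 1"
  shows "(\<Sum>n. weight B F C D n * lifted_series t B A \<alpha> Z (C * q ^ n)) - (\<Sum>n. weight B F D C n * lifted_series t B A \<alpha> Z (D * q ^ n))
    = prefactor B C D F * (\<Sum>j. qfin \<alpha> j * Z ^ j * (tau_r B C D j / qfin q j * eta_r t B C D A j)
         * (qinf (\<alpha> * q ^ j * (C * Z)) / qinf (C * Z)))"
proof -
  have t: "t = C * D * F" by (simp add: t_def)
  obtain K where K: "K > 0" "\<And>i. norm (qinf (A * B * C * D * q ^ i) / qinf (A * C * q ^ i)) \<le> K"
    by (rule bounded_ratio[OF tendsto_qinf_power tendsto_qinf_power, of "A * B * C * D" "A * C"]) auto
  define E where "E = exp (norm (B * C) / (1 - norm q))"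
  define M where "M = E * K * norm (qinf (A * t) / qinf (A * D))"
  have bd: "norm (tau_r B C D j * eta_r t B C D A j) \<le> M * norm D ^ j" for j
  proof -
    have "norm (tau_r B C D j * eta_r t B C D A j) = norm D ^ j * (norm (qfin (B * C) j)
       * norm (qinf (A * B * C * D * q ^ j) / qinf (A * C * q ^ j)) * norm (qinf (A * t) / qinf (A * D)))"
      unfolding tau_r_def eta_r_def by (simp add: norm_mult norm_divide norm_power)
    also have "\<dots> \<le> norm D ^ j * M"
      unfolding M_def using K by (intro mult_left_mono mult_mono) (auto simp: E_def norm_qfin_le)
    finally show ?thesis by (simp add: mult_ac)
  qed
  have M: "0 \<le> M" unfolding M_def E_def using K by simp
  have 0: "(\<lambda>k. qfin \<alpha> k * Z ^ k * delta_r t B C D A k) sums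
     (\<Sum>j. qfin \<alpha> j * Z ^ j * (tau_r B C D j / qfin q j * eta_r t B C D A j) * (qinf (\<alpha> * q ^ j * (C * Z)) / qinf (C * Z)))"
    unfolding delta_r_def by (rule qconv_genfun[OF Z(1) bd _ _ M]) (use Z in \<open>auto simp: norm_mult\<close>)
  note 1 = lifted_genfun_swap(1)[OF Z(1) Z(3), of \<alpha> B F D A]
  note 2 = lifted_genfun_swap(1)[OF Z(2) Z(3), of \<alpha> B F C A]
  have "(\<lambda>k. prefactor B C D F * (qfin \<alpha> k * Z ^ k * delta_r t B C D A k)) sums
    ((\<Sum>n. weight B F C D n * lifted_series t B A \<alpha> Z (C * q ^ n)) - (\<Sum>n. weight B F D C n * lifted_series t B A \<alpha> Z (D * q ^ n)))"
  proof -
    have "prefactor B C D F * (qfin \<alpha> k * Z ^ k * delta_r t B C D A k) =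
       qfin \<alpha> k * Z ^ k * (\<Sum>n. weight B F C D n * delta_l t B A (C * q ^ n) k)
       - qfin \<alpha> k * Z ^ k * (\<Sum>n. weight B F D C n * delta_l t B A (D * q ^ n) k)" for k
      using lifted_coefficient_identity[OF CD(1,2) t nz(1-4) CD(3) nz(5,6), of k]
      by (simp add: right_diff_distrib[symmetric] mult_ac)
    thus ?thesis using sums_diff[OF 1 2] by (simp only:)
  qed
  from sums_unique2[OF this sums_mult[OF 0]] show ?thesis .
qed

section \<open>The difference of the two residue sums\<close>

text \<open>The series \<open>phi32\<close> as a function of \<open>x\<close> has poles through its
  lower parameters \<open>\<alpha> * G * x\<close> and \<open>S * x\<close>. Multiplying by the two
  infinite products with these arguments gives \<open>Nphi\<close>, which is entire in
  \<open>x\<close>.\<close>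
definition Nphi_term where
  "Nphi_term A B \<alpha> G S Y x j = qfin \<alpha> j / qfin q j * Y ^ j * qfin (A * x) j * qfin (B * x) j
     * qinf (\<alpha> * G * x * q ^ j) * qinf (S * x * q ^ j)"

definition Nphi where
  "Nphi A B \<alpha> G S Y x = (\<Sum>j. Nphi_term A B \<alpha> G S Y x j)"

lemma Nphi_term_bound:
  obtains K where "\<And>x j. norm x \<le> r \<Longrightarrow> norm (Nphi_term A B \<alpha> G S Y x j) \<le> K * norm Y ^ j"
proof -
  obtain K0 where K0: "K0 > 0" "\<And>n. norm (qfin \<alpha> n / qfin q n) \<le> K0" by (rule bounded_qbinom_coeff[of \<alpha>]) blast
  define e :: "complex \<Rightarrow> real" where "e = (\<lambda>y. exp (norm y * r / (1 - norm q)))"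
  show thesis
  proof (rule that[of "K0 * e A * e B * e (\<alpha> * G) * e S"])
    fix x j assume x: "norm (x :: complex) \<le> r"
    have 1: "norm (qfin (y * x) j) \<le> e y" for y
      unfolding e_def by (rule norm_qfin_le') (simp add: norm_mult mult_left_mono x)
    have 2: "norm (qinf (y * x * q ^ j)) \<le> e y" for y
      unfolding e_def by (rule norm_qfin_le', rule norm_mult_power_le) (simp add: norm_mult mult_left_mono x)
    have "norm (Nphi_term A B \<alpha> G S Y x j)
      = norm (qfin \<alpha> j / qfin q j) * norm Y ^ j * norm (qfin (A * x) j) * norm (qfin (B * x) j)
        * norm (qinf (\<alpha> * G * x * q ^ j)) * norm (qinf (S * x * q ^ j))"
      unfolding Nphi_term_def by (simp add: norm_mult norm_divide norm_power)
    also have "\<dots> \<le> K0 * norm Y ^ j * e A * e B * e (\<alpha> * G) * e S"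
      using K0 by (intro mult_mono mult_nonneg_nonneg 1 2 K0) (auto simp: e_def)
    finally show "norm (Nphi_term A B \<alpha> G S Y x j) \<le> K0 * e A * e B * e (\<alpha> * G) * e S * norm Y ^ j"
      by (simp add: mult_ac)
  qed
qed

lemma summable_Nphi:
  assumes "norm Y < 1"
  shows "summable (Nphi_term A B \<alpha> G S Y x)"
proof -
  obtain K where K: "\<And>x' j. norm x' \<le> norm x \<Longrightarrow> norm (Nphi_term A B \<alpha> G S Y x' j) \<le> K * norm Y ^ j"
    by (rule Nphi_term_bound) blast
  show ?thesis
    by (rule summable_bounded_geometric[OF K]) (use assms in auto)
qed

lemma holomorphic_Nphi_UNIV:
  assumes Y: "norm Y < 1"
  shows "Nphi A B \<alpha> G S Y holomorphic_on UNIV"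
proof (rule holomorphic_uniform_sequence[where f = "\<lambda>n x. \<Sum>j<n. Nphi_term A B \<alpha> G S Y x j"])
  show "(\<lambda>x. \<Sum>j<n. Nphi_term A B \<alpha> G S Y x j) holomorphic_on UNIV" for n
    unfolding Nphi_term_def by (intro holomorphic_intros)
  fix x0 :: complex
  obtain K where K: "\<And>x j. norm x \<le> norm x0 + 1 \<Longrightarrow> norm (Nphi_term A B \<alpha> G S Y x j) \<le> K * norm Y ^ j"
    by (rule Nphi_term_bound) blast
  have "uniform_limit (cball x0 1) (\<lambda>n x. \<Sum>j<n. Nphi_term A B \<alpha> G S Y x j) (Nphi A B \<alpha> G S Y) sequentially"
    unfolding Nphi_def
  proof (rule Weierstrass_m_test)
    fix j x assume "x \<in> cball x0 1"
    hence "norm x \<le> norm x0 + 1"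
      by (metis mem_cball dist_norm norm_minus_commute add.commute diff_le_eq order_trans norm_triangle_ineq2)
    thus "norm (Nphi_term A B \<alpha> G S Y x j) \<le> K * norm Y ^ j" by (rule K)
  qed (use Y in \<open>auto intro!: summable_mult summable_geometric\<close>)
  thus "\<exists>d>0. cball x0 d \<subseteq> UNIV \<and> uniform_limit (cball x0 d) (\<lambda>n x. \<Sum>j<n. Nphi_term A B \<alpha> G S Y x j) (Nphi A B \<alpha> G S Y) sequentially"
    by (intro exI[of _ 1]) auto
qed auto

lemma Nphi_eq_phi32:
  assumes Y: "norm Y < 1" and nz: "qinf (\<alpha> * G * x) \<noteq> 0" "qinf (S * x) \<noteq> 0"
  shows "Nphi A B \<alpha> G S Y x = qinf (\<alpha> * G * x) * qinf (S * x) * phi32 \<alpha> (A * x) (B * x) (\<alpha> * G * x) (S * x) q Y"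
proof -
  define f where "f = (\<lambda>j. qfin \<alpha> j * qfin (A * x) j * qfin (B * x) j
          / (qfin q j * qfin (\<alpha> * G * x) j * qfin (S * x) j) * Y ^ j)"
  have t: "Nphi_term A B \<alpha> G S Y x = (\<lambda>j. qinf (\<alpha> * G * x) * qinf (S * x) * f j)"
  proof
    fix j
    show "Nphi_term A B \<alpha> G S Y x j = qinf (\<alpha> * G * x) * qinf (S * x) * f j"
      using qinf_split[of "\<alpha> * G * x" j] qinf_split[of "S * x" j] qfin_nonzero[OF nz(1), of j] qfin_nonzero[OF nz(2), of j]
      unfolding Nphi_term_def f_def by (simp add: mult_ac)
  qed
  have "summable (\<lambda>j. qinf (\<alpha> * G * x) * qinf (S * x) * f j)"
    using summable_Nphi[OF Y, of A B \<alpha> G S x] unfolding t .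
  hence "summable f" using nz by (subst (asm) summable_cmult_iff) auto
  thus ?thesis unfolding Nphi_def phi32_def f_def[symmetric] t by (rule suminf_mult)
qed

text \<open>In terms of \<open>x = q\<^sup>s\<close> the integrand is \<open>Pnum / Pden\<close> times
  the factor with the two sines. The numerator is entire, so every pole of the quotient is a zero of the
  denominator.\<close>
definition Pnum where
  "Pnum A B C D F G \<alpha> x = x * qinf (q * x / C) * qinf (q * x / D) * Nphi A B \<alpha> G (A * B * C * D * F) (C * D * F * G) x"
definition Pden where
  "Pden A B F G x = qinf (A * x) * qinf (B * x) * qinf (F * x) * qinf (G * x)"

text \<open>At a node \<open>x = C * q ^ n\<close> the argument \<open>C * D * F * G\<close> of the
  series equals \<open>t * G\<close>, and its terms are those of \<open>lifted_series\<close> up to a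
  common factor.\<close>
lemma Pnum_at_node:
  assumes "C \<noteq> 0" "D \<noteq> 0" and nz: "qinf (A * x) \<noteq> 0" and x: "x = C * q ^ n" and Y: "norm (C * D * F * G) < 1"
  defines "t \<equiv> C * D * F"
  shows "Pnum A B C D F G \<alpha> x / Pden A B F G x = weight B F C D n *
     lifted_series t B A \<alpha> G x"
proof -
  have e: "qfin \<alpha> j * G ^ j * (tau_l t B x j / qfin q j * eta_l t B A x j)
        * (qinf (\<alpha> * q ^ j * (x * G)) / qinf (x * G))
      = 1 / (qinf (A * x) * qinf (G * x)) * Nphi_term A B \<alpha> G (A * B * C * D * F) (C * D * F * G) x j" for j
  proof -
    have 1: "qinf (A * x) = qfin (A * x) j * qinf (A * x * q ^ j)" by (rule qinf_split)
    have 2: "qfin (A * x) j \<noteq> 0" by (rule qfin_nonzero[OF nz])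
    have 3: "qinf (\<alpha> * q ^ j * (x * G)) = qinf (\<alpha> * G * x * q ^ j)" "qinf (x * G) = qinf (G * x)"
      "A * B * t * x * q ^ j = A * B * C * D * F * x * q ^ j" by (simp_all add: t_def mult_ac)
    show ?thesis unfolding tau_l_def eta_l_def Nphi_term_def 3 1 using 2
      by (simp add: t_def power_mult_distrib mult_ac)
  qed
  have "lifted_series t B A \<alpha> G x
     = 1 / (qinf (A * x) * qinf (G * x)) * Nphi A B \<alpha> G (A * B * C * D * F) (C * D * F * G) x"
    unfolding lifted_series_def e Nphi_def by (rule suminf_mult[OF summable_Nphi[OF Y]])
  moreover have "weight B F C D n = x * qinf (q * x / C) * qinf (q * x / D) / (qinf (B * x) * qinf (F * x))"
  proof -
    have eqs: "q * x / C = q ^ Suc n" "q * x / D = C / D * q ^ Suc n" "B * x = B * C * q ^ n" "F * x = F * C * q ^ n"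
      using assms(1) by (simp_all add: x)
    show ?thesis unfolding weight_def eqs by (simp only: x)
  qed
  ultimately show ?thesis unfolding Pnum_def Pden_def by (simp add: mult_ac)
qed

text \<open>The value of the residue sums. The lifted formula gives the right-hand side as a series in
  \<open>eta_r\<close> and \<open>tau_r\<close>; splitting off the products with shifted argument turns
  its terms into those of the \<open>3phi2\<close> series with argument \<open>D * G\<close>.\<close>
theorem node_sums_evaluation:
  fixes A B C D F G \<alpha> :: complex
  defines "P \<equiv> \<lambda>x. Pnum A B C D F G \<alpha> x / Pden A B F G x"
  assumes CD: "C \<noteq> 0" "D \<noteq> 0" "A \<noteq> 0"
    and nz: "qinf (A * C) \<noteq> 0" "qinf (A * D) \<noteq> 0" "qinf (B * C) \<noteq> 0" "qinf (B * D) \<noteq> 0"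
      "qinf (F * C) \<noteq> 0" "qinf (F * D) \<noteq> 0"
    and Z: "norm (C * G) < 1" "norm (D * G) < 1" "norm (C * D * F * G) < 1"
    and phi: "\<And>k. qfin (\<alpha> * C * G) k \<noteq> 0" "\<And>k. qfin (A * B * C * D) k \<noteq> 0"
  shows "summable (\<lambda>n. P (C * q ^ n))" "summable (\<lambda>n. P (D * q ^ n))"
    "(\<Sum>n. P (C * q ^ n)) - (\<Sum>n. P (D * q ^ n)) =
       C * (qinf q * qinf (q * C / D) * qinf (D / C) * qinf (A * B * C * D) * qinf (A * C * D * F)
         * qinf (B * C * D * F) * qinf (\<alpha> * C * G)
         / (qinf (A * C) * qinf (A * D) * qinf (B * C) * qinf (B * D) * qinf (F * C) * qinf (C * G) * qinf (F * D)))
       * phi32 \<alpha> (A * C) (B * C) (\<alpha> * C * G) (A * B * C * D) q (D * G)"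
proof -
  define t where "t = C * D * F"
  have tG: "norm (t * G) < 1" using Z by (simp add: t_def)
  have nodeC: "P (C * q ^ n) = weight B F C D n * lifted_series t B A \<alpha> G (C * q ^ n)" for n
    unfolding P_def t_def
    by (rule Pnum_at_node) (use CD Z qinf_shift_nonzero[OF nz(1), of n] in \<open>auto simp: mult.assoc\<close>)
  have nodeD: "P (D * q ^ n) = weight B F D C n * lifted_series t B A \<alpha> G (D * q ^ n)" for n
  proof -
    have sw: "Pnum A B C D F G \<alpha> x = Pnum A B D C F G \<alpha> x" for x
      unfolding Pnum_def by (simp add: mult_ac)
    have "Pnum A B D C F G \<alpha> (D * q ^ n) / Pden A B F G (D * q ^ n) = weight B F D C n *
       lifted_series (D * C * F) B A \<alpha> G (D * q ^ n)"
      by (rule Pnum_at_node) (use CD Z qinf_shift_nonzero[OF nz(2), of n] in \<open>auto simp: mult_ac\<close>)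
    thus ?thesis unfolding P_def t_def sw by (simp only: mult.commute[of D C])
  qed
  show "summable (\<lambda>n. P (C * q ^ n))"
    unfolding nodeC by (rule lifted_genfun_swap(2)[OF Z(1) tG])
  show "summable (\<lambda>n. P (D * q ^ n))"
    unfolding nodeD by (rule lifted_genfun_swap(2)[OF Z(2) tG])
  have main: "(\<Sum>n. P (C * q ^ n)) - (\<Sum>n. P (D * q ^ n)) =
    prefactor B C D F * (\<Sum>j. qfin \<alpha> j * G ^ j * (tau_r B C D j / qfin q j * eta_r t B C D A j)
         * (qinf (\<alpha> * q ^ j * (C * G)) / qinf (C * G)))"
    unfolding nodeC nodeD t_def
    by (rule lifted_saalschuetz) (use CD nz Z in auto)
  define W where "W = qinf (A * t) * qinf (A * B * C * D) * qinf (\<alpha> * C * G) / (qinf (A * C) * qinf (A * D) * qinf (C * G))"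
  have CGnz: "qinf (C * G) \<noteq> 0" by (rule qinf_nonzero[OF Z(1)])
  have e: "qfin \<alpha> j * G ^ j * (tau_r B C D j / qfin q j * eta_r t B C D A j)
         * (qinf (\<alpha> * q ^ j * (C * G)) / qinf (C * G))
      = W * (qfin \<alpha> j * qfin (A * C) j * qfin (B * C) j / (qfin q j * qfin (\<alpha> * C * G) j * qfin (A * B * C * D) j) * (D * G) ^ j)" for j
  proof -
    have 1: "qinf (A * C) = qfin (A * C) j * qinf (A * C * q ^ j)"
      "qinf (A * B * C * D) = qfin (A * B * C * D) j * qinf (A * B * C * D * q ^ j)"
      "qinf (\<alpha> * C * G) = qfin (\<alpha> * C * G) j * qinf (\<alpha> * C * G * q ^ j)" by (rule qinf_split)+
    have 2: "qfin (A * C) j \<noteq> 0" by (rule qfin_nonzero[OF nz(1)])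
    have 3: "\<alpha> * q ^ j * (C * G) = \<alpha> * C * G * q ^ j" by (simp add: mult_ac)
    show ?thesis unfolding tau_r_def eta_r_def W_def 3 1 using 2 phi
      by (simp add: power_mult_distrib mult_ac)
  qed
  \<comment> \<open>An infinite product that vanishes would make some finite one vanish, against
    \<open>phi\<close>.\<close>
  have bnd: "summable (\<lambda>j. qfin \<alpha> j * qfin (A * C) j * qfin (B * C) j / (qfin q j * qfin (\<alpha> * C * G) j * qfin (A * B * C * D) j) * (D * G) ^ j)"
  proof (cases "qinf (\<alpha> * C * G) = 0 \<or> qinf (A * B * C * D) = 0")
    case True
    then obtain k where "\<alpha> * C * G * q ^ k = 1 \<or> A * B * C * D * q ^ k = 1" by (auto simp: qinf_eq_0_iff)
    hence "qfin (\<alpha> * C * G) (Suc k) = 0 \<or> qfin (A * B * C * D) (Suc k) = 0" by (auto simp: qfin_Suc)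
    thus ?thesis using phi by blast
  next
    case False
    have "(\<lambda>j. qfin \<alpha> j * qfin (A * C) j * qfin (B * C) j) \<longlonglongrightarrow> qinf \<alpha> * qinf (A * C) * qinf (B * C)"
      "(\<lambda>j. qfin q j * qfin (\<alpha> * C * G) j * qfin (A * B * C * D) j) \<longlonglongrightarrow> qinf q * qinf (\<alpha> * C * G) * qinf (A * B * C * D)"
      by (intro tendsto_mult qfin_tendsto)+
    then obtain K where K: "K > 0" "\<And>j. norm (qfin \<alpha> j * qfin (A * C) j * qfin (B * C) j / (qfin q j * qfin (\<alpha> * C * G) j * qfin (A * B * C * D) j)) \<le> K"
      by (rule bounded_ratio) (use False qinf_nonzero[OF norm_q] in auto)
    show ?thesis
      by (rule summable_bounded_geometric[where K = K and r = "norm (D * G)"])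
         (use K Z in \<open>auto simp only: norm_mult norm_power intro!: mult_right_mono zero_le_power norm_ge_zero mult_nonneg_nonneg\<close>)
  qed
  have eq1: "(\<Sum>n. P (C * q ^ n)) - (\<Sum>n. P (D * q ^ n)) = prefactor B C D F * W * phi32 \<alpha> (A * C) (B * C) (\<alpha> * C * G) (A * B * C * D) q (D * G)"
    unfolding main e phi32_def suminf_mult[OF bnd] by (rule mult.assoc[symmetric])
  have eq2: "prefactor B C D F * W = C * (qinf q * qinf (q * C / D) * qinf (D / C) * qinf (A * B * C * D) * qinf (A * C * D * F)
         * qinf (B * C * D * F) * qinf (\<alpha> * C * G)
         / (qinf (A * C) * qinf (A * D) * qinf (B * C) * qinf (B * D) * qinf (F * C) * qinf (C * G) * qinf (F * D)))"
    unfolding prefactor_def W_def t_def by (simp add: mult_ac)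
  show "(\<Sum>n. P (C * q ^ n)) - (\<Sum>n. P (D * q ^ n)) =
       C * (qinf q * qinf (q * C / D) * qinf (D / C) * qinf (A * B * C * D) * qinf (A * C * D * F)
         * qinf (B * C * D * F) * qinf (\<alpha> * C * G)
         / (qinf (A * C) * qinf (A * D) * qinf (B * C) * qinf (B * D) * qinf (F * C) * qinf (C * G) * qinf (F * D)))
       * phi32 \<alpha> (A * C) (B * C) (\<alpha> * C * G) (A * B * C * D) q (D * G)"
    unfolding eq1 eq2 ..
qed

end

section \<open>Winding numbers of loops along a curve in a strip\<close>

text \<open>The left side of the loop is the arc of the curve between the parameters \<open>a\<close>
  and \<open>b\<close>, traversed downwards. It is parametrised by the larger interval from
  \<open>a'\<close> to \<open>b'\<close>, resting at the end points, so that loops with different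
  truncations can be compared by straight-line homotopies with equal parameter.\<close>
definition clamp_to :: "real \<Rightarrow> real \<Rightarrow> real \<Rightarrow> real" where
  "clamp_to a b t = max a (min b t)"

definition truncated_side :: "(real \<Rightarrow> complex) \<Rightarrow> real \<Rightarrow> real \<Rightarrow> real \<Rightarrow> real \<Rightarrow> real \<Rightarrow> complex" where
  "truncated_side \<gamma> a b a' b' u = \<gamma> (clamp_to a b (b' + u * (a' - b')))"

text \<open>Counterclockwise: from \<open>\<gamma> a\<close> horizontally to the line \<open>Re z =
  R\<close>, up along that line, back to \<open>\<gamma> b\<close>, and down along the curve.\<close>
definition box_loop :: "(real \<Rightarrow> complex) \<Rightarrow> real \<Rightarrow> real \<Rightarrow> real \<Rightarrow> real \<Rightarrow> real \<Rightarrow> real \<Rightarrow> complex" where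
  "box_loop \<gamma> a b a' b' R =
     linepath (\<gamma> a) (Complex R (Im (\<gamma> a))) +++
     linepath (Complex R (Im (\<gamma> a))) (Complex R (Im (\<gamma> b))) +++
     linepath (Complex R (Im (\<gamma> b))) (\<gamma> b) +++
     truncated_side \<gamma> a b a' b'"

lemma segments_avoid_join:
  assumes "\<And>t. t \<in> {0..1} \<Longrightarrow> z \<notin> closed_segment (g1 t) (h1 t)"
    and "\<And>t. t \<in> {0..1} \<Longrightarrow> z \<notin> closed_segment (g2 t) (h2 t)"
    and "t \<in> {0..1}"
  shows "z \<notin> closed_segment ((g1 +++ g2) t) ((h1 +++ h2) t)"
  using assms(1)[of "2 * t"] assms(2)[of "2 * t - 1"] assms(3) by (auto simp: joinpaths_def)

text \<open>The usual way to check that a straight-line homotopy misses \<open>z\<close>: both sides lie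
  in a common half-plane without \<open>z\<close>.\<close>
lemma segments_avoid_linepath:
  fixes z :: complex
  assumes "convex H" "z \<notin> H" "a \<in> H" "b \<in> H" "c \<in> H" "d \<in> H" "t \<in> {0..1}"
  shows "z \<notin> closed_segment (linepath a b t) (linepath c d t)"
proof -
  have "linepath a b t \<in> H" "linepath c d t \<in> H"
    using assms by (auto intro!: convexD_alt simp: linepath_def)
  hence "closed_segment (linepath a b t) (linepath c d t) \<subseteq> H"
    by (rule closed_segment_subset) fact
  thus ?thesis using assms(2) by blast
qed

lemma convex_complex_halfspaces:
  "convex {z. Im z < c}" "convex {z. c < Im z}" "convex {z. Re z < c}" "convex {z. c < Re z}"
  "convex {z. Re z \<le> c}" "convex {z. c \<le> Re z}"  "convex {z. c \<le> Im z}" "convex {z. Im z \<le> c}"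
  using convex_halfspace_Im_lt[of c] convex_halfspace_Im_gt[of c] convex_halfspace_Re_lt[of c]
    convex_halfspace_Re_gt[of c] convex_halfspace_Re_le[of c] convex_halfspace_Re_ge[of c]
    convex_halfspace_Im_ge[of c] convex_halfspace_Im_le[of c]
  by (auto simp: conj_commute)

text \<open>A curve that follows the imaginary axis at bounded distance, with the parameter as
  approximate height. It may oscillate and intersect itself.\<close>
locale strip_curve =
  fixes \<gamma> :: "real \<Rightarrow> complex" and M :: real
  assumes cont: "continuous_on UNIV \<gamma>" and near: "\<And>t. norm (\<gamma> t - \<i> * of_real t) \<le> M"
begin

lemma Re_le: "\<bar>Re (\<gamma> t)\<bar> \<le> M" and Im_le: "\<bar>Im (\<gamma> t) - t\<bar> \<le> M"
  using near[of t] abs_Re_le_cmod[of "\<gamma> t - \<i> * of_real t"] abs_Im_le_cmod[of "\<gamma> t - \<i> * of_real t"]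
  by simp_all

lemma closed_range: "closed (range \<gamma>)"
proof (subst closure_subset_eq[symmetric], rule subsetI)
  fix z assume z: "z \<in> closure (range \<gamma>)"
  define B where "B = \<bar>Im z\<bar> + M + 1"
  have "compact (\<gamma> ` {-B..B})"
    by (intro compact_continuous_image continuous_on_subset[OF cont]) auto
  hence cl: "closed (\<gamma> ` {-B..B})" by (rule compact_imp_closed)
  have "range \<gamma> \<subseteq> \<gamma> ` {-B..B} \<union> {w. \<bar>Im z\<bar> + 1 \<le> \<bar>Im w\<bar>}"
  proof (rule image_subsetI)
    fix t
    show "\<gamma> t \<in> \<gamma> ` {-B..B} \<union> {w. \<bar>Im z\<bar> + 1 \<le> \<bar>Im w\<bar>}"
    proof (cases "\<bar>Im z\<bar> + 1 \<le> \<bar>Im (\<gamma> t)\<bar>")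
      case False
      thus ?thesis using Im_le[of t] by (intro UnI1 imageI) (auto simp: B_def)
    qed simp
  qed
  moreover have "closed {w. \<bar>Im z\<bar> + 1 \<le> \<bar>Im w\<bar>}"
    by (intro closed_Collect_le continuous_intros)
  ultimately have "closure (range \<gamma>) \<subseteq> \<gamma> ` {-B..B} \<union> {w. \<bar>Im z\<bar> + 1 \<le> \<bar>Im w\<bar>}"
    using cl by (intro closure_minimal closed_Un) auto
  with z show "z \<in> range \<gamma>" by auto
qed

lemma truncated_side_ends [simp]:
  assumes "a' \<le> a" "a \<le> b" "b \<le> b'"
  shows "pathstart (truncated_side \<gamma> a b a' b') = \<gamma> b" "pathfinish (truncated_side \<gamma> a b a' b') = \<gamma> a"
  using assms by (auto simp: pathstart_def pathfinish_def truncated_side_def clamp_to_def max_def min_def intro!: arg_cong[where f = \<gamma>])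

lemma path_truncated_side [simp]: "path (truncated_side \<gamma> a b a' b')"
  unfolding path_def truncated_side_def clamp_to_def
  by (intro continuous_on_compose2[OF cont] continuous_intros) auto

lemma path_image_truncated_side: "path_image (truncated_side \<gamma> a b a' b') \<subseteq> range \<gamma>"
  by (auto simp: path_image_def truncated_side_def)

lemma box_loop_simps [simp]:
  assumes "a' \<le> a" "a \<le> b" "b \<le> b'"
  shows "path (box_loop \<gamma> a b a' b' R)" "pathstart (box_loop \<gamma> a b a' b' R) = \<gamma> a"
    "pathfinish (box_loop \<gamma> a b a' b' R) = \<gamma> a"
  using assms by (auto simp: box_loop_def)

lemma path_image_box_loop:
  assumes "a' \<le> a" "a \<le> b" "b \<le> b'"
  shows "path_image (box_loop \<gamma> a b a' b' R) \<subseteq> closed_segment (\<gamma> a) (Complex R (Im (\<gamma> a)))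
     \<union> closed_segment (Complex R (Im (\<gamma> a))) (Complex R (Im (\<gamma> b)))
     \<union> closed_segment (Complex R (Im (\<gamma> b))) (\<gamma> b) \<union> range \<gamma>"
  using assms path_image_truncated_side[of a b a' b']
  by (auto simp: box_loop_def path_image_join)

text \<open>Corresponding points of the two loops lie on the same side of \<open>p\<close>, except on
  the part of the curve that they share.\<close>
lemma winding_box_loop_enlarge:
  assumes ord: "a' \<le> a" "a \<le> b" "b \<le> b'" and R: "Re p < R" "R \<le> R'"
    and top: "\<And>t. b \<le> t \<Longrightarrow> Im p < Im (\<gamma> t)" and bot: "\<And>t. t \<le> a \<Longrightarrow> Im (\<gamma> t) < Im p"
    and p: "p \<notin> range \<gamma>"
  shows "winding_number (box_loop \<gamma> a b a' b' R) p = winding_number (box_loop \<gamma> a' b' a' b' R') p"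
proof (rule winding_number_loops_linear_eq)
  fix t :: real assume t: "t \<in> {0..1}"
  show "p \<notin> closed_segment (box_loop \<gamma> a' b' a' b' R' t) (box_loop \<gamma> a b a' b' R t)"
    unfolding box_loop_def
  proof (intro segments_avoid_join t)
    fix t :: real assume t: "t \<in> {0..1}"
    show "p \<notin> closed_segment (linepath (\<gamma> a') (Complex R' (Im (\<gamma> a'))) t) (linepath (\<gamma> a) (Complex R (Im (\<gamma> a))) t)"
      using ord bot by (intro segments_avoid_linepath[OF convex_complex_halfspaces(1)[of "Im p"]] t) auto
    show "p \<notin> closed_segment (linepath (Complex R' (Im (\<gamma> a'))) (Complex R' (Im (\<gamma> b'))) t)
       (linepath (Complex R (Im (\<gamma> a))) (Complex R (Im (\<gamma> b))) t)"
      using R by (intro segments_avoid_linepath[OF convex_complex_halfspaces(4)[of "Re p"]] t) auto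
    show "p \<notin> closed_segment (linepath (Complex R' (Im (\<gamma> b'))) (\<gamma> b') t) (linepath (Complex R (Im (\<gamma> b))) (\<gamma> b) t)"
      using ord top by (intro segments_avoid_linepath[OF convex_complex_halfspaces(2)[of "Im p"]] t) auto
    define s where "s = b' + t * (a' - b')"
    have s: "a' \<le> s" "s \<le> b'"
    proof -
      have "t * (b' - a') \<le> 1 * (b' - a')" using t ord by (intro mult_right_mono) auto
      thus "a' \<le> s" by (simp add: s_def algebra_simps)
      have "0 \<le> t * (b' - a')" using t ord by auto
      thus "s \<le> b'" by (simp add: s_def algebra_simps)
    qed
    have "p \<notin> closed_segment (\<gamma> s) (\<gamma> (clamp_to a b s))"
    proof (cases "b < s \<or> s < a")
      case False
      hence "clamp_to a b s = s" by (auto simp: clamp_to_def)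
      thus ?thesis using p by auto
    next
      case True
      thus ?thesis
      proof
        assume "b < s"
        hence "clamp_to a b s = b" using ord by (auto simp: clamp_to_def)
        moreover have "closed_segment (\<gamma> s) (\<gamma> b) \<subseteq> {z. Im p < Im z}"
          using \<open>b < s\<close> top by (intro closed_segment_subset convex_complex_halfspaces) auto
        ultimately show ?thesis by auto
      next
        assume "s < a"
        hence "clamp_to a b s = a" using ord by (auto simp: clamp_to_def)
        moreover have "closed_segment (\<gamma> s) (\<gamma> a) \<subseteq> {z. Im z < Im p}"
          using \<open>s < a\<close> bot by (intro closed_segment_subset convex_complex_halfspaces) auto
        ultimately show ?thesis by auto
      qed
    qed
    moreover have "clamp_to a' b' s = s" using s by (auto simp: clamp_to_def)
    ultimately show "p \<notin> closed_segment (truncated_side \<gamma> a' b' a' b' t) (truncated_side \<gamma> a b a' b' t)"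
      by (simp add: truncated_side_def s_def)
  qed
qed (use ord in auto)

lemma winding_box_loop_reparametrize:
  assumes ord: "a' \<le> a" "a < b" "b \<le> b'" and p: "p \<notin> path_image (box_loop \<gamma> a b a b R)"
  shows "winding_number (box_loop \<gamma> a b a' b' R) p = winding_number (box_loop \<gamma> a b a b R) p"
proof -
  define f where "f = (\<lambda>u. (b - clamp_to a b (b' + u * (a' - b'))) / (b - a))"
  have q: "truncated_side \<gamma> a b a' b' u = truncated_side \<gamma> a b a b (f u)" for u
  proof -
    have c: "b + f u * (a - b) = clamp_to a b (b' + u * (a' - b'))"
      using ord by (simp add: f_def field_simps)
    have "clamp_to a b (clamp_to a b x) = clamp_to a b x" for x
      using ord by (auto simp: clamp_to_def)
    thus ?thesis unfolding truncated_side_def c by simp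
  qed
  have pi: "p \<notin> path_image (linepath (\<gamma> a) (Complex R (Im (\<gamma> a))))"
    "p \<notin> path_image (linepath (Complex R (Im (\<gamma> a))) (Complex R (Im (\<gamma> b))))"
    "p \<notin> path_image (linepath (Complex R (Im (\<gamma> b))) (\<gamma> b))"
    "p \<notin> path_image (truncated_side \<gamma> a b a b)"
    using p ord by (auto simp: box_loop_def path_image_join)
  have "homotopic_paths (- {p}) (truncated_side \<gamma> a b a b) (truncated_side \<gamma> a b a' b')"
  proof (rule homotopic_paths_reparametrize[where f = f])
    show "path_image (truncated_side \<gamma> a b a b) \<subseteq> - {p}" using pi by auto
    show "continuous_on {0..1} f" unfolding f_def clamp_to_def using ord by (intro continuous_intros) auto
    show "f \<in> {0..1} \<rightarrow> {0..1}"
      using ord unfolding f_def clamp_to_def by (auto simp: divide_simps)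
    show "f 0 = 0" "f 1 = 1" using ord unfolding f_def clamp_to_def by (auto simp: max_def min_def)
  qed (auto simp: q)
  hence h: "homotopic_paths (- {p}) (truncated_side \<gamma> a b a' b') (truncated_side \<gamma> a b a b)"
    by (rule homotopic_paths_sym)
  have r: "homotopic_paths (- {p}) (linepath x y) (linepath x y)" if "p \<notin> path_image (linepath x y)" for x y
    using that by (auto simp: homotopic_paths_refl)
  have "homotopic_paths (- {p}) (box_loop \<gamma> a b a' b' R) (box_loop \<gamma> a b a b R)"
    unfolding box_loop_def using ord by (intro homotopic_paths_join r h pi) auto
  thus ?thesis by (rule winding_number_homotopic_paths)
qed

text \<open>For a point to the right of the whole strip, replacing the curve by a vertical line does not
  change the winding number, and the rectangle has winding number 1.\<close>
lemma winding_box_loop_inside: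
  assumes ord: "a \<le> b" and z: "M < Re z" "Re z < R" "Im (\<gamma> a) < Im z" "Im z < Im (\<gamma> b)"
  shows "winding_number (box_loop \<gamma> a b a b R) z = 1"
proof -
  define a1 a3 where "a1 = Complex (- M - 1) (Im (\<gamma> a))" and "a3 = Complex R (Im (\<gamma> b))"
  have M: "0 \<le> M" using near[of 0] norm_ge_zero order_trans by blast
  have "winding_number (box_loop \<gamma> a b a b R) z = winding_number (rectpath a1 a3) z"
  proof (rule winding_number_loops_linear_eq)
    fix t :: real assume t: "t \<in> {0..1}"
    show "z \<notin> closed_segment (rectpath a1 a3 t) (box_loop \<gamma> a b a b R t)"
      unfolding box_loop_def rectpath_def Let_def
    proof (intro segments_avoid_join t)
      fix t :: real assume t: "t \<in> {0..1}"
      show "z \<notin> closed_segment (linepath a1 (Complex (Re a3) (Im a1)) t) (linepath (\<gamma> a) (Complex R (Im (\<gamma> a))) t)"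
        using z by (intro segments_avoid_linepath[OF convex_complex_halfspaces(1)[of "Im z"]] t) (auto simp: a1_def)
      show "z \<notin> closed_segment (linepath (Complex (Re a3) (Im a1)) a3 t) (linepath (Complex R (Im (\<gamma> a))) (Complex R (Im (\<gamma> b))) t)"
        using z by (intro segments_avoid_linepath[OF convex_complex_halfspaces(4)[of "Re z"]] t) (auto simp: a3_def)
      show "z \<notin> closed_segment (linepath a3 (Complex (Re a1) (Im a3)) t) (linepath (Complex R (Im (\<gamma> b))) (\<gamma> b) t)"
        using z by (intro segments_avoid_linepath[OF convex_complex_halfspaces(2)[of "Im z"]] t) (auto simp: a3_def)
      have "closed_segment (linepath (Complex (Re a1) (Im a3)) a1 t) (truncated_side \<gamma> a b a b t) \<subseteq> {w. Re w \<le> M}"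
      proof (intro closed_segment_subset convex_complex_halfspaces)
        have "linepath (Complex (Re a1) (Im a3)) a1 t \<in> closed_segment (Complex (Re a1) (Im a3)) a1"
          using t by (auto simp: linepath_def closed_segment_def)
        also have "\<dots> \<subseteq> {w. Re w \<le> M}"
          using M by (intro closed_segment_subset convex_complex_halfspaces) (auto simp: a1_def)
        finally show "linepath (Complex (Re a1) (Im a3)) a1 t \<in> {w. Re w \<le> M}" .
        show "truncated_side \<gamma> a b a b t \<in> {w. Re w \<le> M}"
          using Re_le by (auto simp: truncated_side_def abs_le_iff)
      qed
      thus "z \<notin> closed_segment (linepath (Complex (Re a1) (Im a3)) a1 t) (truncated_side \<gamma> a b a b t)"
        using z by auto
    qed
  qed (use ord in auto)
  also have "\<dots> = 1"
    using z M by (intro winding_number_rectpath) (auto simp: in_box_complex_iff a1_def a3_def)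
  finally show ?thesis .
qed

lemma winding_box_loop_outside:
  assumes "a \<le> b" "z \<notin> S" "convex S" "range \<gamma> \<subseteq> S" "Complex R (Im (\<gamma> a)) \<in> S" "Complex R (Im (\<gamma> b)) \<in> S"
  shows "winding_number (box_loop \<gamma> a b a b R) z = 0"
proof (rule winding_number_zero_outside[OF _ \<open>convex S\<close>])
  have "closed_segment (\<gamma> a) (Complex R (Im (\<gamma> a)))
     \<union> closed_segment (Complex R (Im (\<gamma> a))) (Complex R (Im (\<gamma> b)))
     \<union> closed_segment (Complex R (Im (\<gamma> b))) (\<gamma> b) \<union> range \<gamma> \<subseteq> S"
    using assms by (intro Un_least closed_segment_subset) auto
  thus "path_image (box_loop \<gamma> a b a b R) \<subseteq> S"
    by (rule order.trans[OF path_image_box_loop, rotated -1]) (use assms in auto)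
qed (use assms in auto)

text \<open>The relation between topological separation and winding numbers. A path from
  \<open>p\<close> to \<open>z\<close> off the curve is compact, so a sufficiently large loop meets it
  at most on the curve, that is, not at all; hence \<open>p\<close> and \<open>z\<close> have the same
  winding number with respect to the large loop. The hypotheses \<open>top\<close> and
  \<open>bot\<close> keep \<open>p\<close> away from the truncation heights, so that enlarging the loop
  does not sweep over \<open>p\<close>.\<close>
lemma winding_box_loop_component:
  assumes cc: "connected_component (- range \<gamma>) p z"
    and ord: "a < b" and R: "Re p < R"
    and top: "\<And>t. b \<le> t \<Longrightarrow> Im p < Im (\<gamma> t)" and bot: "\<And>t. t \<le> a \<Longrightarrow> Im (\<gamma> t) < Im p"
  obtains a' b' R' where "a' \<le> a" "b \<le> b'" "R \<le> R'" "Re z < R'" "Im (\<gamma> a') < Im z" "Im z < Im (\<gamma> b')"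
    "- M \<le> R'" "winding_number (box_loop \<gamma> a b a b R) p = winding_number (box_loop \<gamma> a' b' a' b' R') z"
proof -
  have M: "0 \<le> M" using near[of 0] norm_ge_zero order_trans by blast
  have "path_component (- range \<gamma>) p z"
    using cc closed_range by (subst open_path_connected_component) auto
  then obtain g where g: "path g" "path_image g \<subseteq> - range \<gamma>" "pathstart g = p" "pathfinish g = z"
    unfolding path_component_def by blast
  have "bounded (path_image g)" using g by (intro compact_imp_bounded compact_path_image)
  then obtain H where H: "\<And>w. w \<in> path_image g \<Longrightarrow> norm w \<le> H" unfolding bounded_iff by blast
  have pz: "p \<in> path_image g" "z \<in> path_image g" using g by auto
  have p: "p \<notin> range \<gamma>" using pz g by auto
  have H0: "0 \<le> H" using H[OF pz(1)] norm_ge_zero order_trans by blast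
  \<comment> \<open>So large that the three straight sides miss the disc of radius \<open>H\<close>, which
    contains the path \<open>g\<close>.\<close>
  define a' b' R' where "a' = min a (- H - M - 1)" and "b' = max b (H + M + 1)" and "R' = max R (H + 1)"
  have ord': "a' \<le> a" "a \<le> b" "b \<le> b'" "R \<le> R'" using ord by (auto simp: a'_def b'_def R'_def)
  have ends: "Im (\<gamma> a') < - H" "H < Im (\<gamma> b')" "H < R'"
    using Im_le[of a'] Im_le[of b'] by (auto simp: a'_def b'_def R'_def abs_le_iff)
  have ReIm: "\<bar>Re w\<bar> \<le> H" "\<bar>Im w\<bar> \<le> H" if "w \<in> path_image g" for w
    using H[OF that] abs_Re_le_cmod[of w] abs_Im_le_cmod[of w] by linarith+
  have "Im p < Im (\<gamma> b)" "Im (\<gamma> a) < Im p" using top bot by auto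
  have disj: "path_image g \<inter> path_image (box_loop \<gamma> a' b' a' b' R') = {}"
  proof -
    have "closed_segment (\<gamma> a') (Complex R' (Im (\<gamma> a'))) \<subseteq> {w. Im w < - H}"
      "closed_segment (Complex R' (Im (\<gamma> a'))) (Complex R' (Im (\<gamma> b'))) \<subseteq> {w. H < Re w}"
      "closed_segment (Complex R' (Im (\<gamma> b'))) (\<gamma> b') \<subseteq> {w. H < Im w}"
      using ends by (intro closed_segment_subset convex_complex_halfspaces; simp)+
    moreover have "path_image (box_loop \<gamma> a' b' a' b' R') \<subseteq> closed_segment (\<gamma> a') (Complex R' (Im (\<gamma> a')))
     \<union> closed_segment (Complex R' (Im (\<gamma> a'))) (Complex R' (Im (\<gamma> b')))
     \<union> closed_segment (Complex R' (Im (\<gamma> b'))) (\<gamma> b') \<union> range \<gamma>"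
      using ord' by (intro path_image_box_loop) auto
    ultimately have "path_image (box_loop \<gamma> a' b' a' b' R')
       \<subseteq> {w. Im w < - H} \<union> {w. H < Re w} \<union> {w. H < Im w} \<union> range \<gamma>" by blast
    moreover have "path_image g \<inter> ({w. Im w < - H} \<union> {w. H < Re w} \<union> {w. H < Im w} \<union> range \<gamma>) = {}"
      using ReIm g(2) by (fastforce simp: abs_le_iff)
    ultimately show ?thesis by blast
  qed
  have "p \<notin> path_image (box_loop \<gamma> a b a b R)"
  proof -
    have "closed_segment (\<gamma> a) (Complex R (Im (\<gamma> a))) \<subseteq> {w. Im w < Im p}"
      "closed_segment (Complex R (Im (\<gamma> a))) (Complex R (Im (\<gamma> b))) \<subseteq> {w. Re p < Re w}"
      "closed_segment (Complex R (Im (\<gamma> b))) (\<gamma> b) \<subseteq> {w. Im p < Im w}"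
      using R top[of b] bot[of a] by (intro closed_segment_subset convex_complex_halfspaces; simp)+
    thus ?thesis using path_image_box_loop[of a a b b R] ord p by auto
  qed
  hence "winding_number (box_loop \<gamma> a b a b R) p = winding_number (box_loop \<gamma> a b a' b' R) p"
    using ord ord' by (intro winding_box_loop_reparametrize[symmetric]) auto
  also have "\<dots> = winding_number (box_loop \<gamma> a' b' a' b' R') p"
    using ord' R top bot p by (intro winding_box_loop_enlarge) auto
  also have "\<dots> = winding_number (box_loop \<gamma> a' b' a' b' R') z"
    using ord' disj pz g by (intro winding_number_eq[of _ _ "path_image g"]) (auto intro: connected_path_image)
  finally show thesis
    using ord' ends ReIm[OF pz(2)] H0 M by (intro that[of a' b' R']) (auto simp: abs_le_iff)
qed

text \<open>A point on the left is joined to one further left than the curve, which the loop cannot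
  enclose.\<close>
theorem winding_box_loop_left:
  assumes "lies_left_of p \<gamma>" "a < b" "Re p < R"
    and "\<And>t. b \<le> t \<Longrightarrow> Im p < Im (\<gamma> t)" and "\<And>t. t \<le> a \<Longrightarrow> Im (\<gamma> t) < Im p"
  shows "winding_number (box_loop \<gamma> a b a b R) p = 0"
proof -
  obtain R0 where R0: "\<And>z. Re z \<le> R0 \<Longrightarrow> connected_component (- range \<gamma>) p z"
    using assms(1) unfolding lies_left_of_def by blast
  define z where "z = complex_of_real (min R0 (- M - 1))"
  have "connected_component (- range \<gamma>) p z" by (intro R0) (simp add: z_def)
  from winding_box_loop_component[OF this assms(2-5)] obtain a' b' R' where
    *: "a' \<le> a" "b \<le> b'" "- M \<le> R'"
    "winding_number (box_loop \<gamma> a b a b R) p = winding_number (box_loop \<gamma> a' b' a' b' R') z" by metis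
  have "winding_number (box_loop \<gamma> a' b' a' b' R') z = 0"
    using * \<open>a < b\<close> Re_le
    by (intro winding_box_loop_outside[where S = "{w. - M \<le> Re w}"] convex_complex_halfspaces)
       (auto simp: z_def abs_le_iff minus_le_iff)
  thus ?thesis using * by simp
qed

text \<open>A point on the right is joined to one further right than the curve, which a large loop
  encloses once.\<close>
theorem winding_box_loop_right:
  assumes "lies_right_of p \<gamma>" "a < b" "Re p < R"
    and "\<And>t. b \<le> t \<Longrightarrow> Im p < Im (\<gamma> t)" and "\<And>t. t \<le> a \<Longrightarrow> Im (\<gamma> t) < Im p"
  shows "winding_number (box_loop \<gamma> a b a b R) p = 1"
proof -
  obtain R0 where R0: "\<And>z. Re z \<ge> R0 \<Longrightarrow> connected_component (- range \<gamma>) p z"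
    using assms(1) unfolding lies_right_of_def by blast
  define z where "z = complex_of_real (max R0 (M + 1))"
  have "connected_component (- range \<gamma>) p z" by (intro R0) (simp add: z_def)
  from winding_box_loop_component[OF this assms(2-5)] obtain a' b' R' where
    *: "a' \<le> a" "b \<le> b'" "Re z < R'" "Im (\<gamma> a') < Im z" "Im z < Im (\<gamma> b')"
    "winding_number (box_loop \<gamma> a b a b R) p = winding_number (box_loop \<gamma> a' b' a' b' R') z" by metis
  have "winding_number (box_loop \<gamma> a' b' a' b' R') z = 1"
    using * \<open>a < b\<close> by (intro winding_box_loop_inside) (auto simp: z_def)
  thus ?thesis using * by simp
qed

end

section \<open>Integration along a Lipschitz curve\<close>

lemma integrable_exp_minus_abs: "(\<lambda>x::real. exp (- \<bar>x\<bar>)) integrable_on UNIV"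
proof -
  have pos: "(\<lambda>x::real. exp (- \<bar>x\<bar>)) integrable_on {0..}"
    by (rule integrable_eq[OF integrable_on_exp_minus_to_infinity[of 1 0]]) auto
  hence "(\<lambda>x::real. exp (- \<bar>x\<bar>)) absolutely_integrable_on {0..}"
    by (intro nonnegative_absolutely_integrable_1) auto
  hence "(\<lambda>x::real. exp (- \<bar>- x\<bar>)) absolutely_integrable_on {..0}"
    using has_absolute_integral_reflect_real[of "{..0}" "{0..}" "\<lambda>x. exp (- \<bar>x\<bar>)"] by auto
  hence "(\<lambda>x::real. exp (- \<bar>x\<bar>)) integrable_on {..0}"
    by (simp add: set_lebesgue_integral_eq_integral)
  with pos have "(\<lambda>x::real. exp (- \<bar>x\<bar>)) integrable_on ({..0} \<union> {0..})"
    by (intro integrable_Un negligible_subset[OF negligible_sing[of 0]]) auto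
  moreover have "{..0} \<union> {0..} = (UNIV :: real set)" by auto
  ultimately show ?thesis by simp
qed

lemma norm_vector_derivative_le_lipschitz:
  fixes f :: "real \<Rightarrow> complex"
  assumes "L-lipschitz_on UNIV f" "(f has_vector_derivative D) (at x)"
  shows "norm D \<le> L"
proof -
  have "norm D \<le> L + e" if e: "0 < e" for e :: real
  proof -
    have "(f has_derivative (\<lambda>h. h *\<^sub>R D)) (at x)"
      using assms(2) by (simp add: has_vector_derivative_def)
    then obtain d where d: "d > 0"
      "\<And>y. norm (y - x) < d \<Longrightarrow> norm (f y - f x - (y - x) *\<^sub>R D) \<le> e * norm (y - x)"
      using e unfolding has_derivative_at_alt by blast
    define h where "h = d / 2"
    have h: "0 < h" "h < d" using d by (simp_all add: h_def)
    have "norm (f (x + h) - f x - h *\<^sub>R D) \<le> e * h"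
      using d(2)[of "x + h"] h by simp
    moreover have "norm (f (x + h) - f x) \<le> L * h"
      using lipschitz_onD[OF assms(1), of "x + h" x] h by (simp add: dist_norm)
    moreover have "norm (h *\<^sub>R D) \<le> norm (f (x + h) - f x) + norm (f (x + h) - f x - h *\<^sub>R D)"
      using norm_triangle_ineq4[of "f (x + h) - f x" "f (x + h) - f x - h *\<^sub>R D"] by simp
    ultimately have "h * norm D \<le> h * (L + e)" using h by (simp add: algebra_simps)
    thus ?thesis using h by simp
  qed
  thus ?thesis by (rule field_le_epsilon)
qed

locale smooth_strip_curve = strip_curve +
  fixes L :: real
  assumes piecewise: "\<And>T. \<gamma> piecewise_C1_differentiable_on {- T..T}"
    and lipschitz: "L-lipschitz_on UNIV \<gamma>"
begin

definition corners where "corners = {t. \<not> \<gamma> differentiable (at t)}"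

text \<open>The derivative, set to 0 at the at most countably many corners, so that the bound
  \<open>norm (velocity t) \<le> L\<close> holds everywhere.\<close>
definition velocity where
  "velocity t = (if \<gamma> differentiable (at t) then vector_derivative \<gamma> (at t) else 0)"

lemma velocity: "t \<notin> corners \<Longrightarrow> (\<gamma> has_vector_derivative velocity t) (at t)"
  by (simp add: corners_def velocity_def vector_derivative_works)

lemma finite_corners: "finite (corners \<inter> {a..b})"
proof -
  define T where "T = max \<bar>a\<bar> \<bar>b\<bar>"
  obtain S where S: "finite S" "\<gamma> C1_differentiable_on {-T..T} - S"
    using piecewise[of T] unfolding piecewise_C1_differentiable_on_def by blast
  have "corners \<inter> {a..b} \<subseteq> S"
  proof
    fix t assume t: "t \<in> corners \<inter> {a..b}"
    show "t \<in> S"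
    proof (rule ccontr)
      assume "t \<notin> S"
      with t have "t \<in> {-T..T} - S" by (auto simp: T_def)
      with S(2) obtain D where "(\<gamma> has_vector_derivative D) (at t)"
        unfolding C1_differentiable_on_def by blast
      thus False using t by (auto simp: corners_def differentiableI_vector)
    qed
  qed
  thus ?thesis using S finite_subset by blast
qed

lemma countable_corners: "countable corners"
proof -
  have "corners = (\<Union>n. corners \<inter> {- real n..real n})"
  proof (intro equalityI subsetI)
    fix t assume "t \<in> corners"
    moreover obtain n where "\<bar>t\<bar> \<le> real n" using real_arch_simple by blast
    ultimately show "t \<in> (\<Union>n. corners \<inter> {- real n..real n})" by (auto simp: abs_le_iff intro!: exI[of _ n])
  qed auto
  moreover have "countable (\<Union>n. corners \<inter> {- real n..real n})"
    by (intro countable_UN countableI_type countable_finite finite_corners)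
  ultimately show ?thesis by (simp only:)
qed

lemma norm_velocity_le: "norm (velocity t) \<le> L"
proof (cases "t \<in> corners")
  case True
  thus ?thesis using lipschitz by (auto simp: velocity_def corners_def lipschitz_on_def)
next
  case False
  thus ?thesis using norm_vector_derivative_le_lipschitz[OF lipschitz velocity] by blast
qed

lemma truncated_side_eq:
  assumes "a < b" "u \<in> {0..1}"
  shows "truncated_side \<gamma> a b a b u = \<gamma> ((a - b) * u + b)"
proof -
  have "u * (b - a) \<le> 1 * (b - a)" "0 \<le> u * (b - a)" using assms by (auto intro!: mult_right_mono)
  hence "a \<le> b + u * (a - b)" "b + u * (a - b) \<le> b" by (simp_all add: algebra_simps)
  thus ?thesis unfolding truncated_side_def clamp_to_def by (simp add: algebra_simps)
qed

lemma truncated_side_derivative: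
  assumes "a < b" "u \<in> {0<..<1}" "(a - b) * u + b \<notin> corners"
  shows "(truncated_side \<gamma> a b a b has_vector_derivative of_real (a - b) * velocity ((a - b) * u + b)) (at u)"
proof (rule has_vector_derivative_transform_within_open[where S = "{0<..<1}"])
  have "((\<lambda>u. (a - b) * u + b) has_vector_derivative (a - b)) (at u)"
    by (auto intro!: derivative_eq_intros simp: has_real_derivative_iff_has_vector_derivative[symmetric])
  from vector_diff_chain_at[OF this, of \<gamma>, OF velocity[OF assms(3)]]
  show "((\<lambda>u. \<gamma> ((a - b) * u + b)) has_vector_derivative of_real (a - b) * velocity ((a - b) * u + b)) (at u)"
    by (simp add: o_def scaleR_conv_of_real)
qed (use assms truncated_side_eq in auto)

lemma corner_preimage_finite:
  assumes "a < b" shows "finite {u \<in> {0..1}. (a - b) * u + b \<in> corners}"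
proof (rule finite_subset)
  show "{u \<in> {0..1}. (a - b) * u + b \<in> corners} \<subseteq> (\<lambda>t. (t - b) / (a - b)) ` (corners \<inter> {a..b})"
  proof
    fix u assume u: "u \<in> {u \<in> {0..1}. (a - b) * u + b \<in> corners}"
    have "u * (b - a) \<le> 1 * (b - a)" "0 \<le> u * (b - a)" using assms u by (auto intro!: mult_right_mono)
    hence "(a - b) * u + b \<in> corners \<inter> {a..b}" using u by (simp add: algebra_simps)
    moreover have "u = ((a - b) * u + b - b) / (a - b)" using assms by simp
    ultimately show "u \<in> (\<lambda>t. (t - b) / (a - b)) ` (corners \<inter> {a..b})" by blast
  qed
qed (intro finite_imageI finite_corners)

lemma valid_path_truncated_side:
  assumes "a < b" shows "valid_path (truncated_side \<gamma> a b a b)"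
proof -
  define T where "T = max \<bar>a\<bar> \<bar>b\<bar>"
  have "{a..b} \<subseteq> {-T..T}" by (auto simp: T_def)
  hence "\<gamma> piecewise_C1_differentiable_on (\<lambda>x. (a - b) * x + b) ` {0..1}"
  proof (intro piecewise_C1_differentiable_on_subset[OF piecewise[of T]] image_subsetI)
    fix u :: real assume u: "u \<in> {0..1}"
    have "u * (b - a) \<le> 1 * (b - a)" "0 \<le> u * (b - a)" using assms u by (auto intro!: mult_right_mono)
    hence "(a - b) * u + b \<in> {a..b}" by (simp add: algebra_simps)
    thus "(a - b) * u + b \<in> {-T..T}" using \<open>{a..b} \<subseteq> {-T..T}\<close> by blast
  qed
  from piecewise_C1_differentiable_affine[OF this]
  have pc: "(\<gamma> \<circ> (\<lambda>x. (a - b) *\<^sub>R x + b)) piecewise_C1_differentiable_on {0..1}" .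
  then obtain S where S: "finite S" "(\<gamma> \<circ> (\<lambda>x. (a - b) *\<^sub>R x + b)) C1_differentiable_on ({0..1} - S)"
    unfolding piecewise_C1_differentiable_on_def by blast
  then obtain D where D: "\<And>x. x \<in> {0..1} - S \<Longrightarrow> ((\<gamma> \<circ> (\<lambda>x. (a - b) *\<^sub>R x + b)) has_vector_derivative D x) (at x)"
    "continuous_on ({0..1} - S) D" unfolding C1_differentiable_on_def by blast
  have "(truncated_side \<gamma> a b a b) C1_differentiable_on ({0..1} - (S \<union> {0, 1}))"
    unfolding C1_differentiable_on_def
  proof (intro exI[of _ D] conjI ballI)
    fix x assume x: "x \<in> {0..1} - (S \<union> {0, 1})"
    show "(truncated_side \<gamma> a b a b has_vector_derivative D x) (at x)"
      by (rule has_vector_derivative_transform_within_open[OF D(1), where S = "{0<..<1}"])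
         (use x assms truncated_side_eq in auto)
  qed (rule continuous_on_subset[OF D(2)], auto)
  moreover have "finite (S \<union> {0, 1})" using S by simp
  ultimately show ?thesis
    using path_truncated_side[of a b a b]
    unfolding valid_path_def piecewise_C1_differentiable_on_def path_def
    by (intro conjI exI[of _ "S \<union> {0, 1}"])
qed

text \<open>The contour integral over the arc, written in the parameter of the curve; the sign comes
  from the downward direction.\<close>
lemma contour_integral_truncated_side:
  assumes ab: "a < b" and f: "f contour_integrable_on truncated_side \<gamma> a b a b"
  shows "((\<lambda>t. f (\<gamma> t) * velocity t) has_integral - contour_integral (truncated_side \<gamma> a b a b) f) {a..b}"
proof -
  let ?s = "truncated_side \<gamma> a b a b"
  define i where "i = contour_integral ?s f"
  define m where "m = 1 / (a - b)"
  define c where "c = - b / (a - b)"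
  define h where "h = (\<lambda>t. f (\<gamma> t) * velocity t)"
  have "(f has_contour_integral i) ?s" unfolding i_def by (rule has_contour_integral_integral[OF f])
  hence "((\<lambda>u. f (?s u) * vector_derivative ?s (at u within {0..1})) has_integral i) {0..1}"
    unfolding has_contour_integral_def .
  hence "((\<lambda>u. of_real (a - b) * h ((a - b) * u + b)) has_integral i) {0..1}"
  proof (rule has_integral_spike_finite[rotated 2])
    show "finite ({0, 1} \<union> {u \<in> {0..1}. (a - b) * u + b \<in> corners})"
      using corner_preimage_finite[OF ab] by simp
    fix u assume u: "u \<in> {0..1} - ({0, 1} \<union> {u \<in> {0..1}. (a - b) * u + b \<in> corners})"
    hence u': "u \<in> {0<..<1}" "(a - b) * u + b \<notin> corners" by auto
    have "vector_derivative ?s (at u within cbox 0 1) = of_real (a - b) * velocity ((a - b) * u + b)"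
    proof (rule vector_derivative_within_cbox)
      show "u \<in> cbox 0 1" using u' by simp
      show "(?s has_vector_derivative of_real (a - b) * velocity ((a - b) * u + b)) (at u within cbox 0 1)"
        by (rule has_vector_derivative_at_within[OF truncated_side_derivative[OF ab u']])
    qed simp
    thus "of_real (a - b) * h ((a - b) * u + b) = f (?s u) * vector_derivative ?s (at u within {0..1})"
      using truncated_side_eq[OF ab, of u] u by (simp add: h_def)
  qed
  hence "((\<lambda>u. of_real (a - b) * h ((a - b) * u + b)) has_integral i) (cbox 0 1)" by simp
  from has_integral_affinity[OF this, of m c]
  have "((\<lambda>x. of_real (a - b) * h ((a - b) * (m * x + c) + b)) has_integral (1 / \<bar>m\<bar>) *\<^sub>R i)
      ((\<lambda>x. (1 / m) * x + - ((1 / m) * c)) ` {0..1})"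
    using ab by (simp add: m_def)
  moreover have "(a - b) * (m * x + c) + b = x" for x
  proof -
    have "m * x + c = (x - b) / (a - b)" by (simp add: m_def c_def diff_divide_distrib)
    thus ?thesis using ab by simp
  qed
  moreover have "(\<lambda>x. (1 / m) * x + - ((1 / m) * c)) ` {0..1} = {a..b}"
  proof -
    have "(\<lambda>x. (1 / m) * x + - ((1 / m) * c)) = (\<lambda>x. (a - b) * x + b)"
      using ab by (simp add: m_def c_def)
    moreover have "(\<lambda>x. (a - b) * x + b) ` {0..1} = {a..b}"
      using ab by (subst image_affinity_atLeastAtMost) auto
    ultimately show ?thesis by (simp only:)
  qed
  moreover have "1 / \<bar>m\<bar> = b - a" using ab by (simp add: m_def)
  ultimately have "((\<lambda>x. of_real (a - b) * h x) has_integral (b - a) *\<^sub>R i) {a..b}" by simp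
  from has_integral_mult_right[OF this, of "1 / of_real (a - b)"]
  have "(h has_integral (1 / of_real (a - b)) * ((b - a) *\<^sub>R i)) {a..b}"
    using ab by (simp add: of_real_diff[symmetric] del: of_real_diff)
  moreover have "(1 / of_real (a - b)) * ((b - a) *\<^sub>R i) = - i"
  proof -
    have "of_real (b - a) = - (of_real (a - b) :: complex)" by simp
    moreover have "of_real (a - b) \<noteq> (0 :: complex)" using ab by simp
    ultimately show ?thesis by (simp only: scaleR_conv_of_real) (simp del: of_real_diff)
  qed
  ultimately show ?thesis by (simp add: h_def i_def)
qed

lemma path_image_truncated_side_eq:
  assumes "a < b"
  shows "path_image (truncated_side \<gamma> a b a b) = \<gamma> ` {a..b}"
proof -
  have "path_image (truncated_side \<gamma> a b a b) = (\<lambda>u. \<gamma> ((a - b) * u + b)) ` {0..1}"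
    unfolding path_image_def using truncated_side_eq[OF assms] by (intro image_cong) auto
  also have "\<dots> = \<gamma> ` ((\<lambda>u. (a - b) * u + b) ` {0..1})" by (simp add: image_image)
  also have "(\<lambda>u. (a - b) * u + b) ` {0..1} = {a..b}"
    using assms by (subst image_affinity_atLeastAtMost) auto
  finally show ?thesis .
qed

lemma path_image_box_loop_eq:
  assumes "a < b"
  shows "path_image (box_loop \<gamma> a b a b R) = closed_segment (\<gamma> a) (Complex R (Im (\<gamma> a)))
     \<union> closed_segment (Complex R (Im (\<gamma> a))) (Complex R (Im (\<gamma> b)))
     \<union> closed_segment (Complex R (Im (\<gamma> b))) (\<gamma> b) \<union> \<gamma> ` {a..b}"
  using assms path_image_truncated_side_eq[OF assms]
  by (simp add: box_loop_def path_image_join Un_assoc)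

lemma valid_path_box_loop: "a < b \<Longrightarrow> valid_path (box_loop \<gamma> a b a b R)"
  by (simp add: box_loop_def valid_path_join valid_path_truncated_side)

lemma contour_integral_box_loop:
  assumes ab: "a < b" and f: "f holomorphic_on S" "open S" "path_image (box_loop \<gamma> a b a b R) \<subseteq> S"
  shows "contour_integral (box_loop \<gamma> a b a b R) f =
      contour_integral (linepath (\<gamma> a) (Complex R (Im (\<gamma> a)))) f
    + contour_integral (linepath (Complex R (Im (\<gamma> a))) (Complex R (Im (\<gamma> b)))) f
    + contour_integral (linepath (Complex R (Im (\<gamma> b))) (\<gamma> b)) f
    - integral {a..b} (\<lambda>t. f (\<gamma> t) * velocity t)" (is ?A)
    and "f contour_integrable_on linepath (\<gamma> a) (Complex R (Im (\<gamma> a)))" (is ?B)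
    and "f contour_integrable_on linepath (Complex R (Im (\<gamma> a))) (Complex R (Im (\<gamma> b)))" (is ?C)
    and "f contour_integrable_on linepath (Complex R (Im (\<gamma> b))) (\<gamma> b)" (is ?D)
    and "((\<lambda>t. f (\<gamma> t) * velocity t) has_integral
           - contour_integral (truncated_side \<gamma> a b a b) f) {a..b}" (is ?E)
proof -
  note pi = path_image_box_loop_eq[OF ab, of R]
  have sub: "path_image (linepath (\<gamma> a) (Complex R (Im (\<gamma> a)))) \<subseteq> S"
    "path_image (linepath (Complex R (Im (\<gamma> a))) (Complex R (Im (\<gamma> b)))) \<subseteq> S"
    "path_image (linepath (Complex R (Im (\<gamma> b))) (\<gamma> b)) \<subseteq> S"
    "path_image (truncated_side \<gamma> a b a b) \<subseteq> S"
    using f(3) path_image_truncated_side_eq[OF ab] unfolding pi by auto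
  note vs = valid_path_truncated_side[OF ab]
  show B: ?B and C: ?C and D: ?D
    by (rule contour_integrable_holomorphic_simple[OF f(1,2) valid_path_linepath]; fact sub)+
  have E: "f contour_integrable_on truncated_side \<gamma> a b a b"
    by (rule contour_integrable_holomorphic_simple[OF f(1,2) vs sub(4)])
  show side: ?E by (rule contour_integral_truncated_side[OF ab E])
  have "contour_integral (truncated_side \<gamma> a b a b) f = - integral {a..b} (\<lambda>t. f (\<gamma> t) * velocity t)"
    using integral_unique[OF side] by simp
  thus ?A
    unfolding box_loop_def using B C D E vs ab
    by (simp add: contour_integrable_joinI)
qed

text \<open>The parenthesis bounds the length of the loop: two horizontal sides, the vertical side, and
  an arc of a curve with speed at most \<open>L\<close>.\<close>
lemma norm_contour_integral_box_loop_le: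
  assumes ab: "a < b" and f: "f holomorphic_on S" "open S" "path_image (box_loop \<gamma> a b a b R) \<subseteq> S"
    and K: "\<And>z. z \<in> path_image (box_loop \<gamma> a b a b R) \<Longrightarrow> norm (f z) \<le> K" "0 \<le> K"
    and R: "M \<le> R"
  shows "norm (contour_integral (box_loop \<gamma> a b a b R) f)
     \<le> K * (2 * (R + M) + \<bar>Im (\<gamma> b) - Im (\<gamma> a)\<bar> + L * (b - a))"
proof -
  note pi = path_image_box_loop_eq[OF ab, of R]
  note ci = contour_integral_box_loop[OF ab f]
  have L0: "0 \<le> L" using norm_velocity_le[of 0] norm_ge_zero order_trans by blast
  have len: "norm (Complex R (Im (\<gamma> t)) - \<gamma> t) \<le> R + M" for t
  proof -
    have "Complex R (Im (\<gamma> t)) - \<gamma> t = of_real (R - Re (\<gamma> t))" by (simp add: complex_eq_iff)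
    hence "norm (Complex R (Im (\<gamma> t)) - \<gamma> t) = \<bar>R - Re (\<gamma> t)\<bar>" by (simp only: norm_of_real)
    thus ?thesis using Re_le[of t] R by linarith
  qed
  have 1: "norm (contour_integral (linepath (\<gamma> a) (Complex R (Im (\<gamma> a)))) f) \<le> K * (R + M)"
  proof (rule order_trans[OF contour_integral_bound_linepath[OF ci(2) K(2)]])
    show "K * norm (Complex R (Im (\<gamma> a)) - \<gamma> a) \<le> K * (R + M)"
      by (rule mult_left_mono[OF len K(2)])
  qed (use pi K in auto)
  have 3: "norm (contour_integral (linepath (Complex R (Im (\<gamma> b))) (\<gamma> b)) f) \<le> K * (R + M)"
  proof (rule order_trans[OF contour_integral_bound_linepath[OF ci(4) K(2)]])
    show "K * norm (\<gamma> b - Complex R (Im (\<gamma> b))) \<le> K * (R + M)"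
      using len[of b] K(2) by (intro mult_left_mono) (simp_all add: norm_minus_commute)
  qed (use pi K in auto)
  have 2: "norm (contour_integral (linepath (Complex R (Im (\<gamma> a))) (Complex R (Im (\<gamma> b)))) f)
      \<le> K * \<bar>Im (\<gamma> b) - Im (\<gamma> a)\<bar>"
  proof -
    have "norm (Complex R (Im (\<gamma> b)) - Complex R (Im (\<gamma> a))) = \<bar>Im (\<gamma> b) - Im (\<gamma> a)\<bar>"
      by (simp add: cmod_def)
    thus ?thesis using contour_integral_bound_linepath[OF ci(3) K(2)] pi K(1) by auto
  qed
  have 4: "norm (integral {a..b} (\<lambda>t. f (\<gamma> t) * velocity t)) \<le> K * L * (b - a)"
  proof -
    have "norm (- contour_integral (truncated_side \<gamma> a b a b) f) \<le> K * L * measure lborel (cbox a b)"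
    proof (rule has_integral_bound)
      show "0 \<le> K * L" using K L0 by simp
      show "((\<lambda>t. f (\<gamma> t) * velocity t) has_integral - contour_integral (truncated_side \<gamma> a b a b) f) (cbox a b)"
        using ci(5) by simp
      fix t assume "t \<in> cbox a b"
      hence "norm (f (\<gamma> t)) \<le> K" using pi by (intro K) auto
      thus "norm (f (\<gamma> t) * velocity t) \<le> K * L"
        unfolding norm_mult using norm_velocity_le[of t] K by (intro mult_mono) auto
    qed
    thus ?thesis using integral_unique[OF ci(5)] ab by simp
  qed
  have "norm (contour_integral (box_loop \<gamma> a b a b R) f) \<le>
      K * (R + M) + K * \<bar>Im (\<gamma> b) - Im (\<gamma> a)\<bar> + K * (R + M) + K * L * (b - a)"
    unfolding ci(1) by (intro order_trans[OF norm_triangle_ineq4] order_trans[OF norm_triangle_ineq] add_mono 1 2 3 4)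
  thus ?thesis by (simp add: algebra_simps)
qed

text \<open>The curve may stay at a point of \<open>Z\<close> for a whole interval of parameters, but
  then its velocity is 0 there. Parameters with nonzero velocity at which the curve is in a given point
  are isolated, hence countably many.\<close>
lemma has_integral_modify_values:
  assumes Z: "countable Z" "\<And>z. z \<notin> Z \<Longrightarrow> f z = g z"
  shows "((\<lambda>t. f (\<gamma> t) * vector_derivative \<gamma> (at t)) has_integral J) UNIV \<longleftrightarrow>
    ((\<lambda>t. g (\<gamma> t) * velocity t) has_integral J) UNIV"
proof -
  \<comment> \<open>The times at which the curve passes through \<open>z\<close> without pausing.\<close>
  define E where "E = (\<lambda>z. {t. t \<notin> corners \<and> velocity t \<noteq> 0 \<and> \<gamma> t = z})"
  have isolated: "\<exists>r>0. \<forall>u. u \<noteq> t \<longrightarrow> \<bar>u - t\<bar> < r \<longrightarrow> \<gamma> u \<noteq> \<gamma> t" if t: "t \<notin> corners" "velocity t \<noteq> 0" for t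
  proof -
    define v where "v = velocity t"
    have "(\<gamma> has_derivative (\<lambda>h. h *\<^sub>R v)) (at t)"
      using velocity[OF t(1)] by (simp add: has_vector_derivative_def v_def)
    moreover have "0 < norm v / 2" using t(2) by (simp add: v_def)
    ultimately obtain r where r: "r > 0"
      "\<And>u. norm (u - t) < r \<Longrightarrow> norm (\<gamma> u - \<gamma> t - (u - t) *\<^sub>R v) \<le> norm v / 2 * norm (u - t)"
      unfolding has_derivative_at_alt by blast
    show ?thesis
    proof (intro exI conjI allI impI)
      fix u assume u: "u \<noteq> t" "\<bar>u - t\<bar> < r"
      show "\<gamma> u \<noteq> \<gamma> t"
      proof
        assume "\<gamma> u = \<gamma> t"
        with r(2)[of u] u have "\<bar>u - t\<bar> * norm v \<le> norm v / 2 * \<bar>u - t\<bar>" by simp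
        moreover have "0 < \<bar>u - t\<bar> * norm v" using u t(2) by (simp add: v_def)
        ultimately show False by (simp add: mult.commute)
      qed
    qed (rule r(1))
  qed
  have half: "2 * (1 / (2 * x)) = 1 / x" for x :: real by simp
  have "countable (E z)" for z
  proof -
    \<comment> \<open>Times that are separated from all other such times by a fixed amount; each of these
      sets is discrete.\<close>
    define D where "D = (\<lambda>n::nat. {t \<in> E z. \<forall>u \<in> E z. u \<noteq> t \<longrightarrow> 1 / real (Suc n) \<le> \<bar>u - t\<bar>})"
    have "E z \<subseteq> (\<Union>n. D n)"
    proof
      fix t assume t: "t \<in> E z"
      then obtain r where r: "r > 0" "\<And>u. u \<noteq> t \<Longrightarrow> \<bar>u - t\<bar> < r \<Longrightarrow> \<gamma> u \<noteq> \<gamma> t"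
        using isolated[of t] by (auto simp: E_def)
      obtain n where n: "1 / real (Suc n) < r" using r(1) nat_approx_posE by blast
      have "1 / real (Suc n) \<le> \<bar>u - t\<bar>" if "u \<in> E z" "u \<noteq> t" for u
      proof (rule ccontr)
        assume "\<not> 1 / real (Suc n) \<le> \<bar>u - t\<bar>"
        hence "\<bar>u - t\<bar> < r" using n by linarith
        from r(2)[OF that(2) this] that t show False by (simp add: E_def)
      qed
      hence "t \<in> D n" using t by (simp add: D_def)
      thus "t \<in> (\<Union>n. D n)" by blast
    qed
    moreover have "countable (D n)" for n
    proof (rule no_limpt_imp_countable)
      fix x
      show "\<not> x islimpt D n"
      proof
        assume lp: "x islimpt D n"
        define r where "r = 1 / (2 * real (Suc n))"
        have r: "0 < r" by (simp add: r_def)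
        from lp r obtain u where u: "u \<in> D n" "u \<noteq> x" "dist u x < r" unfolding islimpt_approachable by blast
        have "0 < dist u x" using u by simp
        with lp obtain u' where u': "u' \<in> D n" "u' \<noteq> x" "dist u' x < dist u x" unfolding islimpt_approachable by blast
        have "u' \<noteq> u" using u' by auto
        hence "1 / real (Suc n) \<le> \<bar>u' - u\<bar>" using u u' by (auto simp: D_def)
        moreover have "\<bar>u' - u\<bar> < 2 * r" using u u' unfolding dist_real_def by linarith
        moreover have "2 * r = 1 / real (Suc n)" unfolding r_def by (rule half)
        ultimately show False by linarith
      qed
    qed
    ultimately show ?thesis by (meson countable_UN countableI_type countable_subset)
  qed
  hence "countable (corners \<union> (\<Union>z\<in>Z. E z))" using Z(1) countable_corners by auto
  hence neg: "negligible (corners \<union> (\<Union>z\<in>Z. E z))" by (simp add: negligible_iff_null_sets countable_imp_null_set_lborel null_sets_completionI)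
  show ?thesis
  proof (rule has_integral_spike_eq[OF neg])
    fix t assume t: "t \<in> UNIV - (corners \<union> (\<Union>z\<in>Z. E z))"
    hence v: "vector_derivative \<gamma> (at t) = velocity t" by (simp add: corners_def velocity_def)
    show "g (\<gamma> t) * velocity t = f (\<gamma> t) * vector_derivative \<gamma> (at t)"
    proof (cases "velocity t = 0")
      case False
      hence "\<gamma> t \<notin> Z" using t by (auto simp: E_def)
      thus ?thesis using Z(2) v by simp
    qed (simp add: v)
  qed
qed

end

section \<open>Closing the contour in the presence of periodic poles\<close>

lemma linear_times_exp_tendsto_0:
  assumes "0 < (c::real)"
  shows "(\<lambda>m. (x + y * real m) * exp (- (real m * c))) \<longlonglongrightarrow> 0"
proof -
  have e: "exp (- (real m * c)) = exp (- c) ^ m" for m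
    by (simp add: exp_of_nat_mult[symmetric])
  have lt: "norm (exp (- c)) < 1" using assms by simp
  have "(\<lambda>m. x * exp (- c) ^ m + y * (real m * exp (- c) ^ m)) \<longlonglongrightarrow> x * 0 + y * 0"
    by (intro tendsto_intros LIMSEQ_power_zero powser_times_n_limit_0 lt)
  thus ?thesis unfolding e by (simp add: algebra_simps)
qed

lemma shift_by_int:
  fixes V :: "complex set"
  assumes "\<And>p. p + t \<in> V \<longleftrightarrow> p \<in> V"
  shows "p + of_int n * t \<in> V \<longleftrightarrow> p \<in> V"
proof (induction n rule: int_induct[where k = 0])
  case (step1 i)
  have "p + of_int (i + 1) * t = (p + of_int i * t) + t" by (simp add: algebra_simps)
  with assms[of "p + of_int i * t"] step1 show ?case by (simp only:)
next
  case (step2 i)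
  have "p + of_int i * t = (p + of_int (i - 1) * t) + t" by (simp add: algebra_simps)
  with assms[of "p + of_int (i - 1) * t"] step2 show ?case by (simp only:)
qed simp

text \<open>The analytic hypotheses under which the integral along the curve equals \<open>- 2 * pi *
  \<i>\<close> times the sum of the residues on its right. Above the height \<open>H\<close> the poles
  of \<open>F\<close> are exactly the points of \<open>V\<close>, a set with period \<open>\<i> *
  T\<close> that is bounded on the right by \<open>B\<close>; infinitely many of them may lie close to
  the curve. All poles on the right of the curve belong to \<open>I\<close>, which stays below the
  height \<open>H\<close>. The function decays exponentially in the vertical direction away from
  \<open>V\<close>, and on the lines \<open>Re z = \<rho> + m\<close> uniformly in the height. In
  \<open>decay\<close> the half-plane starts at \<open>- M - 2\<close> because it has to contain discs
  of radius 1 around poles that are at distance at most 1 from the strip.\<close>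
locale decaying_integrand = smooth_strip_curve +
  fixes F :: "complex \<Rightarrow> complex" and V I :: "complex set" and T H B \<rho> \<epsilon> \<kappa> :: real
  assumes F: "F nicely_meromorphic_on UNIV"
    and T: "0 < T" and H: "0 \<le> H" and eps: "0 < \<epsilon>" and kap: "0 < \<kappa>"
    and V_discrete: "\<And>z. \<not> z islimpt V"
    and V_periodic: "\<And>p. p + \<i> * of_real T \<in> V \<longleftrightarrow> p \<in> V"
    and V_Re: "\<And>p. p \<in> V \<Longrightarrow> Re p \<le> B"
    and V_poles: "\<And>p. H \<le> \<bar>Im p\<bar> \<Longrightarrow> is_pole F p \<longleftrightarrow> p \<in> V"
    and poles_far: "\<And>p t. is_pole F p \<Longrightarrow> \<epsilon> \<le> dist p (\<gamma> t)"
    and decay: "\<And>\<delta>. 0 < \<delta> \<Longrightarrow> \<exists>C. \<forall>s. - M - 2 \<le> Re s \<longrightarrow> H \<le> \<bar>Im s\<bar> \<longrightarrow>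
        (\<forall>p\<in>V. \<delta> \<le> dist p s) \<longrightarrow> norm (F s) \<le> C * exp (- \<bar>Im s\<bar>)"
    and vertical: "\<exists>C. \<forall>m y. \<not> is_pole F (Complex (\<rho> + real m) y)
        \<and> norm (F (Complex (\<rho> + real m) y)) \<le> C * exp (- (\<kappa> * real m))"
    and rho: "B + 1 \<le> \<rho>" "M + 1 \<le> \<rho>"
    and I_Im: "\<And>p. p \<in> I \<Longrightarrow> \<bar>Im p\<bar> \<le> H"
    and I_right: "\<And>p. p \<in> I \<Longrightarrow> is_pole F p \<Longrightarrow> lies_right_of p \<gamma>"
    and I_left: "\<And>p. p \<notin> I \<Longrightarrow> is_pole F p \<Longrightarrow> lies_left_of p \<gamma>"
begin

lemma M_nonneg: "0 \<le> M" using near[of 0] norm_ge_zero order_trans by blast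
lemma L_nonneg: "0 \<le> L" using norm_velocity_le[of 0] norm_ge_zero order_trans by blast

definition poles where "poles = {p. is_pole F p}"

lemma poles_discrete: "\<not> z islimpt poles"
proof -
  have "isolated_singularity_at F z"
    using F meromorphic_on_subset[of F UNIV "{z}"] meromorphic_on_isolated_singularity[of F z]
    by (simp add: nicely_meromorphic_on_def)
  thus ?thesis unfolding poles_def by (rule not_islimpt_poles)
qed

lemma closed_poles_subset: "A \<subseteq> poles \<Longrightarrow> closed A"
  unfolding closed_limpt using poles_discrete islimpt_subset by blast

lemma holomorphic_off_poles: "F holomorphic_on - poles"
proof -
  have "F analytic_on {z}" if "z \<in> - poles" for z
    using nicely_meromorphic_on_imp_analytic_at[OF F, of z] that by (auto simp: poles_def)
  hence "F analytic_on - poles" by (subst analytic_on_analytic_at) blast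
  thus ?thesis by (rule analytic_imp_holomorphic)
qed

lemma curve_avoids: "\<gamma> t \<notin> poles"
  using poles_far[of "\<gamma> t" t] eps by (auto simp: poles_def)

lemma continuous_off_poles: "S \<inter> poles = {} \<Longrightarrow> continuous_on S F"
  by (rule continuous_on_subset[OF holomorphic_on_imp_continuous_on[OF holomorphic_off_poles]]) auto

lemma bound_on_curve: "\<exists>C. \<forall>t. norm (F (\<gamma> t)) \<le> C * exp (- \<bar>t\<bar>)"
proof -
  obtain C1 where "\<forall>s. - M - 2 \<le> Re s \<longrightarrow> H \<le> \<bar>Im s\<bar> \<longrightarrow>
        (\<forall>p\<in>V. min \<epsilon> 1 \<le> dist p s) \<longrightarrow> norm (F s) \<le> C1 * exp (- \<bar>Im s\<bar>)"
    using decay[of "min \<epsilon> 1"] eps by auto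
  note C1 = this[rule_format]
  define T0 where "T0 = H + M + 2"
  have "compact ((\<lambda>t. F (\<gamma> t)) ` {-T0..T0})"
    by (intro compact_continuous_image continuous_on_compose2[OF continuous_off_poles[of "range \<gamma>"] continuous_on_subset[OF cont]])
       (use curve_avoids in auto)
  hence "bounded ((\<lambda>t. F (\<gamma> t)) ` {-T0..T0})" by (rule compact_imp_bounded)
  then obtain C2 where C2: "\<And>t. t \<in> {-T0..T0} \<Longrightarrow> norm (F (\<gamma> t)) \<le> C2"
    unfolding bounded_iff by blast
  define C where "C = \<bar>C1\<bar> * exp M + \<bar>C2\<bar> * exp T0"
  have "norm (F (\<gamma> t)) \<le> C * exp (- \<bar>t\<bar>)" for t
  proof (cases "\<bar>t\<bar> \<le> T0")
    case True
    hence "norm (F (\<gamma> t)) \<le> \<bar>C2\<bar>" using C2[of t] by (auto simp: abs_le_iff)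
    also have "\<dots> \<le> \<bar>C2\<bar> * (exp T0 * exp (- \<bar>t\<bar>))"
      using True by (simp add: exp_add[symmetric] mult_le_cancel_left1)
    also have "\<dots> \<le> C * exp (- \<bar>t\<bar>)" by (simp add: C_def algebra_simps)
    finally show ?thesis .
  next
    case False
    have Im: "\<bar>Im (\<gamma> t)\<bar> \<ge> \<bar>t\<bar> - M" using Im_le[of t] by linarith
    have "norm (F (\<gamma> t)) \<le> C1 * exp (- \<bar>Im (\<gamma> t)\<bar>)"
    proof (rule C1)
      show "- M - 2 \<le> Re (\<gamma> t)" using Re_le[of t] by linarith
      show "H \<le> \<bar>Im (\<gamma> t)\<bar>" using Im False by (simp add: T0_def)
      fix p assume p: "p \<in> V"
      show "min \<epsilon> 1 \<le> dist p (\<gamma> t)"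
      proof (cases "H \<le> \<bar>Im p\<bar>")
        case True
        thus ?thesis using poles_far[of p t] V_poles[of p] p by auto
      next
        case False
        hence "1 \<le> \<bar>Im (p - \<gamma> t)\<bar>" using Im \<open>\<not> \<bar>t\<bar> \<le> T0\<close> by (simp add: T0_def)
        thus ?thesis using abs_Im_le_cmod[of "p - \<gamma> t"] by (simp add: dist_norm)
      qed
    qed
    also have "\<dots> \<le> \<bar>C1\<bar> * exp (M - \<bar>t\<bar>)" using Im by (intro mult_mono) auto
    also have "\<dots> \<le> C * exp (- \<bar>t\<bar>)" by (simp add: C_def exp_diff exp_minus field_simps)
    finally show ?thesis .
  qed
  thus ?thesis by blast
qed

lemma contour_integrable_truncated_side:
  assumes "a < b"
  shows "F contour_integrable_on truncated_side \<gamma> a b a b"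
proof (rule contour_integrable_holomorphic_simple[OF holomorphic_off_poles])
  show "open (- poles)" using closed_poles_subset by auto
  show "valid_path (truncated_side \<gamma> a b a b)" by (rule valid_path_truncated_side[OF assms])
  show "path_image (truncated_side \<gamma> a b a b) \<subseteq> - poles"
    using path_image_truncated_side[of a b a b] curve_avoids by auto
qed

text \<open>Dominated convergence with the majorant \<open>exp (- \<bar>t\<bar>)\<close>; it gives
  existence of the integral over the whole line as well.\<close>
theorem truncated_integrals_tendsto:
  assumes "filterlim a at_bot sequentially" "filterlim b at_top sequentially" "\<And>m::nat. a m < b m"
  shows "(\<lambda>t. F (\<gamma> t) * velocity t) integrable_on UNIV"
    "(\<lambda>m. integral {a m..b m} (\<lambda>t. F (\<gamma> t) * velocity t)) \<longlonglongrightarrow> integral UNIV (\<lambda>t. F (\<gamma> t) * velocity t)"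
proof -
  define h where "h = (\<lambda>t. F (\<gamma> t) * velocity t)"
  define f where "f = (\<lambda>m t. if t \<in> {a m..b m} then h t else 0)"
  obtain C where C: "\<And>t. norm (F (\<gamma> t)) \<le> C * exp (- \<bar>t\<bar>)" using bound_on_curve by blast
  have h_le: "norm (h t) \<le> C * L * exp (- \<bar>t\<bar>)" for t
  proof -
    have "norm (h t) \<le> (C * exp (- \<bar>t\<bar>)) * L"
      unfolding h_def norm_mult using C norm_velocity_le
      by (intro mult_mono) (auto intro: order_trans[OF norm_ge_zero C])
    thus ?thesis by (simp add: mult_ac)
  qed
  have C0: "0 \<le> C * L * exp (- \<bar>t\<bar>)" for t by (rule order_trans[OF norm_ge_zero h_le])
  have int: "f m integrable_on UNIV" for m
    unfolding f_def integrable_restrict_UNIV h_def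
    using contour_integral_truncated_side[OF assms(3) contour_integrable_truncated_side[OF assms(3)]]
    by (auto simp: integrable_on_def)
  have le: "norm (f m t) \<le> C * L * exp (- \<bar>t\<bar>)" for m t
    using h_le C0 by (auto simp: f_def)
  have dom: "(\<lambda>t. C * L * exp (- \<bar>t\<bar>)) integrable_on UNIV"
    by (intro integrable_on_mult_right integrable_exp_minus_abs)
  have conv: "(\<lambda>m. f m t) \<longlonglongrightarrow> h t" for t
  proof (rule tendsto_eventually)
    have "eventually (\<lambda>m. a m \<le> t) sequentially" "eventually (\<lambda>m. t \<le> b m) sequentially"
      using assms(1,2) unfolding filterlim_at_bot filterlim_at_top by blast+
    thus "eventually (\<lambda>m. f m t = h t) sequentially"
      by eventually_elim (simp add: f_def)
  qed
  note dc = dominated_convergence[of f UNIV, OF int dom le conv]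
  show "(\<lambda>t. F (\<gamma> t) * velocity t) integrable_on UNIV" using dc(1) by (simp add: h_def)
  show "(\<lambda>m. integral {a m..b m} (\<lambda>t. F (\<gamma> t) * velocity t)) \<longlonglongrightarrow> integral UNIV (\<lambda>t. F (\<gamma> t) * velocity t)"
    using dc(2) unfolding f_def integral_restrict_UNIV h_def .
qed

text \<open>Modulo the period only finitely many points of \<open>V\<close> are near the strip or to its
  right, so some height \<open>h\<close> avoids all of their imaginary parts, and then every horizontal
  line at height \<open>h + n * T\<close> keeps the distance \<open>\<delta>\<close> from
  \<open>V\<close>.\<close>
lemma good_heights:
  obtains h \<delta> where "0 < h" "h < T" "0 < \<delta>"
    "\<And>p z n. p \<in> V \<Longrightarrow> - M \<le> Re z \<Longrightarrow> Im z = h + of_int n * T \<Longrightarrow> \<delta> \<le> dist p z"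
proof -
  define Y where "Y = Im ` (cbox (Complex (- M - 1) (- T)) (Complex B (2 * T)) \<inter> V)"
  have "finite Y" unfolding Y_def
    by (intro finite_imageI finite_not_islimpt_in_compact) (auto simp: V_discrete)
  moreover have "infinite {0<..<T}" using T by simp
  ultimately obtain h where h: "h \<in> {0<..<T}" "h \<notin> Y"
    by (metis DiffD1 DiffD2 finite_Diff2 ex_in_conv finite.emptyI)
  define \<delta> where "\<delta> = Min (insert 1 (insert T ((\<lambda>y. \<bar>y - h\<bar>) ` Y)))"
  have \<delta>: "0 < \<delta>" "\<delta> \<le> 1" "\<delta> \<le> T" "\<And>y. y \<in> Y \<Longrightarrow> \<delta> \<le> \<bar>y - h\<bar>"
  proof -
    have fin: "finite (insert 1 (insert T ((\<lambda>y. \<bar>y - h\<bar>) ` Y)))" using \<open>finite Y\<close> by simp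
    show "0 < \<delta>" unfolding \<delta>_def using fin h T by (subst Min_gr_iff) auto
    show "\<delta> \<le> 1" "\<delta> \<le> T" "\<And>y. y \<in> Y \<Longrightarrow> \<delta> \<le> \<bar>y - h\<bar>"
      unfolding \<delta>_def by (rule Min_le[OF fin]; simp)+
  qed
  show thesis
  proof (rule that[of h \<delta>])
    fix p z n assume p: "p \<in> V" and z: "- M \<le> Re z" "Im z = h + of_int n * T"
    have Re: "\<bar>Re p - Re z\<bar> \<le> dist p z" and Im: "\<bar>Im p - Im z\<bar> \<le> dist p z"
      using abs_Re_le_cmod[of "p - z"] abs_Im_le_cmod[of "p - z"] by (simp_all add: dist_norm)
    define p' where "p' = p + of_int (- n) * (\<i> * of_real T)"
    have p': "p' \<in> V" using shift_by_int[OF V_periodic] p unfolding p'_def by blast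
    have ImRe: "Re p' = Re p" "Im p' - h = Im p - Im z" unfolding p'_def z by simp_all
    show "\<delta> \<le> dist p z"
    proof (cases "Re p < - M - 1")
      case True
      thus ?thesis using Re z \<delta> by linarith
    next
      case False
      show ?thesis
      proof (cases "- T \<le> Im p' \<and> Im p' \<le> 2 * T")
        case True
        hence "Im p' \<in> Y" using False p' V_Re[OF p'] ImRe by (auto simp: Y_def in_cbox_complex_iff)
        thus ?thesis using \<delta>(4) Im ImRe by fastforce
      next
        case out: False
        hence "T \<le> \<bar>Im p' - h\<bar>" using h by auto
        thus ?thesis using \<delta> Im ImRe by linarith
      qed
    qed
  qed (use h \<delta> in auto)
qed

lemma height_attained:
  obtains t where "Im (\<gamma> t) = h" "\<bar>t - h\<bar> \<le> M"
proof -
  have "\<exists>t. h - M \<le> t \<and> t \<le> h + M \<and> Im (\<gamma> t) = h"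
  proof (rule IVT')
    show "Im (\<gamma> (h - M)) \<le> h" "h \<le> Im (\<gamma> (h + M))" using Im_le[of "h - M"] Im_le[of "h + M"] by linarith+
    show "continuous_on {h - M..h + M} (\<lambda>t. Im (\<gamma> t))"
      by (intro continuous_intros continuous_on_subset[OF cont]) auto
  qed (use M_nonneg in auto)
  thus ?thesis using that by (auto simp: abs_le_iff)
qed

end

text \<open>A sequence of loops whose horizontal sides have the heights \<open>h - m * T\<close> and
  \<open>h + m * T\<close> and whose vertical side moves to the right one unit at a time.\<close>
locale truncated_box = decaying_integrand +
  fixes h \<delta> :: real and a b :: "nat \<Rightarrow> real"
  assumes h: "0 < h" "h < T" and del: "0 < \<delta>"
    and far: "\<And>p z n. p \<in> V \<Longrightarrow> - M \<le> Re z \<Longrightarrow> Im z = h + of_int n * T \<Longrightarrow> \<delta> \<le> dist p z"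
    and a: "\<And>m. Im (\<gamma> (a m)) = h - real m * T" "\<And>m. \<bar>a m - (h - real m * T)\<bar> \<le> M"
    and b: "\<And>m. Im (\<gamma> (b m)) = h + real m * T" "\<And>m. \<bar>b m - (h + real m * T)\<bar> \<le> M"
begin

definition R where "R m = \<rho> + real m"

definition \<Gamma> where "\<Gamma> m = box_loop \<gamma> (a m) (b m) (a m) (b m) (R m)"

text \<open>From some index on, \<open>m * T\<close> exceeds \<open>H\<close> by a margin that covers
  the excursions of the curve and one period.\<close>
definition large where "large m \<longleftrightarrow> H + 4 * M + 3 * T + 3 \<le> real m * T"

lemma eventually_large: "eventually large sequentially"
proof -
  obtain m0 where "(H + 4 * M + 3 * T + 3) / T \<le> real m0" using real_arch_simple by blast
  hence "large m" if "m0 \<le> m" for m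
  proof -
    have "(H + 4 * M + 3 * T + 3) / T \<le> real m"
      using that \<open>_ \<le> real m0\<close> by (meson of_nat_le_iff order_trans)
    thus ?thesis using T by (simp add: large_def pos_divide_le_eq)
  qed
  thus ?thesis by (auto simp: eventually_sequentially)
qed

lemma R_bounds: "B + 1 \<le> R m" "M + 1 \<le> R m" "- M \<le> R m"
  using rho M_nonneg by (auto simp: R_def)

lemma large_ab: "large m \<Longrightarrow> a m < b m"
  using a(2)[of m] b(2)[of m] M_nonneg T H by (auto simp: large_def abs_le_iff)

lemma horizontal_sides:
  assumes "z \<in> closed_segment (\<gamma> t) (Complex (R m) (Im (\<gamma> t))) \<or> z \<in> closed_segment (Complex (R m) (Im (\<gamma> t))) (\<gamma> t)"
  shows "Im z = Im (\<gamma> t)" "- M \<le> Re z" "Re z \<le> R m"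
proof -
  have z: "z \<in> closed_segment (\<gamma> t) (Complex (R m) (Im (\<gamma> t)))"
    using assms closed_segment_commute by blast
  have "closed_segment (\<gamma> t) (Complex (R m) (Im (\<gamma> t))) \<subseteq> {w. Im w \<le> Im (\<gamma> t)} \<inter> {w. Im (\<gamma> t) \<le> Im w} \<inter> {w. - M \<le> Re w} \<inter> {w. Re w \<le> R m}"
    using Re_le[of t] R_bounds[of m] by (intro closed_segment_subset convex_Int convex_complex_halfspaces) (auto simp: abs_le_iff)
  with z have "z \<in> {w. Im w \<le> Im (\<gamma> t)} \<inter> {w. Im (\<gamma> t) \<le> Im w} \<inter> {w. - M \<le> Re w} \<inter> {w. Re w \<le> R m}" by blast
  thus "Im z = Im (\<gamma> t)" "- M \<le> Re z" "Re z \<le> R m" by auto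
qed

lemma vertical_side:
  assumes "z \<in> closed_segment (Complex (R m) x) (Complex (R m) y)" "x \<le> y"
  shows "Re z = R m" "x \<le> Im z" "Im z \<le> y"
proof -
  have "closed_segment (Complex (R m) x) (Complex (R m) y) \<subseteq> {w. Re w \<le> R m} \<inter> {w. R m \<le> Re w} \<inter> {w. x \<le> Im w} \<inter> {w. Im w \<le> y}"
    using assms(2) by (intro closed_segment_subset convex_Int convex_complex_halfspaces) auto
  with assms have "z \<in> {w. Re w \<le> R m} \<inter> {w. R m \<le> Re w} \<inter> {w. x \<le> Im w} \<inter> {w. Im w \<le> y}" by blast
  thus "Re z = R m" "x \<le> Im z" "Im z \<le> y" by auto
qed

lemma path_image_\<Gamma>_cases:
  assumes "large m" "z \<in> path_image (\<Gamma> m)"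
  obtains (bottom) "Im z = h - real m * T" "- M \<le> Re z" "Re z \<le> R m"
    | (right) "Re z = R m" "h - real m * T \<le> Im z" "Im z \<le> h + real m * T"
    | (top) "Im z = h + real m * T" "- M \<le> Re z" "Re z \<le> R m"
    | (curve) t where "z = \<gamma> t" "a m \<le> t" "t \<le> b m"
proof -
  have le: "h - real m * T \<le> h + real m * T" using T by simp
  consider "z \<in> closed_segment (\<gamma> (a m)) (Complex (R m) (Im (\<gamma> (a m))))"
    | "z \<in> closed_segment (Complex (R m) (h - real m * T)) (Complex (R m) (h + real m * T))"
    | "z \<in> closed_segment (Complex (R m) (Im (\<gamma> (b m)))) (\<gamma> (b m))"
    | "z \<in> \<gamma> ` {a m..b m}"
    using assms(2) unfolding \<Gamma>_def path_image_box_loop_eq[OF large_ab[OF assms(1)]] a b by blast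
  thus thesis
  proof cases
    case 1 thus ?thesis using horizontal_sides[of z "a m" m] a(1)[of m] bottom by simp
  next
    case 2 thus ?thesis using vertical_side[OF _ le, of z m] right by simp
  next
    case 3 thus ?thesis using horizontal_sides[of z "b m" m] b(1)[of m] top by simp
  next
    case 4 thus ?thesis using curve by auto
  qed
qed

lemma heights:
  assumes "large m"
  shows "H \<le> \<bar>h - real m * T\<bar>" "H \<le> \<bar>h + real m * T\<bar>"
    "real m * T - T \<le> \<bar>h - real m * T\<bar>" "real m * T - T \<le> \<bar>h + real m * T\<bar>"
  using assms h M_nonneg H T unfolding large_def by auto

lemma far_horizontal:
  assumes "p \<in> V" "- M \<le> Re z" "Im z = h - real m * T \<or> Im z = h + real m * T"
  shows "\<delta> \<le> dist p z"
  using assms far[of p z "- int m"] far[of p z "int m"] by auto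

lemma not_pole_horizontal:
  assumes "large m" "- M \<le> Re z" "Im z = h - real m * T \<or> Im z = h + real m * T"
  shows "z \<notin> poles"
proof
  assume "z \<in> poles"
  moreover have "H \<le> \<bar>Im z\<bar>" using assms(3) heights[OF assms(1)] by auto
  ultimately have "z \<in> V" using V_poles by (auto simp: poles_def)
  thus False using far_horizontal[of z z m] assms del by simp
qed

lemma not_pole_vertical: "Re z = R m \<Longrightarrow> z \<notin> poles"
  using vertical by (metis R_def complex.collapse mem_Collect_eq poles_def)

lemma path_image_\<Gamma>_avoids:
  assumes "large m" shows "path_image (\<Gamma> m) \<subseteq> - poles"
proof
  fix z assume "z \<in> path_image (\<Gamma> m)"
  thus "z \<in> - poles"
    by (rule path_image_\<Gamma>_cases[OF assms])
       (use not_pole_horizontal[OF assms, of z] not_pole_vertical curve_avoids in auto)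
qed

lemma open_off_poles: "open (- poles)" using closed_poles_subset by auto

text \<open>A bound for the length of the loop that is linear in \<open>m\<close>.\<close>
definition len where "len m = 2 * (R m + M) + 2 * real m * T + L * (2 * real m * T + 2 * M)"

lemma norm_contour_integral_\<Gamma>_le:
  assumes m: "large m" and f: "f holomorphic_on S" "open S" "path_image (\<Gamma> m) \<subseteq> S"
    and K: "\<And>z. z \<in> path_image (\<Gamma> m) \<Longrightarrow> norm (f z) \<le> K" "0 \<le> K"
  shows "norm (contour_integral (\<Gamma> m) f) \<le> K * len m"
proof -
  have "norm (contour_integral (\<Gamma> m) f) \<le> K * (2 * (R m + M) + \<bar>Im (\<gamma> (b m)) - Im (\<gamma> (a m))\<bar> + L * (b m - a m))"
    unfolding \<Gamma>_def
    by (rule norm_contour_integral_box_loop_le[OF large_ab[OF m] f(1,2) f(3)[unfolded \<Gamma>_def] K(1)[unfolded \<Gamma>_def] K(2)])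
       (use R_bounds[of m] in auto)
  also have "\<dots> \<le> K * len m"
  proof (rule mult_left_mono[OF _ K(2)])
    have "b m - a m \<le> 2 * real m * T + 2 * M" using a(2)[of m] b(2)[of m] by (simp add: abs_le_iff)
    hence "L * (b m - a m) \<le> L * (2 * real m * T + 2 * M)" using L_nonneg by (rule mult_left_mono)
    thus "2 * (R m + M) + \<bar>Im (\<gamma> (b m)) - Im (\<gamma> (a m))\<bar> + L * (b m - a m) \<le> len m"
      unfolding len_def a b using T by (simp add: mult_ac)
  qed
  finally show ?thesis .
qed

text \<open>A winding number is \<open>1 / (2 * pi)\<close> times an integral of \<open>1 / (w -
  p)\<close>, hence at most the length of the loop divided by its distance from \<open>p\<close>. For
  poles near the truncation heights this linear growth replaces the exact value, because the arc beyond
  the truncation that would complete the separation is missing.\<close>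
lemma norm_winding_le:
  assumes m: "large m" and p: "p \<in> V" "H \<le> \<bar>Im p\<bar>"
  shows "norm (winding_number (\<Gamma> m) p) \<le> len m / (2 * pi * min \<epsilon> (min \<delta> 1))"
proof -
  define d where "d = min \<epsilon> (min \<delta> 1)"
  have d: "0 < d" using eps del by (simp add: d_def)
  have dist: "d \<le> dist p z" if "z \<in> path_image (\<Gamma> m)" for z
    using m that
  proof (cases rule: path_image_\<Gamma>_cases)
    case bottom thus ?thesis using far_horizontal[OF p(1), of z m] by (simp add: d_def)
  next
    case top thus ?thesis using far_horizontal[OF p(1), of z m] by (simp add: d_def)
  next
    case right
    hence "1 \<le> \<bar>Re (p - z)\<bar>" using V_Re[OF p(1)] R_bounds[of m] by simp
    thus ?thesis using abs_Re_le_cmod[of "p - z"] by (simp add: d_def dist_norm)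
  next
    case (curve t) thus ?thesis using poles_far[of p t] V_poles p by (simp add: d_def)
  qed
  hence pn: "p \<notin> path_image (\<Gamma> m)" using d by fastforce
  have vp: "valid_path (\<Gamma> m)" unfolding \<Gamma>_def by (rule valid_path_box_loop[OF large_ab[OF m]])
  have "norm (contour_integral (\<Gamma> m) (\<lambda>w. 1 / (w - p))) \<le> (1 / d) * len m"
  proof (rule norm_contour_integral_\<Gamma>_le[OF m])
    show "(\<lambda>w. 1 / (w - p)) holomorphic_on - {p}" by (intro holomorphic_intros) auto
    fix z assume "z \<in> path_image (\<Gamma> m)"
    hence "d \<le> norm (z - p)" using dist[of z] by (simp add: dist_norm norm_minus_commute)
    thus "norm (1 / (z - p)) \<le> 1 / d" using d by (simp add: norm_divide frac_le)
  qed (use pn d in auto)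
  hence "norm (winding_number (\<Gamma> m) p) \<le> 1 / (2 * pi) * ((1 / d) * len m)"
    unfolding winding_number_valid_path[OF vp pn] norm_mult
    by (intro mult_mono) (auto simp: norm_divide norm_mult)
  thus ?thesis by (simp add: d_def field_simps)
qed

text \<open>The points of \<open>V\<close> in a fixed window that contains, up to a multiple of the
  period, every pole near a truncation height.\<close>
definition V0 where "V0 = cbox (Complex (- M - 1) (h - 3 * M - 1)) (Complex B (h + 3 * M + 1)) \<inter> V"

lemma finite_V0: "finite V0"
  unfolding V0_def by (intro finite_not_islimpt_in_compact) (auto simp: V_discrete)

text \<open>The poles near one of the two truncation heights. The curve reaches the height \<open>h + m
  * T\<close> at a parameter within \<open>M\<close> of it and deviates from its parameter by at most
  \<open>M\<close>; hence beyond the truncation it stays above \<open>h + m * T - 2 * M\<close>, and the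
  loop stays below \<open>h + m * T + 2 * M\<close>. Outside these margins the winding numbers are
  known.\<close>
definition edge where
  "edge m = {p \<in> poles. - M - 1 \<le> Re p \<and>
     (h + real m * T - 2 * M \<le> Im p \<and> Im p \<le> h + real m * T + 3 * M + 1 \<or>
      h - real m * T - 3 * M - 1 \<le> Im p \<and> Im p \<le> h - real m * T + 2 * M)}"

lemma edge_Im: "large m \<Longrightarrow> p \<in> edge m \<Longrightarrow> real m * T - T - 2 * M \<le> \<bar>Im p\<bar>"
proof -
  assume m: "large m" and p: "p \<in> edge m"
  have "h + real m * T - 2 * M \<le> Im p \<or> Im p \<le> h - real m * T + 2 * M"
    using p unfolding edge_def by blast
  moreover have "Im p \<le> \<bar>Im p\<bar>" "- Im p \<le> \<bar>Im p\<bar>" by simp_all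
  ultimately show ?thesis using h T by linarith
qed

lemma V_shift: "p + of_int n * (\<i> * of_real T) \<in> V \<longleftrightarrow> p \<in> V"
  by (rule shift_by_int[OF V_periodic])

lemma edge_Re: "p \<in> edge m \<Longrightarrow> - M - 1 \<le> Re p"
  unfolding edge_def by blast

lemma edge_V: "large m \<Longrightarrow> p \<in> edge m \<Longrightarrow> p \<in> V \<and> H \<le> \<bar>Im p\<bar>"
proof -
  assume m: "large m" and p: "p \<in> edge m"
  have "H \<le> \<bar>Im p\<bar>" using edge_Im[OF m p] m M_nonneg T unfolding large_def by linarith
  thus ?thesis using V_poles[of p] p unfolding edge_def poles_def by blast
qed

lemma edge_representative:
  assumes "large m" "p \<in> edge m"
  obtains v n where "v \<in> V0" "p = v + of_int n * (\<i> * of_real T)" "n = int m \<or> n = - int m"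
proof -
  have p: "p \<in> V" using edge_V[OF assms] by simp
  have sh: "p + of_int n * (\<i> * of_real T) \<in> V" for n using p by (simp only: V_shift)
  have Re: "Re p \<le> B" "- M - 1 \<le> Re p" using V_Re[OF p] edge_Re[OF assms(2)] by blast+
  from assms consider "h + real m * T - 2 * M \<le> Im p \<and> Im p \<le> h + real m * T + 3 * M + 1"
    | "h - real m * T - 3 * M - 1 \<le> Im p \<and> Im p \<le> h - real m * T + 2 * M"
    unfolding edge_def by blast
  thus thesis
  proof cases
    case 1
    have "p + of_int (- int m) * (\<i> * of_real T) \<in> V0"
      using 1 Re sh[of "- int m"] M_nonneg by (auto simp: V0_def in_cbox_complex_iff)
    thus ?thesis by (rule that[of _ "int m"]) auto
  next
    case 2
    have "p + of_int (int m) * (\<i> * of_real T) \<in> V0"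
      using 2 Re sh[of "int m"] M_nonneg by (auto simp: V0_def in_cbox_complex_iff)
    thus ?thesis by (rule that[of _ "- int m"]) auto
  qed
qed

text \<open>Translation by \<open>m\<close> periods carries the poles near a truncation height into the
  fixed finite set \<open>V0\<close>.\<close>
lemma card_edge:
  assumes "large m" shows "finite (edge m)" "card (edge m) \<le> 2 * card V0"
proof -
  define sh where "sh = (\<lambda>n v. v + of_int n * (\<i> * of_real T) :: complex)"
  have sub: "edge m \<subseteq> sh (int m) ` V0 \<union> sh (- int m) ` V0"
  proof
    fix p assume "p \<in> edge m"
    then obtain v n where v: "v \<in> V0" "p = sh n v" "n = int m \<or> n = - int m"
      unfolding sh_def by (rule edge_representative[OF assms])
    thus "p \<in> sh (int m) ` V0 \<union> sh (- int m) ` V0" by blast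
  qed
  have fin: "finite (sh (int m) ` V0 \<union> sh (- int m) ` V0)" using finite_V0 by auto
  show "finite (edge m)" using sub fin by (rule finite_subset)
  have "card (edge m) \<le> card (sh (int m) ` V0 \<union> sh (- int m) ` V0)" by (rule card_mono[OF fin sub])
  also have "\<dots> \<le> card (sh (int m) ` V0) + card (sh (- int m) ` V0)" by (rule card_Un_le)
  also have "\<dots> \<le> card V0 + card V0" by (intro add_mono card_image_le finite_V0)
  finally show "card (edge m) \<le> 2 * card V0" by simp
qed

lemma V0_separation:
  obtains r where "0 < r" "r \<le> 1" "\<And>v p. v \<in> V0 \<Longrightarrow> p \<in> V \<Longrightarrow> p \<noteq> v \<Longrightarrow> 2 * r \<le> dist p v"
proof -
  have "\<forall>v\<in>V0. \<exists>r>0. \<forall>p\<in>V. p \<noteq> v \<longrightarrow> r \<le> dist p v"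
    using V_discrete unfolding islimpt_approachable by (meson not_less)
  then obtain r where r: "\<And>v. v \<in> V0 \<Longrightarrow> 0 < r v" "\<And>v p. v \<in> V0 \<Longrightarrow> p \<in> V \<Longrightarrow> p \<noteq> v \<Longrightarrow> r v \<le> dist p v"
    by metis
  define r0 where "r0 = Min (insert 1 (r ` V0))"
  have fin: "finite (insert 1 (r ` V0))" using finite_V0 by simp
  have r0: "0 < r0" "r0 \<le> 1" "\<And>v. v \<in> V0 \<Longrightarrow> r0 \<le> r v"
  proof -
    show "0 < r0" unfolding r0_def using fin r by (subst Min_gr_iff) auto
    show "r0 \<le> 1" "\<And>v. v \<in> V0 \<Longrightarrow> r0 \<le> r v" unfolding r0_def by (rule Min_le[OF fin]; simp)+
  qed
  show thesis
  proof (rule that[of "r0 / 2"])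
    fix v p assume vp: "v \<in> V0" "p \<in> V" "p \<noteq> v"
    show "2 * (r0 / 2) \<le> dist p v" using r0(3)[OF vp(1)] r(2)[OF vp] by simp
  qed (use r0 in auto)
qed

text \<open>Cauchy's estimate on a circle whose radius does not depend on \<open>m\<close>: by
  periodicity the poles near the truncation heights are as far from the rest of \<open>V\<close> as
  their representatives in the finite set \<open>V0\<close>.\<close>
lemma residue_decay:
  obtains K where "0 \<le> K" "\<And>m p. large m \<Longrightarrow> p \<in> edge m \<Longrightarrow> norm (residue F p) \<le> K * exp (- (real m * T))"
proof -
  obtain r where r: "0 < r" "r \<le> 1" "\<And>v p. v \<in> V0 \<Longrightarrow> p \<in> V \<Longrightarrow> p \<noteq> v \<Longrightarrow> 2 * r \<le> dist p v"
    by (rule V0_separation) blast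
  obtain C where "\<forall>s. - M - 2 \<le> Re s \<longrightarrow> H \<le> \<bar>Im s\<bar> \<longrightarrow>
        (\<forall>p\<in>V. r \<le> dist p s) \<longrightarrow> norm (F s) \<le> C * exp (- \<bar>Im s\<bar>)" using decay[OF r(1)] by blast
  note C = this[rule_format]
  define X where "X = T + 2 * M + 1"
  show thesis
  proof (rule that[of "\<bar>C\<bar> * exp X"])
    fix m p assume m: "large m" and p: "p \<in> edge m"
    have pV: "p \<in> V" using edge_V[OF m p] by simp
    obtain v n where v: "v \<in> V0" "p = v + of_int n * (\<i> * of_real T)"
      by (rule edge_representative[OF m p])
    have sep: "2 * r \<le> dist p' p" if "p' \<in> V" "p' \<noteq> p" for p'
    proof -
      have "p' + of_int (- n) * (\<i> * of_real T) \<in> V" using that(1) by (simp only: V_shift)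
      moreover have "p' + of_int (- n) * (\<i> * of_real T) \<noteq> v" using that v by auto
      ultimately have "2 * r \<le> dist (p' + of_int (- n) * (\<i> * of_real T)) v" by (rule r(3)[OF v(1)])
      thus ?thesis unfolding v(2) by (simp add: dist_norm algebra_simps)
    qed
    have near: "H \<le> \<bar>Im s\<bar> \<and> real m * T - X \<le> \<bar>Im s\<bar> \<and> - M - 2 \<le> Re s" if "dist p s \<le> r" for s
    proof -
      have "\<bar>Im p - Im s\<bar> \<le> 1" "\<bar>Re p - Re s\<bar> \<le> 1"
        using that r(2) abs_Im_le_cmod[of "p - s"] abs_Re_le_cmod[of "p - s"] by (simp_all add: dist_norm)
      hence "\<bar>Im p\<bar> \<le> \<bar>Im s\<bar> + 1" "Re p - 1 \<le> Re s" by linarith+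
      moreover have "H + T + 2 * M + 1 \<le> real m * T" using m M_nonneg T unfolding large_def by linarith
      ultimately show ?thesis using edge_Im[OF m p] edge_Re[OF p] unfolding X_def by (intro conjI; linarith)
    qed
    define U where "U = - (poles - {p})"
    have U: "open U" unfolding U_def by (intro open_Compl closed_poles_subset) auto
    have cb: "cball p r \<subseteq> U"
    proof
      fix s assume s: "s \<in> cball p r"
      show "s \<in> U"
      proof (rule ccontr)
        assume "s \<notin> U"
        hence s': "s \<in> poles" "s \<noteq> p" by (auto simp: U_def)
        have "H \<le> \<bar>Im s\<bar>" using near[of s] s by simp
        with s'(1) have "s \<in> V" using V_poles[of s] by (simp add: poles_def)
        from sep[OF this s'(2)] s r(1) show False by (simp add: dist_commute)
      qed
    qed
    have "F holomorphic_on U - {p}"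
      by (rule holomorphic_on_subset[OF holomorphic_off_poles]) (unfold U_def, blast)
    from base_residue[OF U _ r(1) this cb]
    have "(F has_contour_integral 2 * pi * \<i> * residue F p) (circlepath p r)"
      by (simp add: U_def)
    hence "norm (2 * pi * \<i> * residue F p) \<le> (\<bar>C\<bar> * exp (X - real m * T)) * (2 * pi * r)"
    proof (rule has_contour_integral_bound_circlepath)
      fix s assume s: "norm (s - p) = r"
      have "norm (F s) \<le> C * exp (- \<bar>Im s\<bar>)"
      proof (rule C)
        show "- M - 2 \<le> Re s" "H \<le> \<bar>Im s\<bar>" using near[of s] s by (simp_all add: dist_norm norm_minus_commute)
        fix p' assume p': "p' \<in> V"
        show "r \<le> dist p' s"
        proof (cases "p' = p")
          case True thus ?thesis using s by (simp add: dist_norm norm_minus_commute)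
        next
          case False
          have "dist p' p \<le> dist p' s + dist s p" by (rule dist_triangle)
          thus ?thesis using sep[OF p' False] s by (simp add: dist_norm)
        qed
      qed
      also have "\<dots> \<le> \<bar>C\<bar> * exp (X - real m * T)"
      proof (intro mult_mono)
        have "real m * T - X \<le> \<bar>Im s\<bar>" using near[of s] s by (simp add: dist_norm norm_minus_commute)
        thus "exp (- \<bar>Im s\<bar>) \<le> exp (X - real m * T)" by simp
      qed simp_all
      finally show "norm (F s) \<le> \<bar>C\<bar> * exp (X - real m * T)" .
    qed (use r in auto)
    moreover have "norm (2 * pi * \<i> * residue F p) = (2 * pi) * norm (residue F p)"
      by (simp add: norm_mult)
    ultimately have "(2 * pi) * norm (residue F p) \<le> (2 * pi) * (\<bar>C\<bar> * exp (X - real m * T) * r)"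
      by (simp only: mult_ac)
    hence "norm (residue F p) \<le> \<bar>C\<bar> * exp (X - real m * T) * r"
      by (rule mult_left_le_imp_le) simp
    also have "\<dots> \<le> \<bar>C\<bar> * exp (X - real m * T) * 1" using r by (intro mult_left_mono) auto
    also have "\<dots> = \<bar>C\<bar> * exp X * exp (- (real m * T))" by (simp add: exp_diff exp_minus divide_inverse)
    finally show "norm (residue F p) \<le> \<bar>C\<bar> * exp X * exp (- (real m * T))" .
  qed simp
qed

definition right_poles where "right_poles m = {p \<in> I. is_pole F p \<and> Re p < R m}"

text \<open>The residue theorem for the loop. Poles on the right of the curve are encircled once, those
  on the left, or beyond the vertical side, not at all; only poles near the truncation heights have an
  unknown winding number, and these form the set \<open>E\<close>.\<close>
lemma residue_theorem_\<Gamma>: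
  assumes m: "large m"
  obtains E where "E \<subseteq> edge m" "finite E"
    "contour_integral (\<Gamma> m) F = 2 * pi * \<i> * ((\<Sum>p\<in>right_poles m. residue F p)
       + (\<Sum>p\<in>E. winding_number (\<Gamma> m) p * residue F p))"
proof -
  define S where "S = box (Complex (- M - 1) (h - real m * T - 3 * M - 1)) (Complex (R m + 1) (h + real m * T + 3 * M + 1))"
  note ab = large_ab[OF m]
  have vp: "valid_path (\<Gamma> m)" and cl: "pathfinish (\<Gamma> m) = pathstart (\<Gamma> m)" and pth: "path (\<Gamma> m)"
    unfolding \<Gamma>_def using ab valid_path_box_loop[OF ab] by auto
  have mT: "0 \<le> real m * T" using T by simp
  have pi_S: "path_image (\<Gamma> m) \<subseteq> S"
  proof
    fix z assume "z \<in> path_image (\<Gamma> m)"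
    with m show "z \<in> S"
    proof (cases rule: path_image_\<Gamma>_cases)
      case (curve t)
      have "- M \<le> Re z" "Re z \<le> M" using Re_le[of t] curve by (auto simp: abs_le_iff)
      moreover have "h - real m * T - 2 * M \<le> Im z" "Im z \<le> h + real m * T + 2 * M"
        using Im_le[of t] curve a(2)[of m] b(2)[of m] by (auto simp: abs_le_iff)
      ultimately show ?thesis using R_bounds[of m] M_nonneg by (auto simp: S_def in_box_complex_iff)
    next
      case bottom
      thus ?thesis using mT R_bounds[of m] M_nonneg unfolding S_def in_box_complex_iff complex.sel greaterThanLessThan_iff by (intro conjI; linarith)
    next
      case top
      thus ?thesis using mT R_bounds[of m] M_nonneg unfolding S_def in_box_complex_iff complex.sel greaterThanLessThan_iff by (intro conjI; linarith)
    next
      case right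
      thus ?thesis using mT R_bounds[of m] M_nonneg unfolding S_def in_box_complex_iff complex.sel greaterThanLessThan_iff by (intro conjI; linarith)
    qed
  qed
  have pi_R: "path_image (\<Gamma> m) \<subseteq> {z. Re z \<le> R m}"
  proof
    fix z assume "z \<in> path_image (\<Gamma> m)"
    with m show "z \<in> {z. Re z \<le> R m}"
    proof (cases rule: path_image_\<Gamma>_cases)
      case (curve t)
      thus ?thesis using Re_le[of t] R_bounds[of m] by (auto simp: abs_le_iff)
    qed auto
  qed
  have S: "open S" "connected S" "convex S" unfolding S_def by (rule open_box convex_connected[OF convex_box(2)] convex_box(2))+
  have outside: "winding_number (\<Gamma> m) z = 0" if "z \<notin> S" for z
    by (rule winding_number_zero_outside[OF pth S(3) cl that pi_S])
  define pts where "pts = poles \<inter> S"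
  have fin: "finite pts"
  proof (rule finite_subset)
    show "pts \<subseteq> cbox (Complex (- M - 1) (h - real m * T - 3 * M - 1)) (Complex (R m + 1) (h + real m * T + 3 * M + 1)) \<inter> poles"
      unfolding pts_def S_def using box_subset_cbox by blast
  qed (intro finite_not_islimpt_in_compact, auto simp: poles_discrete)
  have res: "contour_integral (\<Gamma> m) F = 2 * pi * \<i> * (\<Sum>p\<in>pts. winding_number (\<Gamma> m) p * residue F p)"
  proof (rule Residue_theorem[OF S(1,2) fin _ vp cl])
    show "F holomorphic_on S - pts"
      by (rule holomorphic_on_subset[OF holomorphic_off_poles]) (auto simp: pts_def)
    show "path_image (\<Gamma> m) \<subseteq> S - pts" using pi_S path_image_\<Gamma>_avoids[OF m] by (auto simp: pts_def)
  qed (use outside in auto)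
  have mid: "h - real m * T + 2 * M < Im p \<and> Im p < h + real m * T - 2 * M" if "p \<in> pts" "p \<notin> edge m" for p
  proof -
    have 1: "- M - 1 < Re p" "h - real m * T - 3 * M - 1 < Im p" "Im p < h + real m * T + 3 * M + 1" "p \<in> poles"
      using that(1) by (simp_all add: pts_def S_def in_box_complex_iff)
    hence "\<not> (h + real m * T - 2 * M \<le> Im p)" "\<not> (Im p \<le> h - real m * T + 2 * M)"
      using that(2) unfolding edge_def by auto
    thus ?thesis by linarith
  qed
  have top: "Im p < Im (\<gamma> t)" if "b m \<le> t" "Im p < h + real m * T - 2 * M" for p t
    using that Im_le[of t] b(2)[of m] by (auto simp: abs_le_iff)
  have bot: "Im (\<gamma> t) < Im p" if "t \<le> a m" "h - real m * T + 2 * M < Im p" for p t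
    using that Im_le[of t] a(2)[of m] by (auto simp: abs_le_iff)
  have wn1: "winding_number (\<Gamma> m) p = 1" if "p \<in> right_poles m" for p
  proof -
    have p: "p \<in> I" "is_pole F p" "Re p < R m" "\<bar>Im p\<bar> \<le> H" using that I_Im by (auto simp: right_poles_def)
    have "h - real m * T + 2 * M < Im p" "Im p < h + real m * T - 2 * M"
      using p(4) m h T M_nonneg unfolding large_def abs_le_iff by linarith+
    thus ?thesis unfolding \<Gamma>_def
      by (intro winding_box_loop_right[OF I_right[OF p(1,2)] ab p(3)] top bot)
  qed
  have sub: "right_poles m \<subseteq> pts - edge m"
  proof
    fix p assume p: "p \<in> right_poles m"
    hence "p \<in> S" using wn1[OF p] outside[of p] by auto
    moreover have "\<bar>Im p\<bar> \<le> H" "p \<in> poles" using p I_Im by (auto simp: right_poles_def poles_def)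
    moreover have "p \<notin> edge m"
    proof
      assume "p \<in> edge m"
      from edge_Im[OF m this] \<open>\<bar>Im p\<bar> \<le> H\<close> m M_nonneg T show False
        unfolding large_def by linarith
    qed
    ultimately show "p \<in> pts - edge m" by (auto simp: pts_def)
  qed
  have wn0: "winding_number (\<Gamma> m) p = 0" if p: "p \<in> pts" "p \<notin> edge m" "p \<notin> right_poles m" for p
  proof (cases "Re p < R m")
    case True
    have "is_pole F p" "p \<notin> I" using p True by (auto simp: right_poles_def pts_def poles_def)
    thus ?thesis unfolding \<Gamma>_def
      by (intro winding_box_loop_left[OF I_left ab True] top bot) (use mid[OF p(1,2)] in auto)
  next
    case False
    hence "R m < Re p" using not_pole_vertical[of p m] p by (force simp: pts_def)
    thus ?thesis
      by (intro winding_number_zero_outside[OF pth convex_complex_halfspaces(5) cl _ pi_R]) auto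
  qed
  have "(\<Sum>p\<in>pts. winding_number (\<Gamma> m) p * residue F p)
     = (\<Sum>p\<in>pts - edge m. winding_number (\<Gamma> m) p * residue F p) + (\<Sum>p\<in>pts \<inter> edge m. winding_number (\<Gamma> m) p * residue F p)"
    by (subst sum.Int_Diff[OF fin, of _ "edge m"]) (rule add.commute)
  also have "(\<Sum>p\<in>pts - edge m. winding_number (\<Gamma> m) p * residue F p) = (\<Sum>p\<in>right_poles m. residue F p)"
    using fin sub wn0 wn1 by (intro sum.mono_neutral_cong_right) auto
  finally show thesis
    using res fin by (intro that[of "pts \<inter> edge m"]) auto
qed

definition caps where
  "caps m = contour_integral (linepath (\<gamma> (a m)) (Complex (R m) (Im (\<gamma> (a m))))) F
    + contour_integral (linepath (Complex (R m) (Im (\<gamma> (a m)))) (Complex (R m) (Im (\<gamma> (b m))))) F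
    + contour_integral (linepath (Complex (R m) (Im (\<gamma> (b m)))) (\<gamma> (b m))) F"

lemma contour_integral_\<Gamma>:
  "large m \<Longrightarrow> contour_integral (\<Gamma> m) F = caps m - integral {a m..b m} (\<lambda>t. F (\<gamma> t) * velocity t)"
  unfolding caps_def \<Gamma>_def
  by (rule contour_integral_box_loop(1)[OF large_ab holomorphic_off_poles open_off_poles])
     (use path_image_\<Gamma>_avoids in \<open>simp_all add: \<Gamma>_def\<close>)

text \<open>The horizontal sides have length linear in \<open>m\<close> and the integrand is
  \<open>O(exp (- m * T))\<close> there; on the vertical side it is \<open>O(exp (- \<kappa> *
  m))\<close>.\<close>
lemma caps_tendsto: "caps \<longlonglongrightarrow> 0"
proof -
  obtain C where "\<forall>s. - M - 2 \<le> Re s \<longrightarrow> H \<le> \<bar>Im s\<bar> \<longrightarrow>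
        (\<forall>p\<in>V. \<delta> \<le> dist p s) \<longrightarrow> norm (F s) \<le> C * exp (- \<bar>Im s\<bar>)" using decay[OF del] by blast
  note C = this[rule_format]
  obtain C' where C': "\<And>m y. norm (F (Complex (\<rho> + real m) y)) \<le> C' * exp (- (\<kappa> * real m))"
    using vertical by blast
  define K1 where "K1 = (\<lambda>m. \<bar>C\<bar> * exp T * exp (- (real m * T)))"
  define K2 where "K2 = (\<lambda>m. \<bar>C'\<bar> * exp (- (real m * \<kappa>)))"
  define bnd where "bnd = (\<lambda>m. 2 * (K1 m * (R m + M)) + K2 m * (2 * real m * T))"
  have hor: "norm (F z) \<le> K1 m"
    if m: "large m" and z: "- M \<le> Re z" "Im z = h - real m * T \<or> Im z = h + real m * T" for m z
  proof -
    have Im: "H \<le> \<bar>Im z\<bar>" "real m * T - T \<le> \<bar>Im z\<bar>" using z(2) heights[OF m] by auto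
    have "norm (F z) \<le> C * exp (- \<bar>Im z\<bar>)"
      using z Im far_horizontal by (intro C) auto
    also have "\<dots> \<le> \<bar>C\<bar> * exp (T - real m * T)" using Im(2) by (intro mult_mono) auto
    also have "\<dots> = K1 m" by (simp add: K1_def exp_diff exp_minus divide_inverse)
    finally show ?thesis .
  qed
  have le: "norm (caps m) \<le> bnd m" if m: "large m" for m
  proof -
    note ci = contour_integral_box_loop[OF large_ab[OF m] holomorphic_off_poles open_off_poles
        path_image_\<Gamma>_avoids[OF m, unfolded \<Gamma>_def]]
    have K: "0 \<le> K1 m" "0 \<le> K2 m" by (simp_all add: K1_def K2_def)
    have ln: "norm (Complex (R m) (Im (\<gamma> t)) - \<gamma> t) \<le> R m + M" for t
    proof -
      have "Complex (R m) (Im (\<gamma> t)) - \<gamma> t = of_real (R m - Re (\<gamma> t))" by (simp add: complex_eq_iff)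
      hence "norm (Complex (R m) (Im (\<gamma> t)) - \<gamma> t) = \<bar>R m - Re (\<gamma> t)\<bar>" by (simp only: norm_of_real)
      thus ?thesis using Re_le[of t] R_bounds[of m] by linarith
    qed
    have 1: "norm (contour_integral (linepath (\<gamma> (a m)) (Complex (R m) (Im (\<gamma> (a m))))) F) \<le> K1 m * (R m + M)"
    proof (rule order_trans[OF contour_integral_bound_linepath[OF ci(2) K(1)]])
      fix z assume "z \<in> closed_segment (\<gamma> (a m)) (Complex (R m) (Im (\<gamma> (a m))))"
      thus "norm (F z) \<le> K1 m" using horizontal_sides[of z "a m" m] a by (intro hor[OF m]) auto
    qed (rule mult_left_mono[OF ln K(1)])
    have 3: "norm (contour_integral (linepath (Complex (R m) (Im (\<gamma> (b m)))) (\<gamma> (b m))) F) \<le> K1 m * (R m + M)"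
    proof (rule order_trans[OF contour_integral_bound_linepath[OF ci(4) K(1)]])
      fix z assume "z \<in> closed_segment (Complex (R m) (Im (\<gamma> (b m)))) (\<gamma> (b m))"
      thus "norm (F z) \<le> K1 m" using horizontal_sides[of z "b m" m] b by (intro hor[OF m]) auto
    next
      show "K1 m * norm (\<gamma> (b m) - Complex (R m) (Im (\<gamma> (b m)))) \<le> K1 m * (R m + M)"
        using ln[of "b m"] K(1) by (intro mult_left_mono) (simp_all add: norm_minus_commute)
    qed
    have 2: "norm (contour_integral (linepath (Complex (R m) (Im (\<gamma> (a m)))) (Complex (R m) (Im (\<gamma> (b m))))) F)
       \<le> K2 m * (2 * real m * T)"
    proof (rule order_trans[OF contour_integral_bound_linepath[OF ci(3) K(2)]])
      fix z assume z: "z \<in> closed_segment (Complex (R m) (Im (\<gamma> (a m)))) (Complex (R m) (Im (\<gamma> (b m))))"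
      have "Im (\<gamma> (a m)) \<le> Im (\<gamma> (b m))" using T by (simp add: a b)
      hence "z = Complex (\<rho> + real m) (Im z)"
        using vertical_side(1)[OF z] by (simp add: complex_eq_iff R_def)
      hence "norm (F z) \<le> C' * exp (- (\<kappa> * real m))" using C' by metis
      also have "\<dots> \<le> \<bar>C'\<bar> * exp (- (\<kappa> * real m))" by (intro mult_right_mono) auto
      also have "\<dots> = K2 m" by (simp add: K2_def mult.commute)
      finally show "norm (F z) \<le> K2 m" .
    next
      have "norm (Complex (R m) (Im (\<gamma> (b m))) - Complex (R m) (Im (\<gamma> (a m)))) = 2 * real m * T"
      proof -
        have "Complex (R m) (Im (\<gamma> (b m))) - Complex (R m) (Im (\<gamma> (a m))) = \<i> * of_real (2 * real m * T)"
          by (simp add: complex_eq_iff a b)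
        thus ?thesis using T by (simp only: norm_mult norm_ii norm_of_real) simp
      qed
      thus "K2 m * norm (Complex (R m) (Im (\<gamma> (b m))) - Complex (R m) (Im (\<gamma> (a m)))) \<le> K2 m * (2 * real m * T)"
        by simp
    qed
    have "norm (caps m) \<le> K1 m * (R m + M) + K2 m * (2 * real m * T) + K1 m * (R m + M)"
      unfolding caps_def by (intro norm_triangle_le add_mono 1 2 3 order_trans[OF norm_triangle_ineq add_mono])
    thus ?thesis by (simp add: bnd_def)
  qed
  have "bnd \<longlonglongrightarrow> 0"
  proof -
    have "(\<lambda>m. 2 * \<bar>C\<bar> * exp T * ((\<rho> + M + 1 * real m) * exp (- (real m * T)))
        + 2 * \<bar>C'\<bar> * T * ((0 + 1 * real m) * exp (- (real m * \<kappa>)))) \<longlonglongrightarrow>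
        2 * \<bar>C\<bar> * exp T * 0 + 2 * \<bar>C'\<bar> * T * 0"
      by (intro tendsto_add tendsto_mult_left linear_times_exp_tendsto_0 T kap)
    thus ?thesis unfolding bnd_def K1_def K2_def R_def by (simp add: mult_ac add_ac)
  qed
  thus ?thesis
    by (rule Lim_null_comparison[rotated]) (use eventually_large le in \<open>auto elim: eventually_mono\<close>)
qed

text \<open>The contribution of the poles near the truncation heights is bounded by a fixed number of
  poles, times a winding number of size \<open>O(m)\<close>, times a residue of size \<open>O(exp (- m *
  T))\<close>.\<close>
theorem residue_sums_tendsto:
  "(\<lambda>m. \<Sum>p\<in>right_poles m. residue F p)
     \<longlonglongrightarrow> - (integral UNIV (\<lambda>t. F (\<gamma> t) * velocity t) / (2 * pi * \<i>))"
proof -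
  define J where "J = integral UNIV (\<lambda>t. F (\<gamma> t) * velocity t)"
  have "\<forall>m. \<exists>E. large m \<longrightarrow> E \<subseteq> edge m \<and> finite E \<and>
      contour_integral (\<Gamma> m) F = 2 * pi * \<i> * ((\<Sum>p\<in>right_poles m. residue F p)
         + (\<Sum>p\<in>E. winding_number (\<Gamma> m) p * residue F p))"
  proof
    fix m
    show "\<exists>E. large m \<longrightarrow> E \<subseteq> edge m \<and> finite E \<and>
      contour_integral (\<Gamma> m) F = 2 * pi * \<i> * ((\<Sum>p\<in>right_poles m. residue F p)
         + (\<Sum>p\<in>E. winding_number (\<Gamma> m) p * residue F p))"
    proof (cases "large m")
      case True
      show ?thesis by (rule residue_theorem_\<Gamma>[OF True]) blast
    qed simp
  qed
  from choice[OF this] obtain E where E':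
    "\<forall>m. large m \<longrightarrow> E m \<subseteq> edge m \<and> finite (E m) \<and>
      contour_integral (\<Gamma> m) F = 2 * pi * \<i> * ((\<Sum>p\<in>right_poles m. residue F p)
         + (\<Sum>p\<in>E m. winding_number (\<Gamma> m) p * residue F p))" ..
  have E: "E m \<subseteq> edge m" "finite (E m)"
    "contour_integral (\<Gamma> m) F = 2 * pi * \<i> * ((\<Sum>p\<in>right_poles m. residue F p)
       + (\<Sum>p\<in>E m. winding_number (\<Gamma> m) p * residue F p))" if "large m" for m
    using E'[rule_format, OF that] by blast+
  define err where "err = (\<lambda>m. \<Sum>p\<in>E m. winding_number (\<Gamma> m) p * residue F p)"
  obtain K where K: "0 \<le> K" "\<And>m p. large m \<Longrightarrow> p \<in> edge m \<Longrightarrow> norm (residue F p) \<le> K * exp (- (real m * T))"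
    by (rule residue_decay) blast
  define d where "d = 2 * pi * min \<epsilon> (min \<delta> 1)"
  have d: "0 < d" using eps del by (simp add: d_def)
  define w where "w = (\<lambda>m. 2 * real (card V0) * (len m / d * (K * exp (- (real m * T)))))"
  have err_le: "norm (err m) \<le> w m" if m: "large m" for m
  proof -
    have len: "0 \<le> len m"
      using R_bounds[of m] T M_nonneg L_nonneg by (simp add: len_def)
    have "norm (err m) \<le> (\<Sum>p\<in>E m. norm (winding_number (\<Gamma> m) p * residue F p))"
      unfolding err_def by (rule norm_sum)
    also have "\<dots> \<le> (\<Sum>p\<in>E m. len m / d * (K * exp (- (real m * T))))"
    proof (rule sum_mono)
      fix p assume "p \<in> E m"
      hence p: "p \<in> edge m" using E(1)[OF m] by blast
      have "norm (winding_number (\<Gamma> m) p) \<le> len m / d"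
        using norm_winding_le[OF m, of p] edge_V[OF m p] by (simp add: d_def)
      thus "norm (winding_number (\<Gamma> m) p * residue F p) \<le> len m / d * (K * exp (- (real m * T)))"
        unfolding norm_mult using K(2)[OF m p] len d by (intro mult_mono) auto
    qed
    also have "\<dots> = real (card (E m)) * (len m / d * (K * exp (- (real m * T))))" by simp
    also have "\<dots> \<le> w m" unfolding w_def
    proof (rule mult_right_mono)
      have "card (E m) \<le> card (edge m)" by (rule card_mono[OF card_edge(1)[OF m] E(1)[OF m]])
      also have "\<dots> \<le> 2 * card V0" by (rule card_edge(2)[OF m])
      finally have "real (card (E m)) \<le> real (2 * card V0)" by (simp only: of_nat_le_iff)
      thus "real (card (E m)) \<le> 2 * real (card V0)" by simp
    qed (use len d K(1) in simp)
    finally show ?thesis .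
  qed
  have "w \<longlonglongrightarrow> 0"
  proof -
    have "(\<lambda>m. 2 * real (card V0) / d * K * ((2 * \<rho> + 2 * M + 2 * L * M + (2 + 2 * T + 2 * L * T) * real m) * exp (- (real m * T)))) \<longlonglongrightarrow>
        2 * real (card V0) / d * K * 0"
      by (intro tendsto_mult_left linear_times_exp_tendsto_0 T)
    moreover have "w = (\<lambda>m. 2 * real (card V0) / d * K * ((2 * \<rho> + 2 * M + 2 * L * M + (2 + 2 * T + 2 * L * T) * real m) * exp (- (real m * T))))"
    proof
      fix m
      have "len m = 2 * \<rho> + 2 * M + 2 * L * M + (2 + 2 * T + 2 * L * T) * real m"
        by (simp add: len_def R_def algebra_simps)
      thus "w m = 2 * real (card V0) / d * K * ((2 * \<rho> + 2 * M + 2 * L * M + (2 + 2 * T + 2 * L * T) * real m) * exp (- (real m * T)))"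
        unfolding w_def by (simp add: mult_ac)
    qed
    ultimately show ?thesis by simp
  qed
  hence err0: "err \<longlonglongrightarrow> 0"
    by (rule Lim_null_comparison[rotated]) (use eventually_large err_le in \<open>auto elim: eventually_mono\<close>)
  \<comment> \<open>Outside the large indices the truncation parameters need not be ordered; any ordered
    pair will do there.\<close>
  define a' b' where "a' = (\<lambda>m. if large m then a m else - real m - 1)" and "b' = (\<lambda>m. if large m then b m else real m)"
  have lima: "filterlim a' at_bot sequentially"
  proof -
    have "filterlim (\<lambda>m. h + M - T * real m) at_bot sequentially"
    proof -
      have "filterlim (\<lambda>m. T * real m) at_top sequentially"
        by (rule filterlim_tendsto_pos_mult_at_top[OF tendsto_const T filterlim_real_sequentially])
      hence "filterlim (\<lambda>m. - (h + M) + T * real m) at_top sequentially"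
        by (rule filterlim_tendsto_add_at_top[OF tendsto_const])
      thus ?thesis by (subst filterlim_uminus_at_bot) (simp add: algebra_simps)
    qed
    moreover have "eventually (\<lambda>m. a' m \<le> h + M - T * real m) sequentially"
      using eventually_large
    proof eventually_elim
      case (elim m)
      thus ?case using a(2)[of m] by (simp add: a'_def abs_le_iff mult.commute)
    qed
    ultimately show ?thesis by (rule filterlim_at_bot_mono)
  qed
  have limb: "filterlim b' at_top sequentially"
  proof -
    have "filterlim (\<lambda>m. h - M + T * real m) at_top sequentially"
      by (rule filterlim_tendsto_add_at_top[OF tendsto_const
          filterlim_tendsto_pos_mult_at_top[OF tendsto_const T filterlim_real_sequentially]])
    moreover have "eventually (\<lambda>m. h - M + T * real m \<le> b' m) sequentially"
      using eventually_large
    proof eventually_elim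
      case (elim m)
      thus ?case using b(2)[of m] by (simp add: b'_def abs_le_iff mult.commute)
    qed
    ultimately show ?thesis by (rule filterlim_at_top_mono)
  qed
  have "a' m < b' m" for m using large_ab[of m] by (simp add: a'_def b'_def)
  from truncated_integrals_tendsto(2)[OF lima limb this]
  have J: "(\<lambda>m. integral {a' m..b' m} (\<lambda>t. F (\<gamma> t) * velocity t)) \<longlonglongrightarrow> J" by (simp add: J_def)
  have "(\<lambda>m. (caps m - integral {a' m..b' m} (\<lambda>t. F (\<gamma> t) * velocity t)) / (2 * pi * \<i>) - err m)
      \<longlonglongrightarrow> (0 - J) / (2 * pi * \<i>) - 0"
    by (intro tendsto_diff tendsto_divide caps_tendsto J err0 tendsto_const) auto
  hence "(\<lambda>m. (caps m - integral {a' m..b' m} (\<lambda>t. F (\<gamma> t) * velocity t)) / (2 * pi * \<i>) - err m)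
      \<longlonglongrightarrow> - (J / (2 * pi * \<i>))" by simp
  moreover have "eventually (\<lambda>m. (caps m - integral {a' m..b' m} (\<lambda>t. F (\<gamma> t) * velocity t)) / (2 * pi * \<i>) - err m
      = (\<Sum>p\<in>right_poles m. residue F p)) sequentially"
    using eventually_large
  proof eventually_elim
    case (elim m)
    have "caps m - integral {a' m..b' m} (\<lambda>t. F (\<gamma> t) * velocity t)
      = 2 * pi * \<i> * ((\<Sum>p\<in>right_poles m. residue F p) + err m)"
      using contour_integral_\<Gamma>[OF elim] E(3)[OF elim] elim by (simp add: a'_def b'_def err_def)
    thus ?case by simp
  qed
  ultimately show ?thesis unfolding J_def by (rule Lim_transform_eventually)
qed

end

context decaying_integrand
begin

theorem contour_integral_residues:
  shows "(\<lambda>t. F (\<gamma> t) * velocity t) integrable_on UNIV"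
    and "(\<lambda>m. \<Sum>p | p \<in> I \<and> is_pole F p \<and> Re p < \<rho> + real m. residue F p)
     \<longlonglongrightarrow> - (integral UNIV (\<lambda>t. F (\<gamma> t) * velocity t) / (2 * pi * \<i>))"
proof -
  show "(\<lambda>t. F (\<gamma> t) * velocity t) integrable_on UNIV"
  proof (rule truncated_integrals_tendsto(1)[of "\<lambda>m. - real m - 1" real])
    show "filterlim (\<lambda>m. - real m - 1) at_bot sequentially"
    proof (rule filterlim_at_bot_mono)
      show "filterlim (\<lambda>m. - real m) at_bot sequentially"
        by (subst filterlim_uminus_at_bot) (simp add: filterlim_real_sequentially)
    qed simp
  qed (auto simp: filterlim_real_sequentially)
  obtain h \<delta> where hd: "0 < h" "h < T" "0 < \<delta>"
    "\<And>p z n. p \<in> V \<Longrightarrow> - M \<le> Re z \<Longrightarrow> Im z = h + of_int n * T \<Longrightarrow> \<delta> \<le> dist p z"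
    by (rule good_heights) blast
  have "\<exists>t. Im (\<gamma> t) = y \<and> \<bar>t - y\<bar> \<le> M" for y using height_attained[of y] by blast
  then obtain \<tau> where tau: "\<And>y. Im (\<gamma> (\<tau> y)) = y" "\<And>y. \<bar>\<tau> y - y\<bar> \<le> M" by metis
  interpret truncated_box \<gamma> M L F V I T H B \<rho> \<epsilon> \<kappa> h \<delta> "\<lambda>m. \<tau> (h - real m * T)" "\<lambda>m. \<tau> (h + real m * T)"
    by unfold_locales (use hd tau in auto)
  show "(\<lambda>m. \<Sum>p | p \<in> I \<and> is_pole F p \<and> Re p < \<rho> + real m. residue F p)
     \<longlonglongrightarrow> - (integral UNIV (\<lambda>t. F (\<gamma> t) * velocity t) / (2 * pi * \<i>))"
    using residue_sums_tendsto unfolding right_poles_def R_def .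
qed

end

section \<open>The Barnes integrand\<close>

lemma eventually_nonzero_entire:
  assumes "f holomorphic_on UNIV" "f \<beta> \<noteq> (0 :: complex)"
  shows "eventually (\<lambda>s. f s \<noteq> 0) (at z)"
proof (cases "f z = 0")
  case True
  obtain r where r: "0 < r" "\<And>w. w \<in> ball z r - {z} \<Longrightarrow> f w \<noteq> 0"
    using isolated_zeros[OF assms(1) open_UNIV connected_UNIV UNIV_I True UNIV_I assms(2)] by metis
  thus ?thesis unfolding eventually_at
    by (intro exI[of _ r]) (auto simp: dist_commute)
next
  case False
  have "continuous_on UNIV f" using assms(1) by (rule holomorphic_on_imp_continuous_on)
  hence "isCont f z" by (simp add: continuous_on_eq_continuous_at)
  thus ?thesis using False by (auto simp: isCont_def intro: tendsto_imp_eventually_ne)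
qed

text \<open>If \<open>f\<close> vanishes as well, the quotient has a limit and the residue is 0, in
  agreement with the formula.\<close>
lemma simple_zero_quotient:
  assumes f: "f analytic_on {p}" and g: "g analytic_on {p}"
    and g0: "g p = 0" "(g has_field_derivative g') (at p)" "g' \<noteq> 0"
  shows "f p = 0 \<Longrightarrow> \<exists>l. (\<lambda>s. f s / g s) \<midarrow>p\<rightarrow> l"
    and "residue (\<lambda>s. f s / g s) p = f p / g'"
proof -
  have lim: "\<exists>l. (\<lambda>s. f s / g s) \<midarrow>p\<rightarrow> l" if "f p = 0"
  proof -
    obtain f' where "(f has_field_derivative f') (at p)"
      using f analytic_on_imp_differentiable_at field_differentiable_def by blast
    hence "((\<lambda>y. (f y - f p) / (y - p)) \<longlongrightarrow> f') (at p)" by (simp add: has_field_derivative_iff)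
    moreover have "((\<lambda>y. (g y - g p) / (y - p)) \<longlongrightarrow> g') (at p)" using g0(2) by (simp add: has_field_derivative_iff)
    ultimately have "((\<lambda>y. ((f y - f p) / (y - p)) / ((g y - g p) / (y - p))) \<longlongrightarrow> f' / g') (at p)"
      using g0(3) by (intro tendsto_divide)
    moreover have "eventually (\<lambda>y. ((f y - f p) / (y - p)) / ((g y - g p) / (y - p)) = f y / g y) (at p)"
      unfolding eventually_at_topological using that g0(1) by (intro exI[of _ UNIV]) auto
    ultimately have "((\<lambda>y. f y / g y) \<longlongrightarrow> f' / g') (at p)" by (rule Lim_transform_eventually)
    thus ?thesis by blast
  qed
  thus "f p = 0 \<Longrightarrow> \<exists>l. (\<lambda>s. f s / g s) \<midarrow>p\<rightarrow> l" .
  show "residue (\<lambda>s. f s / g s) p = f p / g'"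
  proof (cases "f p = 0")
    case True
    then obtain l where l: "(\<lambda>s. f s / g s) \<midarrow>p\<rightarrow> l" using lim by blast
    have "(\<lambda>s. f s / g s) meromorphic_on {p}"
      by (intro meromorphic_intros analytic_on_imp_meromorphic_on f g)
    hence iso: "isolated_singularity_at (\<lambda>s. f s / g s) p" by (rule meromorphic_on_isolated_singularity)
    have "remove_sings (\<lambda>s. f s / g s) analytic_on {p}" by (rule remove_sings_analytic_at[OF iso l])
    then obtain A where "open A" "p \<in> A" "remove_sings (\<lambda>s. f s / g s) holomorphic_on A"
      using analytic_at by blast
    hence "residue (remove_sings (\<lambda>s. f s / g s)) p = 0" by (rule residue_holo)
    thus ?thesis using True iso by simp
  next
    case False
    obtain A where A: "open A" "p \<in> A" "f holomorphic_on A" using f analytic_at by blast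
    obtain A' where A': "open A'" "p \<in> A'" "g holomorphic_on A'" using g analytic_at by blast
    obtain r where r: "0 < r" "ball p r \<subseteq> A \<inter> A'" using A A' open_contains_ball[of "A \<inter> A'"] by blast
    show ?thesis
    proof (rule residue_simple_pole_deriv[where s = "ball p r"])
      show "f holomorphic_on ball p r" "g holomorphic_on ball p r"
        using A A' r holomorphic_on_subset by blast+
    qed (use False r g0 in auto)
  qed
qed

lemma qpow_add: "qpow w (x + y) = qpow w x * qpow w y"
  by (simp add: qpow_def exp_add[symmetric] algebra_simps)

lemma qpow_diff: "qpow w (x - y) = qpow w x / qpow w y"
  by (simp add: qpow_def exp_diff[symmetric] algebra_simps)

lemma qpow_nonzero [simp]: "qpow w x \<noteq> 0"
  by (simp add: qpow_def)

lemma qpow_of_nat: "qpow w (of_nat n) = qpow w 1 ^ n"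
  by (simp add: qpow_def exp_of_nat_mult[symmetric] algebra_simps)

lemma norm_qpow: "norm (qpow w x) = exp (- (w * Re x))"
  by (simp add: qpow_def)

lemma holomorphic_qpow [holomorphic_intros]: "f holomorphic_on S \<Longrightarrow> (\<lambda>s. qpow w (f s)) holomorphic_on S"
  unfolding qpow_def by (intro holomorphic_intros)

lemma qpow_eq_1_iff:
  assumes "w \<noteq> 0"
  shows "qpow w x = 1 \<longleftrightarrow> (\<exists>m. x = 2 * of_real pi * \<i> * of_int m / of_real w)"
proof
  assume "qpow w x = 1"
  hence "Re (of_real w * x) = 0" "\<exists>n::int. Im (of_real w * x) = of_int (2 * n) * pi"
    by (auto simp: qpow_def exp_minus exp_eq_1)
  then obtain n :: int where "Re (of_real w * x) = 0" "Im (of_real w * x) = of_int (2 * n) * pi" by blast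
  hence "of_real w * x = 2 * of_real pi * \<i> * of_int n" by (auto simp: complex_eq_iff)
  thus "\<exists>m. x = 2 * of_real pi * \<i> * of_int m / of_real w"
    using assms by (intro exI[of _ n]) (simp add: field_simps)
next
  assume "\<exists>m. x = 2 * of_real pi * \<i> * of_int m / of_real w"
  then obtain m where "x = 2 * of_real pi * \<i> * of_int m / of_real w" by blast
  hence "of_real w * x = 2 * of_int m * of_real pi * \<i>" using assms by (simp add: mult_ac)
  thus "qpow w x = 1" by (auto simp: qpow_def exp_minus exp_eq_1 intro!: exI[of _ m])
qed

lemma sin_pi_diff_of_nat: "sin (of_real pi * ((x :: complex) - of_nat n)) = (-1) ^ n * sin (of_real pi * x)"
proof (induction n)
  case (Suc n)
  have "of_real pi * (x - of_nat (Suc n)) = of_real pi * (x - of_nat n) - of_real pi"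
    by (simp add: algebra_simps)
  thus ?case using Suc by (simp add: sin_diff sin_of_real cos_of_real)
qed simp

lemma sin_pi_eq_0_iff: "sin (of_real pi * (x :: complex)) = 0 \<longleftrightarrow> (\<exists>n. x = of_int n)"
proof -
  have "sin (of_real pi * x) = 0 \<longleftrightarrow> (\<exists>n::int. of_real pi * x = of_real (of_int n * pi))"
    by (rule Complex_Transcendental.sin_eq_0)
  also have "\<dots> \<longleftrightarrow> (\<exists>n. x = of_int n)"
    by (simp add: field_simps)
  finally show ?thesis .
qed

lemma norm_sin_ge:
  "norm (sin (z :: complex)) \<ge> \<bar>sin (Re z)\<bar>" (is ?A)
  "norm (sin z) \<ge> (exp \<bar>Im z\<bar> - exp (- \<bar>Im z\<bar>)) / 2" (is ?B)
proof -
  have "norm (sin z) ^ 2 = (exp (2 * Im z) + inverse (exp (2 * Im z)) - 2 * cos (2 * Re z)) / 4"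
    by (rule norm_sin_squared)
  moreover have "cos (2 * Re z) = 1 - 2 * sin (Re z) ^ 2"
    by (simp add: cos_double_sin)
  moreover have "exp (2 * Im z) + inverse (exp (2 * Im z)) = (exp \<bar>Im z\<bar> - exp (- \<bar>Im z\<bar>)) ^ 2 + 2"
    by (cases "Im z \<ge> 0") (simp_all add: power2_eq_square algebra_simps exp_add[symmetric] exp_minus[symmetric])
  ultimately have e: "norm (sin z) ^ 2 = ((exp \<bar>Im z\<bar> - exp (- \<bar>Im z\<bar>)) / 2) ^ 2 + \<bar>sin (Re z)\<bar> ^ 2"
    by (simp add: power_divide)
  show ?A by (rule power2_le_imp_le) (simp_all add: e)
  show ?B by (rule power2_le_imp_le) (simp_all add: e)
qed

text \<open>The condition \<open>facs\<close> keeps the increasing sequences, which start at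
  \<open>c\<close> and \<open>d\<close>, away from the decreasing ones; for \<open>d\<close> and
  \<open>g\<close> that already follows from \<open>norm (qpow w (d + g)) < 1\<close>.\<close>
locale barnes_parameters =
  fixes w :: real and a b c d e f g :: complex
  assumes w: "w > 0"
    and norms: "norm (qpow w (c + g)) < 1" "norm (qpow w (d + g)) < 1" "norm (qpow w (c + d + f + g)) < 1"
    and cd: "sin (of_real pi * (c - d)) \<noteq> 0"
    and facs: "qfacs w [a + c, a + d, b + c, b + d, c + f, c + g, d + f] \<noteq> 0"
begin

abbreviation (input) q where "q \<equiv> qpow w 1"

sublocale q_base q
  by unfold_locales (use w in \<open>simp_all add: norm_qpow\<close>)

definition A where "A = qpow w a"
definition B where "B = qpow w b"
definition C where "C = qpow w c"
definition D where "D = qpow w d"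
definition F where "F = qpow w f"
definition G where "G = qpow w g"
definition \<alpha> where "\<alpha> = qpow w e"
lemmas params = A_def B_def C_def D_def F_def G_def \<alpha>_def

definition \<omega> where "\<omega> = 2 * pi / w"

lemma \<omega>_pos: "0 < \<omega>" using w by (simp add: \<omega>_def)

lemma qpow_period: "qpow w (s + \<i> * of_real \<omega>) = qpow w s"
proof -
  have "qpow w (\<i> * of_real \<omega>) = 1"
    using w by (subst qpow_eq_1_iff) (auto intro!: exI[of _ 1] simp: \<omega>_def)
  thus ?thesis by (simp add: qpow_add)
qed

lemma param_nonzero: "A \<noteq> 0" "B \<noteq> 0" "C \<noteq> 0" "D \<noteq> 0" "F \<noteq> 0" "G \<noteq> 0"
  by (simp_all add: params)

lemma small: "norm (C * G) < 1" "norm (D * G) < 1" "norm (C * D * F * G) < 1"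
  using norms unfolding params by (simp_all only: qpow_add)

lemma nz: "qinf (A * C) \<noteq> 0" "qinf (A * D) \<noteq> 0" "qinf (B * C) \<noteq> 0" "qinf (B * D) \<noteq> 0"
      "qinf (F * C) \<noteq> 0" "qinf (F * D) \<noteq> 0" "qinf (G * C) \<noteq> 0" "qinf (G * D) \<noteq> 0"
  using facs qinf_nonzero[OF small(2)] unfolding qfacs_def params by (simp_all add: qpow_add mult.commute)

text \<open>Apart from \<open>ker\<close>, the integrand depends on \<open>s\<close> through \<open>qpow
  w s\<close> only, so \<open>psi\<close> has the period \<open>\<i> * \<omega>\<close>. The decay in
  the vertical direction is due to \<open>ker\<close> alone.\<close>
definition num where "num = Pnum A B C D F G \<alpha>"
definition den where "den = Pden A B F G"
definition psi where "psi s = num (qpow w s) / den (qpow w s)"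
definition ker where "ker s = of_real pi / (sin (of_real pi * (c - s)) * sin (of_real pi * (d - s)))"

lemma qinf_zero_iff: "qinf (qpow w y * qpow w s) = 0 \<longleftrightarrow> s \<in> decreasing_seq w y"
proof -
  have "qinf (qpow w y * qpow w s) = 0 \<longleftrightarrow> (\<exists>k. qpow w (y + s + of_nat k) = 1)"
    by (simp add: qinf_eq_0_iff qpow_add qpow_of_nat)
  also have "\<dots> \<longleftrightarrow> (\<exists>k m. y + s + of_nat k = 2 * of_real pi * \<i> * of_int m / of_real w)"
    using w by (simp add: qpow_eq_1_iff)
  also have "\<dots> \<longleftrightarrow> s \<in> decreasing_seq w y"
    unfolding decreasing_seq_def by (auto simp: algebra_simps intro!: exI)
  finally show ?thesis .
qed

lemma den_zero: "den (qpow w s) = 0 \<Longrightarrow> s \<in> decreasing_seq w a \<union> decreasing_seq w b \<union> decreasing_seq w f \<union> decreasing_seq w g"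
  unfolding den_def Pden_def params by (auto simp: qinf_zero_iff)

lemma holomorphic_num: "h holomorphic_on S \<Longrightarrow> (\<lambda>s. num (h s)) holomorphic_on S"
proof -
  assume h: "h holomorphic_on S"
  have "Nphi A B \<alpha> G (A * B * C * D * F) (C * D * F * G) holomorphic_on UNIV"
    by (rule holomorphic_Nphi_UNIV[OF small(3)])
  hence "(\<lambda>s. Nphi A B \<alpha> G (A * B * C * D * F) (C * D * F * G) (h s)) holomorphic_on S"
    using holomorphic_on_compose[OF h holomorphic_on_subset] by (auto simp: o_def)
  thus ?thesis unfolding num_def Pnum_def using param_nonzero
    by (intro holomorphic_intros h) auto
qed

lemma holomorphic_den: "h holomorphic_on S \<Longrightarrow> (\<lambda>s. den (h s)) holomorphic_on S"
  unfolding den_def Pden_def by (intro holomorphic_intros)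

lemma holomorphic_qpow_id: "qpow w holomorphic_on S"
  using holomorphic_qpow[of "\<lambda>s. s" S w] by (simp add: holomorphic_intros)

lemma psi_analytic: "den (qpow w s) \<noteq> 0 \<Longrightarrow> psi analytic_on {s}"
proof -
  assume s: "den (qpow w s) \<noteq> 0"
  have "(\<lambda>s. num (qpow w s)) analytic_on {s}" "(\<lambda>s. den (qpow w s)) analytic_on {s}"
    using holomorphic_num[OF holomorphic_qpow_id, of UNIV] holomorphic_den[OF holomorphic_qpow_id, of UNIV]
    by (auto intro: holomorphic_on_imp_analytic_at)
  thus ?thesis unfolding psi_def using s by (intro analytic_intros) auto
qed

lemma psi_meromorphic: "psi meromorphic_on S"
proof -
  have "(\<lambda>s. num (qpow w s)) analytic_on S" "(\<lambda>s. den (qpow w s)) analytic_on S"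
    using holomorphic_num[OF holomorphic_qpow_id, of UNIV] holomorphic_den[OF holomorphic_qpow_id, of UNIV]
    by (auto simp: analytic_on_open intro: analytic_on_subset[of _ UNIV])
  thus ?thesis unfolding psi_def by (intro meromorphic_intros analytic_on_imp_meromorphic_on)
qed

lemma psi_period: "psi (s + \<i> * of_real \<omega>) = psi s"
  by (simp add: psi_def qpow_period)

lemma ker_analytic: "sin (of_real pi * (c - s)) \<noteq> 0 \<Longrightarrow> sin (of_real pi * (d - s)) \<noteq> 0 \<Longrightarrow> ker analytic_on {s}"
  unfolding ker_def by (intro analytic_intros) auto

lemma ker_meromorphic: "ker meromorphic_on S"
  unfolding ker_def by (intro meromorphic_intros analytic_on_imp_meromorphic_on analytic_intros)

text \<open>Equal to the given integrand except at the zeros of \<open>qinf (\<alpha> * G * x)\<close>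
  and \<open>qinf (A * B * C * D * F * x)\<close>, where terms of the \<open>3phi2\<close> series have a
  vanishing denominator.\<close>
definition reg where "reg s = psi s * ker s"

lemma reg_meromorphic: "reg meromorphic_on S"
  unfolding reg_def by (intro meromorphic_intros psi_meromorphic ker_meromorphic)

lemma integrand_eq_reg:
  assumes "qinf (\<alpha> * G * qpow w s) \<noteq> 0" "qinf (A * B * C * D * F * qpow w s) \<noteq> 0"
  shows "barnes_integrand w a b c d e f g s = reg s"
proof -
  let ?x = "qpow w s"
  have *: "qpow w (1 - c + s) = q * ?x / C" "qpow w (1 - d + s) = q * ?x / D"
    "qpow w (a + b + c + d + f + s) = A * B * C * D * F * ?x" "qpow w (e + g + s) = \<alpha> * G * ?x"
    "qpow w (a + s) = A * ?x" "qpow w (b + s) = B * ?x" "qpow w (f + s) = F * ?x" "qpow w (g + s) = G * ?x"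
    "qpow w (c + d + f + g) = C * D * F * G" "qpow w e = \<alpha>"
    by (simp_all add: params qpow_add qpow_diff)
  have N: "Nphi A B \<alpha> G (A * B * C * D * F) (C * D * F * G) ?x = qinf (\<alpha> * G * ?x) * qinf (A * B * C * D * F * ?x)
     * phi32 \<alpha> (A * ?x) (B * ?x) (\<alpha> * G * ?x) (A * B * C * D * F * ?x) q (C * D * F * G)"
    by (rule Nphi_eq_phi32[OF small(3) assms])
  show ?thesis
    unfolding barnes_integrand_def qfacs_def list.map prod_list.Cons prod_list.Nil *
      reg_def psi_def ker_def num_def den_def Pnum_def Pden_def N
    by (simp add: mult_ac)
qed

lemma eventually_integrand_eq_reg: "eventually (\<lambda>s. barnes_integrand w a b c d e f g s = reg s) (at z)"
proof -
  have ev: "eventually (\<lambda>s. qinf (y * qpow w s) \<noteq> 0) (at z)" for y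
  proof (rule eventually_nonzero_entire)
    show "(\<lambda>s. qinf (y * qpow w s)) holomorphic_on UNIV"
      by (intro holomorphic_intros)
    define r where "r = ln (norm y + 1) / w + 1"
    have "w * r = ln (norm y + 1) + w" using w by (simp add: r_def field_simps)
    hence "norm (y * qpow w (of_real r)) = norm y * (exp (- w) / (norm y + 1))"
      by (simp add: norm_mult norm_qpow exp_diff exp_minus exp_add divide_inverse add_nonneg_pos)
    also have "\<dots> \<le> norm y * (1 / (norm y + 1))"
      using w by (intro mult_left_mono divide_right_mono) auto
    also have "\<dots> < 1" by (simp add: divide_less_eq add_nonneg_pos)
    finally show "qinf (y * qpow w (of_real r)) \<noteq> 0" by (rule qinf_nonzero)
  qed
  show ?thesis using ev[of "\<alpha> * G"] ev[of "A * B * C * D * F"]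
    by eventually_elim (rule integrand_eq_reg)
qed

text \<open>The version of the integrand with all removable singularities filled in; the residue theorem
  is applied to it.\<close>
definition integrand where "integrand = remove_sings (barnes_integrand w a b c d e f g)"

lemma barnes_meromorphic: "barnes_integrand w a b c d e f g meromorphic_on S"
  using reg_meromorphic[of S] meromorphic_on_cong[OF eventually_integrand_eq_reg refl] by blast

lemma integrand_eq: "integrand = remove_sings reg"
  unfolding integrand_def
  by (intro ext remove_sings_cong eventually_integrand_eq_reg refl)

lemma integrand_nice: "integrand nicely_meromorphic_on UNIV"
  unfolding integrand_def by (rule remove_sings_nicely_meromorphic[OF barnes_meromorphic])

lemma pole_iff: "is_pole integrand p \<longleftrightarrow> is_pole (barnes_integrand w a b c d e f g) p"
  "is_pole integrand p \<longleftrightarrow> is_pole reg p"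
proof -
  show "is_pole integrand p \<longleftrightarrow> is_pole (barnes_integrand w a b c d e f g) p"
    unfolding integrand_def by (rule is_pole_remove_sings_iff[OF meromorphic_on_isolated_singularity[OF barnes_meromorphic]])
  show "is_pole integrand p \<longleftrightarrow> is_pole reg p"
    unfolding integrand_eq by (rule is_pole_remove_sings_iff[OF meromorphic_on_isolated_singularity[OF reg_meromorphic]])
qed

lemma residue_eq: "residue integrand p = residue reg p"
  unfolding integrand_eq by (rule residue_remove_sings[OF meromorphic_on_isolated_singularity[OF reg_meromorphic]])

section \<open>Decay of the integrand\<close>

text \<open>As \<open>Re s\<close> tends to infinity, \<open>x = qpow w s\<close> tends to 0; there the
  denominator tends to 1, and the numerator carries the explicit factor \<open>x\<close>.\<close>
lemma psi_right_bound:
  obtains \<beta> K where "0 \<le> K" "\<And>s. \<beta> \<le> Re s \<Longrightarrow> den (qpow w s) \<noteq> 0"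
    "\<And>s. \<beta> \<le> Re s \<Longrightarrow> norm (psi s) \<le> K * exp (- (w * Re s))"
proof -
  \<comment> \<open>For \<open>norm x \<le> r\<close> the four products in the denominator have arguments
    inside the unit disc.\<close>
  define r where "r = 1 / (norm A + norm B + norm F + norm G + 1)"
  have pos: "0 < norm A + norm B + norm F + norm G + 1" by (intro add_nonneg_pos) auto
  hence r: "0 < r" by (simp add: r_def)
  have small_arg: "norm (y * x) < 1" if "norm x \<le> r" "norm y < norm A + norm B + norm F + norm G + 1" for x y :: complex
  proof -
    have "norm (y * x) \<le> norm y * r" unfolding norm_mult using that(1) by (intro mult_left_mono) auto
    also have "\<dots> < (norm A + norm B + norm F + norm G + 1) * r" using that(2) r by (intro mult_strict_right_mono) auto
    also have "\<dots> = 1" using pos by (simp add: r_def)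
    finally show ?thesis .
  qed
  have den: "den x \<noteq> 0" if "norm x \<le> r" for x
  proof -
    have "norm y < norm A + norm B + norm F + norm G + 1 \<Longrightarrow> qinf (y * x) \<noteq> 0" for y
      by (rule qinf_nonzero[OF small_arg[OF that]])
    moreover have "norm A < norm A + norm B + norm F + norm G + 1" "norm B < norm A + norm B + norm F + norm G + 1"
      "norm F < norm A + norm B + norm F + norm G + 1" "norm G < norm A + norm B + norm F + norm G + 1"
      using norm_ge_zero[of A] norm_ge_zero[of B] norm_ge_zero[of F] norm_ge_zero[of G] by linarith+
    ultimately show ?thesis unfolding den_def Pden_def by simp
  qed
  define h where "h = (\<lambda>x. qinf (q * x / C) * qinf (q * x / D) * Nphi A B \<alpha> G (A * B * C * D * F) (C * D * F * G) x / den x)"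
  have "h holomorphic_on {x. den x \<noteq> 0}"
    unfolding h_def using param_nonzero
    by (intro holomorphic_intros holomorphic_den holomorphic_on_subset[OF holomorphic_Nphi_UNIV[OF small(3)]]) auto
  hence "continuous_on (cball 0 r) h"
    by (rule continuous_on_subset[OF holomorphic_on_imp_continuous_on]) (use den in auto)
  hence "bounded (h ` cball 0 r)"
    by (intro compact_imp_bounded compact_continuous_image) auto
  then obtain K where K: "\<And>x. x \<in> cball 0 r \<Longrightarrow> norm (h x) \<le> K" unfolding bounded_iff by blast
  define \<beta> where "\<beta> = - ln r / w"
  have x: "norm (qpow w s) \<le> r" if "\<beta> \<le> Re s" for s
  proof -
    have "- ln r \<le> w * Re s" using that w by (simp add: \<beta>_def field_simps)
    hence "exp (- (w * Re s)) \<le> exp (ln r)" by simp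
    thus ?thesis using r by (simp add: norm_qpow)
  qed
  show thesis
  proof (rule that[of "\<bar>K\<bar>" \<beta>])
    fix s assume s: "\<beta> \<le> Re s"
    show "den (qpow w s) \<noteq> 0" by (rule den[OF x[OF s]])
    have "psi s = qpow w s * h (qpow w s)" by (simp add: psi_def h_def num_def Pnum_def)
    hence "norm (psi s) = exp (- (w * Re s)) * norm (h (qpow w s))" by (simp add: norm_mult norm_qpow)
    also have "\<dots> \<le> exp (- (w * Re s)) * \<bar>K\<bar>" using K[of "qpow w s"] x[OF s] by (intro mult_left_mono) auto
    finally show "norm (psi s) \<le> \<bar>K\<bar> * exp (- (w * Re s))" by (simp add: mult.commute)
  qed simp
qed

lemma sin_pi_Im_bound:
  assumes "\<bar>Im y\<bar> + 1 \<le> \<bar>Im s\<bar>"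
  shows "1 / 4 * exp (\<bar>Im s\<bar> - \<bar>Im y\<bar>) \<le> norm (sin (of_real pi * (y - s)))"
proof -
  define u where "u = \<bar>Im (of_real pi * (y - s))\<bar>"
  have "\<bar>Im s\<bar> - \<bar>Im y\<bar> \<le> \<bar>Im (y - s)\<bar>" by simp
  also have "\<dots> \<le> pi * \<bar>Im (y - s)\<bar>" using pi_gt3 mult_right_mono[of 1 pi "\<bar>Im (y - s)\<bar>"] by simp
  also have "\<dots> = u" by (simp add: u_def abs_mult)
  finally have u: "\<bar>Im s\<bar> - \<bar>Im y\<bar> \<le> u" .
  hence "1 \<le> u" using assms by simp
  hence "exp (- u) \<le> 1" "2 \<le> exp u" using exp_ge_add_one_self[of u] by (simp, linarith)
  moreover have "1 / 4 * x \<le> (x - y) / 2" if "y \<le> 1" "2 \<le> x" for x y :: real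
    using that by (simp add: field_simps)
  ultimately have "1 / 4 * exp u \<le> (exp u - exp (- u)) / 2" by blast
  also have "\<dots> \<le> norm (sin (of_real pi * (y - s)))" unfolding u_def by (rule norm_sin_ge(2))
  finally have "1 / 4 * exp u \<le> norm (sin (of_real pi * (y - s)))" .
  moreover have "exp (\<bar>Im s\<bar> - \<bar>Im y\<bar>) \<le> exp u" using u by simp
  ultimately show ?thesis by linarith
qed

text \<open>One sine supplies the exponential decay; for the other a constant lower bound is
  enough.\<close>
lemma ker_bound:
  assumes "\<bar>Im c\<bar> + \<bar>Im d\<bar> + 1 \<le> \<bar>Im s\<bar>"
  shows "norm (ker s) \<le> 16 * pi * exp \<bar>Im c\<bar> * exp (- \<bar>Im s\<bar>)"
    "sin (of_real pi * (c - s)) \<noteq> 0" "sin (of_real pi * (d - s)) \<noteq> 0"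
proof -
  have c: "1 / 4 * exp (\<bar>Im s\<bar> - \<bar>Im c\<bar>) \<le> norm (sin (of_real pi * (c - s)))"
    by (rule sin_pi_Im_bound) (use assms in auto)
  have "1 / 4 * exp (\<bar>Im s\<bar> - \<bar>Im d\<bar>) \<le> norm (sin (of_real pi * (d - s)))"
    by (rule sin_pi_Im_bound) (use assms in auto)
  moreover have "1 \<le> exp (\<bar>Im s\<bar> - \<bar>Im d\<bar>)" using assms by simp
  ultimately have d: "1 / 4 \<le> norm (sin (of_real pi * (d - s)))" by linarith
  have p: "0 < 1 / 4 * exp (\<bar>Im s\<bar> - \<bar>Im c\<bar>)" by simp
  show "sin (of_real pi * (c - s)) \<noteq> 0" "sin (of_real pi * (d - s)) \<noteq> 0" using c d p by auto
  have "norm (ker s) = pi / (norm (sin (of_real pi * (c - s))) * norm (sin (of_real pi * (d - s))))"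
    by (simp add: ker_def norm_divide norm_mult)
  also have "\<dots> \<le> pi / (1 / 4 * exp (\<bar>Im s\<bar> - \<bar>Im c\<bar>) * (1 / 4))"
    by (intro divide_left_mono mult_mono c d mult_pos_pos order_less_le_trans[OF p c] order_less_le_trans[OF _ d]) auto
  also have "\<dots> = 16 * pi * exp \<bar>Im c\<bar> * exp (- \<bar>Im s\<bar>)"
    by (simp add: exp_diff exp_minus field_simps)
  finally show "norm (ker s) \<le> 16 * pi * exp \<bar>Im c\<bar> * exp (- \<bar>Im s\<bar>)" .
qed

definition V where "V = {p. is_pole psi p}"

lemma V_discrete: "\<not> z islimpt V"
  unfolding V_def by (rule not_islimpt_poles[OF meromorphic_on_isolated_singularity[OF psi_meromorphic]])

lemma V_periodic: "p + \<i> * of_real \<omega> \<in> V \<longleftrightarrow> p \<in> V"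
proof -
  have "(psi \<circ> (+) (\<i> * of_real \<omega>)) = psi"
    using psi_period by (auto simp: o_def add.commute)
  thus ?thesis unfolding V_def using is_pole_shift_iff[of psi "\<i> * of_real \<omega>" p] by (simp add: add.commute)
qed

lemma den_nonzero_not_V: "den (qpow w p) \<noteq> 0 \<Longrightarrow> p \<notin> V"
  unfolding V_def using psi_analytic analytic_at_imp_no_pole by blast

lemma pole_iff_V:
  assumes "\<bar>Im c\<bar> + \<bar>Im d\<bar> + 1 \<le> \<bar>Im p\<bar>"
  shows "is_pole integrand p \<longleftrightarrow> p \<in> V"
proof -
  note k = ker_bound(2,3)[OF assms]
  have "ker analytic_on {p}" by (rule ker_analytic[OF k])
  moreover have "ker p \<noteq> 0" using k by (simp add: ker_def)
  ultimately show ?thesis unfolding pole_iff(2) V_def mem_Collect_eq reg_def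
    by (rule is_pole_mult_analytic_nonzero2_iff)
qed

definition psi_reg where "psi_reg = remove_sings psi"

lemma psi_reg_period: "psi_reg (s + of_int n * (\<i> * of_real \<omega>)) = psi_reg s"
proof -
  have "psi_reg (s + \<i> * of_real \<omega>) = psi_reg s" for s
  proof -
    have "psi_reg (s + \<i> * of_real \<omega>) = remove_sings (\<lambda>u. psi (s + \<i> * of_real \<omega> + u)) 0"
      unfolding psi_reg_def by (rule remove_sings_shift_0)
    also have "(\<lambda>u. psi (s + \<i> * of_real \<omega> + u)) = (\<lambda>u. psi (s + u))"
    proof
      fix u show "psi (s + \<i> * of_real \<omega> + u) = psi (s + u)"
        using psi_period[of "s + u"] by (simp add: add_ac)
    qed
    also have "remove_sings (\<lambda>u. psi (s + u)) 0 = psi_reg s"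
      unfolding psi_reg_def by (rule remove_sings_shift_0[symmetric])
    finally show ?thesis .
  qed
  hence "s + \<i> * of_real \<omega> \<in> {u. psi_reg u = v} \<longleftrightarrow> s \<in> {u. psi_reg u = v}" for s v by simp
  from shift_by_int[of "\<i> * of_real \<omega>" "{u. psi_reg u = psi_reg s}", OF this, of s n]
  show ?thesis by simp
qed

text \<open>Far to the right this is \<open>psi_right_bound\<close>; elsewhere translation by a period
  moves \<open>s\<close> into a compact rectangle, from which the discs around the poles have been
  removed.\<close>
lemma psi_reg_bound:
  assumes "0 < \<delta>"
  obtains K where "0 \<le> K" "\<And>s. - N \<le> Re s \<Longrightarrow> (\<And>p. p \<in> V \<Longrightarrow> \<delta> \<le> dist p s) \<Longrightarrow> norm (psi_reg s) \<le> K"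
proof -
  obtain \<beta> K1 where b: "0 \<le> K1" "\<And>s. \<beta> \<le> Re s \<Longrightarrow> den (qpow w s) \<noteq> 0"
    "\<And>s. \<beta> \<le> Re s \<Longrightarrow> norm (psi s) \<le> K1 * exp (- (w * Re s))" by (rule psi_right_bound) blast
  define S where "S = cbox (Complex (- N) 0) (Complex \<beta> \<omega>) \<inter> (\<Inter>p\<in>V. {s. \<delta> \<le> dist p s})"
  have "compact S" unfolding S_def
    by (intro compact_Int_closed compact_cbox closed_INT ballI closed_Collect_le continuous_intros)
  moreover have "continuous_on S psi_reg"
  proof -
    have nice: "psi_reg nicely_meromorphic_on UNIV"
      unfolding psi_reg_def by (rule remove_sings_nicely_meromorphic[OF psi_meromorphic])
    have "isCont psi_reg s" if "s \<in> S" for s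
    proof -
      have "s \<notin> V" using that assms by (force simp: S_def)
      hence "\<not> is_pole psi_reg s"
        unfolding psi_reg_def V_def using is_pole_remove_sings_iff[OF meromorphic_on_isolated_singularity[OF psi_meromorphic]] by simp
      from nicely_meromorphic_on_imp_analytic_at[OF nice UNIV_I this] show ?thesis
        by (rule analytic_at_imp_isCont)
    qed
    thus ?thesis by (intro continuous_at_imp_continuous_on) auto
  qed
  ultimately have "bounded (psi_reg ` S)" by (intro compact_imp_bounded compact_continuous_image)
  then obtain K2 where K2: "\<And>s. s \<in> S \<Longrightarrow> norm (psi_reg s) \<le> K2" unfolding bounded_iff by blast
  show thesis
  proof (rule that[of "K1 * exp (- (w * \<beta>)) + \<bar>K2\<bar>"])
    fix s assume s: "- N \<le> Re s" "\<And>p. p \<in> V \<Longrightarrow> \<delta> \<le> dist p s"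
    show "norm (psi_reg s) \<le> K1 * exp (- (w * \<beta>)) + \<bar>K2\<bar>"
    proof (cases "\<beta> \<le> Re s")
      case True
      have "psi_reg s = psi s"
        unfolding psi_reg_def by (rule remove_sings_at_analytic[OF psi_analytic[OF b(2)[OF True]]])
      hence "norm (psi_reg s) \<le> K1 * exp (- (w * Re s))" using b(3)[OF True] by simp
      also have "\<dots> \<le> K1 * exp (- (w * \<beta>))" using True w b(1) by (intro mult_left_mono) auto
      finally show ?thesis by simp
    next
      case False
      define n where "n = \<lfloor>Im s / \<omega>\<rfloor>"
      define s' where "s' = s + of_int (- n) * (\<i> * of_real \<omega>)"
      have Im: "Im s' = Im s - of_int n * \<omega>" "Re s' = Re s" by (simp_all add: s'_def)
      have "of_int n \<le> Im s / \<omega>" "Im s / \<omega> < of_int n + 1" unfolding n_def by linarith+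
      hence "0 \<le> Im s'" "Im s' \<le> \<omega>" using \<omega>_pos unfolding Im by (simp_all add: field_simps)
      moreover have "\<delta> \<le> dist p s'" if "p \<in> V" for p
      proof -
        have "p + of_int n * (\<i> * of_real \<omega>) \<in> V" using that by (simp only: shift_by_int[OF V_periodic])
        from s(2)[OF this] show ?thesis by (simp add: s'_def dist_norm algebra_simps)
      qed
      ultimately have "s' \<in> S" using s(1) False by (auto simp: S_def in_cbox_complex_iff Im)
      hence "norm (psi_reg s') \<le> K2" by (rule K2)
      moreover have "psi_reg s' = psi_reg s" unfolding s'_def by (rule psi_reg_period)
      ultimately have "norm (psi_reg s) \<le> K2" by simp
      moreover have "0 \<le> K1 * exp (- (w * \<beta>))" using b(1) by simp
      ultimately show ?thesis by linarith
    qed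
  qed (use b(1) in simp)
qed

lemma integrand_decay:
  assumes "0 < \<delta>"
  shows "\<exists>K. \<forall>s. - N \<le> Re s \<longrightarrow> \<bar>Im c\<bar> + \<bar>Im d\<bar> + 1 \<le> \<bar>Im s\<bar> \<longrightarrow>
        (\<forall>p\<in>V. \<delta> \<le> dist p s) \<longrightarrow> norm (integrand s) \<le> K * exp (- \<bar>Im s\<bar>)"
proof -
  obtain K where K: "0 \<le> K" "\<And>s. - N \<le> Re s \<Longrightarrow> (\<And>p. p \<in> V \<Longrightarrow> \<delta> \<le> dist p s) \<Longrightarrow> norm (psi_reg s) \<le> K"
    by (rule psi_reg_bound[OF assms]) blast
  have "norm (integrand s) \<le> K * (16 * pi * exp \<bar>Im c\<bar>) * exp (- \<bar>Im s\<bar>)"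
    if s: "- N \<le> Re s" "\<bar>Im c\<bar> + \<bar>Im d\<bar> + 1 \<le> \<bar>Im s\<bar>" "\<And>p. p \<in> V \<Longrightarrow> \<delta> \<le> dist p s" for s
  proof -
    have "s \<notin> V" using s(3)[of s] assms by auto
    hence np: "\<not> is_pole psi s" by (simp add: V_def)
    have "isolated_singularity_at psi s" "not_essential psi s"
      using psi_meromorphic meromorphic_on_isolated_singularity meromorphic_on_not_essential by blast+
    with np obtain l where l: "psi \<midarrow>s\<rightarrow> l" unfolding not_essential_def by blast
    have "ker \<midarrow>s\<rightarrow> ker s"
      using analytic_at_imp_isCont[OF ker_analytic[OF ker_bound(2,3)[OF s(2)]]] by (simp add: isCont_def)
    with l have "reg \<midarrow>s\<rightarrow> l * ker s" unfolding reg_def by (rule tendsto_mult)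
    hence "integrand s = l * ker s" unfolding integrand_eq by (rule remove_sings_eqI)
    moreover have "psi_reg s = l" unfolding psi_reg_def using l by (rule remove_sings_eqI)
    ultimately have "norm (integrand s) = norm (psi_reg s) * norm (ker s)" by (simp add: norm_mult)
    also have "\<dots> \<le> K * (16 * pi * exp \<bar>Im c\<bar> * exp (- \<bar>Im s\<bar>))"
      using K s by (intro mult_mono ker_bound(1)) auto
    finally show ?thesis by (simp add: mult.assoc)
  qed
  thus ?thesis by blast
qed

text \<open>The line must avoid the real parts of all zeros of the two sines. On a line that does, the
  sines are bounded below by their values at the real part, and this bound is the same for all
  translates by integers.\<close>
lemma increasing_vertical:
  obtains \<rho> K where "\<rho>0 \<le> \<rho>" "\<And>m y. \<not> is_pole integrand (Complex (\<rho> + real m) y)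
        \<and> norm (integrand (Complex (\<rho> + real m) y)) \<le> K * exp (- (w * real m))"
proof -
  obtain \<beta> K1 where b: "0 \<le> K1" "\<And>s. \<beta> \<le> Re s \<Longrightarrow> den (qpow w s) \<noteq> 0"
    "\<And>s. \<beta> \<le> Re s \<Longrightarrow> norm (psi s) \<le> K1 * exp (- (w * Re s))" by (rule psi_right_bound) blast
  define r0 where "r0 = max \<rho>0 \<beta>"
  define X where "X = range (\<lambda>n::int. Re c - of_int n) \<union> range (\<lambda>n::int. Re d - of_int n)"
  have "countable X" unfolding X_def by (intro countable_Un countable_image countableI_type)
  moreover have "uncountable {r0<..<r0 + 1}" by (simp add: uncountable_open_interval)
  ultimately have "\<not> {r0<..<r0 + 1} \<subseteq> X" using countable_subset[of "{r0<..<r0 + 1}" X] by blast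
  then obtain \<rho> where rho: "\<rho> \<in> {r0<..<r0 + 1}" "\<rho> \<notin> X" by blast
  have sn: "sin (pi * (Re y - \<rho>)) \<noteq> 0" if "\<rho> \<notin> range (\<lambda>n::int. Re y - of_int n)" for y
  proof
    assume "sin (pi * (Re y - \<rho>)) = 0"
    then obtain n :: int where "pi * (Re y - \<rho>) = of_int n * pi" by (auto simp: sin_zero_iff_int2)
    hence "\<rho> = Re y - of_int n" by simp
    thus False using that by blast
  qed
  define \<sigma> where "\<sigma> = (\<lambda>y. \<bar>sin (pi * (Re y - \<rho>))\<bar>)"
  have sig: "0 < \<sigma> c" "0 < \<sigma> d" using sn rho(2) by (simp_all add: \<sigma>_def X_def)
  have lower: "\<sigma> y \<le> norm (sin (of_real pi * (y - Complex (\<rho> + real m) t)))" for y m t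
  proof -
    have "sin (of_real pi * (y - Complex (\<rho> + real m) t)) = (-1) ^ m * sin (of_real pi * (y - Complex \<rho> t))"
    proof -
      have "y - Complex (\<rho> + real m) t = (y - Complex \<rho> t) - of_nat m" by (simp add: complex_eq_iff)
      thus ?thesis by (simp only: sin_pi_diff_of_nat)
    qed
    hence "norm (sin (of_real pi * (y - Complex (\<rho> + real m) t))) = norm (sin (of_real pi * (y - Complex \<rho> t)))"
      by (simp add: norm_mult norm_power)
    moreover have "\<sigma> y \<le> norm (sin (of_real pi * (y - Complex \<rho> t)))"
      using norm_sin_ge(1)[of "of_real pi * (y - Complex \<rho> t)"] by (simp add: \<sigma>_def)
    ultimately show ?thesis by simp
  qed
  show thesis
  proof (rule that[of \<rho> "K1 * (pi / (\<sigma> c * \<sigma> d)) * exp (- (w * \<rho>))"])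
    fix m y
    show "\<not> is_pole integrand (Complex (\<rho> + real m) y) \<and>
      norm (integrand (Complex (\<rho> + real m) y)) \<le> K1 * (pi / (\<sigma> c * \<sigma> d)) * exp (- (w * \<rho>)) * exp (- (w * real m))"
    proof
    define s where "s = Complex (\<rho> + real m) y"
    have s: "\<beta> \<le> Re s" using rho(1) by (simp add: s_def r0_def)
    have sc: "\<sigma> c \<le> norm (sin (of_real pi * (c - s)))" and sd: "\<sigma> d \<le> norm (sin (of_real pi * (d - s)))"
      unfolding s_def by (rule lower)+
    hence ne: "sin (of_real pi * (c - s)) \<noteq> 0" "sin (of_real pi * (d - s)) \<noteq> 0" using sig by auto
    have ana: "reg analytic_on {s}"
      unfolding reg_def by (intro analytic_intros psi_analytic ker_analytic b(2)[OF s] ne)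
    thus "\<not> is_pole integrand (Complex (\<rho> + real m) y)"
      unfolding pole_iff(2) s_def[symmetric] by (rule analytic_at_imp_no_pole)
    have "integrand s = reg s" unfolding integrand_eq by (rule remove_sings_at_analytic[OF ana])
    hence "norm (integrand s) = norm (psi s) * (pi / (norm (sin (of_real pi * (c - s))) * norm (sin (of_real pi * (d - s)))))"
      by (simp add: reg_def ker_def norm_mult norm_divide)
    also have "\<dots> \<le> (K1 * exp (- (w * Re s))) * (pi / (\<sigma> c * \<sigma> d))"
    proof (intro mult_mono b(3)[OF s] divide_left_mono sc sd)
      show "0 < norm (sin (of_real pi * (c - s))) * norm (sin (of_real pi * (d - s))) * (\<sigma> c * \<sigma> d)"
        using ne sig by simp
    qed (use sig b(1) in auto)
    also have "\<dots> = K1 * (pi / (\<sigma> c * \<sigma> d)) * exp (- (w * \<rho>)) * exp (- (w * real m))"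
      by (simp add: s_def exp_add[symmetric] algebra_simps)
    finally show "norm (integrand (Complex (\<rho> + real m) y)) \<le> K1 * (pi / (\<sigma> c * \<sigma> d)) * exp (- (w * \<rho>)) * exp (- (w * real m))"
      unfolding s_def .
    qed
  qed (use rho(1) in \<open>simp add: r0_def\<close>)
qed

section \<open>Poles and residues\<close>

text \<open>The factor \<open>qinf (q * x / C)\<close> of the numerator vanishes for \<open>x = C / q ^
  Suc k\<close>, and similarly with \<open>D\<close>. These zeros cancel the zeros of the sines to the
  left of \<open>c\<close> and \<open>d\<close>.\<close>
lemma psi_zero_below: "psi (c - of_nat (Suc k)) = 0" "psi (d - of_nat (Suc k)) = 0"
proof -
  have z: "qinf (q * qpow w (y - of_nat (Suc k)) / qpow w y) = 0" for y
  proof -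
    have "q * qpow w (y - of_nat (Suc k)) / qpow w y * q ^ k = 1"
      by (simp add: qpow_diff qpow_of_nat[of w "Suc k", simplified])
    thus ?thesis unfolding qinf_eq_0_iff by blast
  qed
  show "psi (c - of_nat (Suc k)) = 0" "psi (d - of_nat (Suc k)) = 0"
    unfolding psi_def num_def Pnum_def using z[of c] z[of d] by (simp_all only: C_def D_def) simp_all
qed

lemma reg_quotient:
  "reg = (\<lambda>s. (psi s * (of_real pi / sin (of_real pi * (d - s)))) / sin (of_real pi * (c - s)))"
  "reg = (\<lambda>s. (psi s * (of_real pi / sin (of_real pi * (c - s)))) / sin (of_real pi * (d - s)))"
  unfolding reg_def ker_def by (auto simp: mult.commute)

lemma sin_integer_shift:
  fixes y y' p :: complex
  assumes "y - p = of_int n" "sin (of_real pi * (y' - y)) \<noteq> 0"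
  shows "sin (of_real pi * (y' - p)) \<noteq> 0"
proof
  assume "sin (of_real pi * (y' - p)) = 0"
  then obtain m where "y' - p = of_int m" by (auto simp: sin_pi_eq_0_iff)
  hence "y' - y = of_int (m - n)" using assms(1) by (simp add: algebra_simps)
  thus False using assms(2) sin_pi_eq_0_iff by blast
qed

lemma simple_zero_at_integer:
  assumes "y - p = of_int n" "psi analytic_on {p}" "sin (of_real pi * (y' - y)) \<noteq> 0"
  defines "u \<equiv> \<lambda>s. psi s * (of_real pi / sin (of_real pi * (y' - s)))"
    and "v \<equiv> \<lambda>s. sin (of_real pi * (y - s))"
  shows "psi p = 0 \<Longrightarrow> \<exists>l. (\<lambda>s. u s / v s) \<midarrow>p\<rightarrow> l"
    and "residue (\<lambda>s. u s / v s) p = u p / (- of_real pi * cos (of_real pi * (y - p)))"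
proof -
  have ne: "sin (of_real pi * (y' - p)) \<noteq> 0" by (rule sin_integer_shift[OF assms(1,3)])
  have u: "u analytic_on {p}" unfolding u_def by (intro analytic_intros assms(2)) (use ne in auto)
  have v: "v analytic_on {p}" unfolding v_def by (intro analytic_intros)
  have v0: "v p = 0" unfolding v_def sin_pi_eq_0_iff using assms(1) by blast
  have v': "(v has_field_derivative - of_real pi * cos (of_real pi * (y - p))) (at p)"
    unfolding v_def by (auto intro!: derivative_eq_intros)
  have "cos (of_real pi * (y - p)) \<noteq> 0"
    using v0 sin_cos_squared_add[of "of_real pi * (y - p)"] by (auto simp: v_def)
  hence ne': "- of_real pi * cos (of_real pi * (y - p)) \<noteq> 0" by simp
  show "psi p = 0 \<Longrightarrow> \<exists>l. (\<lambda>s. u s / v s) \<midarrow>p\<rightarrow> l"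
    by (rule simple_zero_quotient(1)[OF u v v0 v' ne']) (simp add: u_def)
  show "residue (\<lambda>s. u s / v s) p = u p / (- of_real pi * cos (of_real pi * (y - p)))"
    by (rule simple_zero_quotient(2)[OF u v v0 v' ne'])
qed

lemma sin_dc: "sin (of_real pi * (d - c)) \<noteq> 0" "sin (of_real pi * (d - c)) = - sin (of_real pi * (c - d))"
proof -
  have "of_real pi * (d - c) = - (of_real pi * (c - d))" by (simp add: algebra_simps)
  hence "sin (of_real pi * (d - c)) = sin (- (of_real pi * (c - d)))" by (rule arg_cong)
  thus "sin (of_real pi * (d - c)) = - sin (of_real pi * (c - d))" by (simp only: sin_minus)
  thus "sin (of_real pi * (d - c)) \<noteq> 0" using cd by simp
qed

text \<open>Where the denominator does not vanish, a pole can only come from a sine, and the zeros of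
  the numerator leave just the nodes \<open>c + n\<close> and \<open>d + n\<close>.\<close>
lemma pole_location:
  assumes "is_pole integrand p" "den (qpow w p) \<noteq> 0"
  shows "p \<in> increasing_seq c \<union> increasing_seq d"
proof (rule ccontr)
  assume np: "p \<notin> increasing_seq c \<union> increasing_seq d"
  have ana: "psi analytic_on {p}" by (rule psi_analytic[OF assms(2)])
  have pole: "is_pole reg p" using assms(1) pole_iff(2) by simp
  have below: "\<exists>k. p = y - of_nat (Suc k)" if "y - p = of_int n" "p \<notin> increasing_seq y" for y n
  proof -
    have "0 < n"
    proof (rule ccontr)
      assume "\<not> 0 < n"
      hence "p = y + of_nat (nat (- n))" using that(1) by (simp add: algebra_simps)
      thus False using that(2) by (auto simp: increasing_seq_def)
    qed
    hence "of_int n = (of_nat (Suc (nat (n - 1))) :: complex)" by (simp add: of_nat_nat)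
    thus ?thesis using that(1) by (intro exI[of _ "nat (n - 1)"]) (simp add: algebra_simps)
  qed
  have no_lim: "\<not> (\<exists>l. reg \<midarrow>p\<rightarrow> l)"
    using pole unfolding is_pole_def using not_tendsto_and_filterlim_at_infinity[of "at p" reg] by auto
  consider "sin (of_real pi * (c - p)) \<noteq> 0" "sin (of_real pi * (d - p)) \<noteq> 0"
    | "sin (of_real pi * (c - p)) = 0" | "sin (of_real pi * (d - p)) = 0" by blast
  thus False
  proof cases
    case 1
    have "reg analytic_on {p}" unfolding reg_def by (intro analytic_intros ana ker_analytic 1)
    thus False using pole analytic_at_imp_no_pole by blast
  next
    case 2
    then obtain n where n: "c - p = of_int n" by (auto simp: sin_pi_eq_0_iff)
    then obtain k where "p = c - of_nat (Suc k)" using below[of c n] np by blast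
    hence "psi p = 0" using psi_zero_below(1) by simp
    from simple_zero_at_integer(1)[OF n ana sin_dc(1) this] no_lim show False unfolding reg_quotient(1) by simp
  next
    case 3
    then obtain n where n: "d - p = of_int n" by (auto simp: sin_pi_eq_0_iff)
    then obtain k where "p = d - of_nat (Suc k)" using below[of d n] np by blast
    hence "psi p = 0" using psi_zero_below(2) by simp
    from simple_zero_at_integer(1)[OF n ana cd this] no_lim show False unfolding reg_quotient(2) by simp
  qed
qed

lemma den_at_nodes: "den (qpow w (c + of_nat n)) \<noteq> 0" "den (qpow w (d + of_nat n)) \<noteq> 0"
proof -
  have "den (C * q ^ n) \<noteq> 0" "den (D * q ^ n) \<noteq> 0"
    unfolding den_def Pden_def using nz qinf_shift_nonzero by (simp_all add: mult.assoc[symmetric])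
  thus "den (qpow w (c + of_nat n)) \<noteq> 0" "den (qpow w (d + of_nat n)) \<noteq> 0"
    by (simp_all add: qpow_add qpow_of_nat C_def D_def)
qed

text \<open>The factors \<open>(-1) ^ n\<close> from the derivative of one sine and from the value of
  the other one cancel.\<close>
lemma residue_at_node:
  assumes "den (qpow w (y + of_nat n)) \<noteq> 0" "sin (of_real pi * (y' - y)) \<noteq> 0"
    and reg: "reg = (\<lambda>s. (psi s * (of_real pi / sin (of_real pi * (y' - s)))) / sin (of_real pi * (y - s)))"
  shows "residue integrand (y + of_nat n) = - (psi (y + of_nat n) / sin (of_real pi * (y' - y)))"
proof -
  define p where "p = y + of_nat n"
  have yp: "y - p = of_int (- int n)" by (simp add: p_def)
  have ana: "psi analytic_on {p}" unfolding p_def by (rule psi_analytic[OF assms(1)])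
  have "residue integrand p = (psi p * (of_real pi / sin (of_real pi * (y' - p)))) / (- of_real pi * cos (of_real pi * (y - p)))"
    unfolding residue_eq reg by (rule simple_zero_at_integer(2)[OF yp ana assms(2)])
  moreover have "sin (of_real pi * (y' - p)) = (-1) ^ n * sin (of_real pi * (y' - y))"
    unfolding p_def using sin_pi_diff_of_nat[of "y' - y" n] by (simp add: algebra_simps)
  moreover have "cos (of_real pi * (y - p)) = (-1) ^ n"
  proof -
    have "of_real pi * (y - p) = of_real (- (real n * pi))" by (simp add: p_def)
    hence "cos (of_real pi * (y - p)) = of_real (cos (real n * pi))" by (simp only: cos_of_real) simp
    thus ?thesis by (simp add: cos_npi)
  qed
  moreover have "((-1) ^ n * (-1) ^ n :: complex) = 1" by (simp add: power_mult_distrib[symmetric])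
  ultimately show ?thesis unfolding p_def[symmetric] using assms(2)
    by (cases "even n") (simp_all add: field_simps)
qed

lemma residue_zero: "\<not> is_pole integrand p \<Longrightarrow> residue integrand p = 0"
proof -
  assume "\<not> is_pole integrand p"
  from nicely_meromorphic_on_imp_analytic_at[OF integrand_nice UNIV_I this]
  obtain S where "open S" "p \<in> S" "integrand holomorphic_on S" using analytic_at by blast
  thus ?thesis by (rule residue_holo)
qed

text \<open>Nodes that happen not to be poles may be included, since their residue is 0. The two
  sequences are disjoint because \<open>c - d\<close> is not an integer.\<close>
lemma node_partial_sums:
  "(\<Sum>p | p \<in> increasing_seq c \<union> increasing_seq d \<and> is_pole integrand p \<and> Re p < x. residue integrand p)
   = (\<Sum>n<nat \<lceil>x - Re c\<rceil>. residue integrand (c + of_nat n)) + (\<Sum>n<nat \<lceil>x - Re d\<rceil>. residue integrand (d + of_nat n))"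
proof -
  define S where "S = (\<lambda>y. (\<lambda>n. y + of_nat n :: complex) ` {..<nat \<lceil>x - Re y\<rceil>})"
  have S: "p \<in> S y \<longleftrightarrow> p \<in> increasing_seq y \<and> Re p < x" for p y
  proof -
    have n: "n < nat \<lceil>x - Re y\<rceil> \<longleftrightarrow> Re (y + of_nat n) < x" for n
      by (simp add: zless_nat_eq_int_zless less_ceiling_iff algebra_simps)
    show ?thesis
    proof
      assume "p \<in> S y"
      then obtain n where m: "n \<in> {..<nat \<lceil>x - Re y\<rceil>}" and p: "p = y + of_nat n" unfolding S_def by (elim imageE)
      hence "Re p < x" using n[of n] unfolding p lessThan_iff by simp
      thus "p \<in> increasing_seq y \<and> Re p < x" unfolding increasing_seq_def using p by blast
    next
      assume *: "p \<in> increasing_seq y \<and> Re p < x"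
      then obtain n where p: "p = y + of_nat n" unfolding increasing_seq_def by blast
      hence "n \<in> {..<nat \<lceil>x - Re y\<rceil>}" using * n[of n] unfolding lessThan_iff by simp
      thus "p \<in> S y" unfolding S_def p by (rule imageI)
    qed
  qed
  have disj: "S c \<inter> S d = {}"
  proof (rule ccontr)
    assume "S c \<inter> S d \<noteq> {}"
    then obtain n m :: nat where "c + of_nat n = d + of_nat m" by (auto simp: S_def)
    hence "c - d = of_int (int m - int n)" by (simp add: algebra_simps)
    thus False using cd sin_pi_eq_0_iff by blast
  qed
  have fin: "finite (S y)" for y by (simp add: S_def)
  have sumS: "(\<Sum>p\<in>S y. residue integrand p) = (\<Sum>n<nat \<lceil>x - Re y\<rceil>. residue integrand (y + of_nat n))" for y
    unfolding S_def by (subst sum.reindex) (auto simp: inj_on_def)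
  have "(\<Sum>p | p \<in> increasing_seq c \<union> increasing_seq d \<and> is_pole integrand p \<and> Re p < x. residue integrand p)
    = (\<Sum>p\<in>S c \<union> S d. residue integrand p)"
    by (rule sum.mono_neutral_left) (use fin S residue_zero in auto)
  also have "\<dots> = (\<Sum>p\<in>S c. residue integrand p) + (\<Sum>p\<in>S d. residue integrand p)"
    by (rule sum.union_disjoint[OF fin fin disj])
  finally show ?thesis unfolding sumS .
qed

lemma psi_nodes: "psi (c + of_nat n) = Pnum A B C D F G \<alpha> (C * q ^ n) / Pden A B F G (C * q ^ n)"
  "psi (d + of_nat n) = Pnum A B C D F G \<alpha> (D * q ^ n) / Pden A B F G (D * q ^ n)"
  unfolding psi_def num_def den_def by (simp_all add: qpow_add qpow_of_nat C_def D_def)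

section \<open>The evaluation of the integral\<close>

lemma countable_removed_values: "countable {z. barnes_integrand w a b c d e f g z \<noteq> integrand z}"
proof (rule no_limpt_imp_countable)
  fix z
  have "eventually (\<lambda>s. barnes_integrand w a b c d e f g s = integrand s) (at z)"
    using eventually_remove_sings_eq_at[OF meromorphic_on_isolated_singularity[OF barnes_meromorphic]]
    unfolding integrand_def by (rule eventually_mono) simp
  thus "\<not> z islimpt {z. barnes_integrand w a b c d e f g z \<noteq> integrand z}"
    by (simp add: islimpt_iff_eventually)
qed

text \<open>The hypotheses on contour and poles are exactly what the abstract residue theorem needs: by
  \<open>pole_location\<close>, a pole outside the increasing sequences is a zero of the denominator and
  so belongs to a decreasing sequence.\<close>
lemma barnes_integral_residue_limit:
  assumes "imaginary_contour \<gamma>"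
    and "separates_poles \<gamma> (barnes_integrand w a b c d e f g)
           (increasing_seq c \<union> increasing_seq d)
           (decreasing_seq w a \<union> decreasing_seq w b \<union> decreasing_seq w f \<union> decreasing_seq w g)"
  obtains J \<rho> where
    "((\<lambda>t. barnes_integrand w a b c d e f g (\<gamma> t) * vector_derivative \<gamma> (at t)) has_integral J) UNIV"
    "(\<lambda>m. \<Sum>p | p \<in> increasing_seq c \<union> increasing_seq d \<and> is_pole integrand p \<and> Re p < \<rho> + real m.
        residue integrand p) \<longlonglongrightarrow> - (J / (2 * pi * \<i>))"
proof -
  obtain L where L: "L-lipschitz_on UNIV \<gamma>" using assms(1) unfolding imaginary_contour_def by blast
  have "bounded (range (\<lambda>t. \<gamma> t - \<i> * of_real t))" using assms(1) unfolding imaginary_contour_def by blast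
  then obtain M where M: "\<And>t. norm (\<gamma> t - \<i> * of_real t) \<le> M" unfolding bounded_iff by blast
  interpret smooth_strip_curve \<gamma> M L
  proof
    show "continuous_on UNIV \<gamma>" using L by (rule lipschitz_on_continuous_on)
    show "\<And>T. \<gamma> piecewise_C1_differentiable_on {- T..T}" using assms(1) unfolding imaginary_contour_def by blast
  qed (rule M, rule L)
  \<comment> \<open>Above this height the sines are bounded below, and all nodes lie below it.\<close>
  define H where "H = \<bar>Im c\<bar> + \<bar>Im d\<bar> + 1"
  obtain \<beta> where \<beta>: "\<And>s. \<beta> \<le> Re s \<Longrightarrow> den (qpow w s) \<noteq> 0" using psi_right_bound by metis
  obtain \<rho> K where \<rho>: "max (\<beta> + 1) (M + 1) \<le> \<rho>" and K: "\<And>m y. \<not> is_pole integrand (Complex (\<rho> + real m) y)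
        \<and> norm (integrand (Complex (\<rho> + real m) y)) \<le> K * exp (- (w * real m))"
    using increasing_vertical[of "max (\<beta> + 1) (M + 1)"] by blast
  obtain \<epsilon> where \<epsilon>: "\<epsilon> > 0" "\<And>p t. is_pole integrand p \<Longrightarrow> \<epsilon> \<le> dist p (\<gamma> t)"
    using assms(2) unfolding separates_poles_def pole_iff(1)[symmetric] by blast
  interpret ci: decaying_integrand \<gamma> M L integrand V "increasing_seq c \<union> increasing_seq d" \<omega> H \<beta> \<rho> \<epsilon> w
  proof
    show "integrand nicely_meromorphic_on UNIV" by (rule integrand_nice)
    show "0 < \<omega>" by (rule \<omega>_pos)
    show "0 \<le> H" by (simp add: H_def)
    show "0 < \<epsilon>" by (rule \<epsilon>(1))
    show "0 < w" by (rule w)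
    show "\<not> z islimpt V" for z by (rule V_discrete)
    show "p + \<i> * of_real \<omega> \<in> V \<longleftrightarrow> p \<in> V" for p by (rule V_periodic)
    show "Re p \<le> \<beta>" if "p \<in> V" for p
    proof (rule ccontr)
      assume "\<not> Re p \<le> \<beta>"
      hence "den (qpow w p) \<noteq> 0" by (intro \<beta>) simp
      with den_nonzero_not_V that show False by blast
    qed
    show "is_pole integrand p \<longleftrightarrow> p \<in> V" if "H \<le> \<bar>Im p\<bar>" for p
      using that unfolding H_def by (rule pole_iff_V)
    show "\<epsilon> \<le> dist p (\<gamma> t)" if "is_pole integrand p" for p t by (rule \<epsilon>(2)[OF that])
    show "\<exists>K. \<forall>s. - M - 2 \<le> Re s \<longrightarrow> H \<le> \<bar>Im s\<bar> \<longrightarrow>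
        (\<forall>p\<in>V. \<delta> \<le> dist p s) \<longrightarrow> norm (integrand s) \<le> K * exp (- \<bar>Im s\<bar>)" if "0 < \<delta>" for \<delta>
      using integrand_decay[OF that, of "M + 2"] unfolding H_def by simp
    show "\<exists>K. \<forall>m y. \<not> is_pole integrand (Complex (\<rho> + real m) y)
        \<and> norm (integrand (Complex (\<rho> + real m) y)) \<le> K * exp (- (w * real m))"
      using K by blast
    show "\<beta> + 1 \<le> \<rho>" "M + 1 \<le> \<rho>" using \<rho> by simp_all
    show "\<bar>Im p\<bar> \<le> H" if "p \<in> increasing_seq c \<union> increasing_seq d" for p
      using that by (auto simp: increasing_seq_def H_def)
    show "lies_right_of p \<gamma>" if "p \<in> increasing_seq c \<union> increasing_seq d" "is_pole integrand p" for p
      using assms(2) that unfolding separates_poles_def pole_iff(1) by blast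
    show "lies_left_of p \<gamma>" if "p \<notin> increasing_seq c \<union> increasing_seq d" "is_pole integrand p" for p
    proof -
      have "den (qpow w p) = 0" using pole_location that by blast
      from den_zero[OF this] assms(2) that(2) show ?thesis unfolding separates_poles_def pole_iff(1) by blast
    qed
  qed
  have "((\<lambda>t. barnes_integrand w a b c d e f g (\<gamma> t) * vector_derivative \<gamma> (at t)) has_integral
      integral UNIV (\<lambda>t. integrand (\<gamma> t) * velocity t)) UNIV"
    using has_integral_modify_values[OF countable_removed_values, of "barnes_integrand w a b c d e f g" integrand]
      integrable_integral[OF ci.contour_integral_residues(1)] by blast
  thus thesis using ci.contour_integral_residues(2) by (rule that)
qed

text \<open>The limit of the residue sums is the difference of the two node series divided by \<open>sin
  (of_real pi * (d - c))\<close>, up to sign.\<close>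
lemma barnes_integral_value:
  assumes phi: "\<And>k. qpoch (qpow w (c + e + g)) (qpow w 1) k \<noteq> 0" "\<And>k. qpoch (qpow w (a + b + c + d)) (qpow w 1) k \<noteq> 0"
    and lim: "(\<lambda>m. \<Sum>p | p \<in> increasing_seq c \<union> increasing_seq d \<and> is_pole integrand p \<and> Re p < \<rho> + real m.
        residue integrand p) \<longlonglongrightarrow> - J'"
  shows "J' = qpow w c / sin (of_real pi * (d - c))
           * (qfacs w [1, 1 + c - d, d - c, a + b + c + d, a + c + d + f, b + c + d + f, c + e + g]
              / qfacs w [a + c, a + d, b + c, b + d, c + f, c + g, d + f])
           * phi32 (qpow w e) (qpow w (a + c)) (qpow w (b + c))
               (qpow w (c + e + g)) (qpow w (a + b + c + d)) (qpow w 1) (qpow w (d + g))"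
proof -
  define P where "P = (\<lambda>x. Pnum A B C D F G \<alpha> x / Pden A B F G x)"
  define \<sigma> where "\<sigma> = sin (of_real pi * (d - c))"
  have \<sigma>: "\<sigma> \<noteq> 0" "sin (of_real pi * (c - d)) = - \<sigma>" using sin_dc by (simp_all add: \<sigma>_def)
  have phi': "qfin (\<alpha> * C * G) k \<noteq> 0" "qfin (A * B * C * D) k \<noteq> 0" for k
    using phi[of k] by (simp_all add: params qpow_add mult_ac)
  note eval = node_sums_evaluation[OF param_nonzero(3,4,1) nz(1-6) small phi']
  have summ: "summable (\<lambda>n. P (C * q ^ n))" "summable (\<lambda>n. P (D * q ^ n))"
    unfolding P_def by (rule eval(1), rule eval(2))
  have P: "Pnum A B C D F G \<alpha> x / Pden A B F G x = P x" for x by (simp add: P_def)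
  note diff = eval(3)[unfolded P]
  have resC: "residue integrand (c + of_nat n) = - (P (C * q ^ n) / \<sigma>)" for n
    using residue_at_node[OF den_at_nodes(1) sin_dc(1) reg_quotient(1)] unfolding psi_nodes P_def \<sigma>_def .
  have resD: "residue integrand (d + of_nat n) = P (D * q ^ n) / \<sigma>" for n
    using residue_at_node[OF den_at_nodes(2) cd reg_quotient(2)] unfolding psi_nodes P_def \<sigma>(2) by simp
  have idx: "filterlim (\<lambda>m. nat \<lceil>\<rho> + real m - y\<rceil>) at_top at_top" for y
    by real_asymp
  have "(\<lambda>m. (\<Sum>n<nat \<lceil>\<rho> + real m - Re c\<rceil>. P (C * q ^ n))) \<longlonglongrightarrow> (\<Sum>n. P (C * q ^ n))"
    by (rule filterlim_compose[OF summable_LIMSEQ[OF summ(1)] idx])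
  moreover have "(\<lambda>m. (\<Sum>n<nat \<lceil>\<rho> + real m - Re d\<rceil>. P (D * q ^ n))) \<longlonglongrightarrow> (\<Sum>n. P (D * q ^ n))"
    by (rule filterlim_compose[OF summable_LIMSEQ[OF summ(2)] idx])
  ultimately have "(\<lambda>m. - (\<Sum>n<nat \<lceil>\<rho> + real m - Re c\<rceil>. P (C * q ^ n)) / \<sigma> + (\<Sum>n<nat \<lceil>\<rho> + real m - Re d\<rceil>. P (D * q ^ n)) / \<sigma>)
     \<longlonglongrightarrow> - (\<Sum>n. P (C * q ^ n)) / \<sigma> + (\<Sum>n. P (D * q ^ n)) / \<sigma>"
    by (intro tendsto_intros \<sigma>)
  moreover have "(\<Sum>p | p \<in> increasing_seq c \<union> increasing_seq d \<and> is_pole integrand p \<and> Re p < x. residue integrand p)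
    = - (\<Sum>n<nat \<lceil>x - Re c\<rceil>. P (C * q ^ n)) / \<sigma> + (\<Sum>n<nat \<lceil>x - Re d\<rceil>. P (D * q ^ n)) / \<sigma>" for x
    unfolding node_partial_sums resC resD by (simp add: sum_negf sum_divide_distrib)
  ultimately have "- J' = - (\<Sum>n. P (C * q ^ n)) / \<sigma> + (\<Sum>n. P (D * q ^ n)) / \<sigma>"
    using lim LIMSEQ_unique by (simp only:)
  hence "- J' = - (((\<Sum>n. P (C * q ^ n)) - (\<Sum>n. P (D * q ^ n))) / \<sigma>)"
    by (simp add: diff_divide_distrib)
  hence "J' = ((\<Sum>n. P (C * q ^ n)) - (\<Sum>n. P (D * q ^ n))) / \<sigma>"
    by (simp only: neg_equal_iff_equal)
  moreover have "qfacs w [1, 1 + c - d, d - c, a + b + c + d, a + c + d + f, b + c + d + f, c + e + g]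
     = qinf q * qinf (q * C / D) * qinf (D / C) * qinf (A * B * C * D) * qinf (A * C * D * F)
         * qinf (B * C * D * F) * qinf (\<alpha> * C * G)"
    unfolding qfacs_def params by (simp add: qpow_add qpow_diff mult_ac)
  moreover have "qfacs w [a + c, a + d, b + c, b + d, c + f, c + g, d + f]
     = qinf (A * C) * qinf (A * D) * qinf (B * C) * qinf (B * D) * qinf (F * C) * qinf (C * G) * qinf (F * D)"
    unfolding qfacs_def params by (simp add: qpow_add mult_ac)
  moreover have "qpow w e = \<alpha>" "qpow w c = C" "qpow w (a + c) = A * C" "qpow w (b + c) = B * C" "qpow w (c + e + g) = \<alpha> * C * G"
      "qpow w (a + b + c + d) = A * B * C * D" "qpow w (d + g) = D * G"
    unfolding params by (simp_all add: qpow_add mult_ac)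
  ultimately show ?thesis unfolding diff \<sigma>_def by simp
qed

end

theorem theorem7p3:
  fixes w :: real and a b c d e f g :: complex and \<gamma> :: "real \<Rightarrow> complex"
  assumes "w > 0"
    and "Max {norm (qpow w f), norm (qpow w g), norm (qpow w (c + f)), norm (qpow w (c + g)),
              norm (qpow w (d + f)), norm (qpow w (d + g)), norm (qpow w (c + d + f + g))} < 1"
    and "sin (of_real pi * (c - d)) \<noteq> 0"
    and "qfacs w [a + c, a + d, b + c, b + d, c + f, c + g, d + f] \<noteq> 0"
    and "\<And>k. qpoch (qpow w (c + e + g)) (qpow w 1) k \<noteq> 0"
    and "\<And>k. qpoch (qpow w (a + b + c + d)) (qpow w 1) k \<noteq> 0"
    and "imaginary_contour \<gamma>"
    and "separates_poles \<gamma> (barnes_integrand w a b c d e f g)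
           (increasing_seq c \<union> increasing_seq d)
           (decreasing_seq w a \<union> decreasing_seq w b \<union> decreasing_seq w f \<union> decreasing_seq w g)"
  shows "(\<lambda>t. barnes_integrand w a b c d e f g (\<gamma> t) * vector_derivative \<gamma> (at t))
           integrable_on UNIV \<and>
         1 / (2 * of_real pi * \<i>) *
           integral UNIV
             (\<lambda>t. barnes_integrand w a b c d e f g (\<gamma> t) * vector_derivative \<gamma> (at t))
         = qpow w c / sin (of_real pi * (d - c))
           * (qfacs w [1, 1 + c - d, d - c, a + b + c + d, a + c + d + f, b + c + d + f, c + e + g]
              / qfacs w [a + c, a + d, b + c, b + d, c + f, c + g, d + f])
           * phi32 (qpow w e) (qpow w (a + c)) (qpow w (b + c))
               (qpow w (c + e + g)) (qpow w (a + b + c + d)) (qpow w 1) (qpow w (d + g))"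
proof -
  interpret barnes_parameters w a b c d e f g
  proof
    show "norm (qpow w (c + g)) < 1" "norm (qpow w (d + g)) < 1" "norm (qpow w (c + d + f + g)) < 1"
      using assms(2) by (simp_all only: Max_less_iff finite.intros insert_not_empty ball_simps not_False_eq_True)
  qed (fact assms)+
  obtain J \<rho> where
    J: "((\<lambda>t. barnes_integrand w a b c d e f g (\<gamma> t) * vector_derivative \<gamma> (at t)) has_integral J) UNIV"
    and lim: "(\<lambda>m. \<Sum>p | p \<in> increasing_seq c \<union> increasing_seq d \<and> is_pole integrand p \<and> Re p < \<rho> + real m.
        residue integrand p) \<longlonglongrightarrow> - (J / (2 * pi * \<i>))"
    by (rule barnes_integral_residue_limit[OF assms(7,8)])
  show ?thesis
    using has_integral_integrable[OF J] barnes_integral_value[OF assms(5,6) lim]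
    unfolding integral_unique[OF J] by simp
qed

end
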